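(* Let $N\subseteq M$ be an inclusion as in Case (1) or Case (2), with Markov trace $tr$ of modulus $\tau$, let $E_N:M\to N$ be the $tr$-preserving conditional expectation, and let $\{\lambda_i : i\in\{1,2,\dots,n\}\}$ be a basis for $M/N$. Let $P$ be a $II_1$ factor in Case (1), or a finite dimensional $C^*$-algebra in Case (2), such that $P$ contains $M$ and also contains a projection $f$ with $\sum_{i=1}^n\lambda_i^*f\lambda_i=1$, and suppose that the following hold: 1) $fxf=E_N(x)f$ for all $x\in M$; 2) $\{\tau^{-1/2}f\lambda_i : 1\le i\le n\}$ is a basis for $P/M$ (where $M\subseteq P$ is a finite index inclusion of $II_1$ factors in Case (1), or a connected inclusion in Case (2)). In Case (2) suppose in addition that 3) the map $N\to P$, $x\mapsto xf$, is injective. Then there exists an isomorphism from $M_1=\langle M,e_1\rangle$ onto $P$ which maps $e_1$ to $f$.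
   Context: All inclusions are unital inclusions of finite von Neumann algebras with a faithful normal tracial state. Isomorphism means $*$-isomorphism. For an inclusion $A\subseteq B$ with trace $tr$ on $B$, $\langle B,e_A\rangle$ denotes Jones' basic construction, generated on $L^2(B,tr)$ by $B$ and the orthogonal projection $e_A$ onto $L^2(A,tr)$ (the Jones projection); for $N\subseteq M$ write $e_1=e_N$ and $M_1=\langle M,e_1\rangle$. The trace $tr$ on $B$ is a Markov trace of modulus $\sigma$ if it extends to a positive trace $Tr$ on $\langle B,e_A\rangle$ with $Tr(xe_A)=\sigma\,tr(x)$ for $x\in B$. Case (1): $A\subseteq B$ are $II_1$ factors with $[B:A]<\infty$; there is a unique Markov trace, with modulus $[B:A]^{-1}$. Case (2): $A\subseteq B$ is a connected unital inclusion of finite dimensional $C^*$-algebras (connected Bratteli diagram) with inclusion matrix $G$; there is a unique normalized Markov trace, with modulus $\|G\|^{-2}$. Definition (basis). Let $A\subseteq B$ be as in Case (1) or (2), with Markov trace $tr$ of modulus $\sigma$ and $tr$-preserving conditional expectation $E_A:B\to A$. A finite family $\{\lambda_i\}_{i=1}^n\subseteq B$ is a basis for $B/A$ if it satisfies one of the following conditions (which are equivalent): (i) the matrix $Q=(E_A(\lambda_i\lambda_j^* ))_{i,j}$ is a projection in $M_n(A)$ with $tr_{M_n(A)}(Q)=\sigma^{-1}/n$, where $tr_{M_n(A)}$ is the normalized trace $\frac1n\sum_i tr(a_{ii})$; (ii) $\sum_i\lambda_i^*e_A\lambda_i=1$; (iii) $x=\sum_i E_A(x\lambda_i^* )\lambda_i$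 for every $x\in B$. *)

theory Defs
  imports "HOL-Analysis.Analysis"
begin

section \<open>Complex Hilbert spaces and bounded operators\<close>

class scaleC =
  fixes scaleC :: "complex \<Rightarrow> 'a \<Rightarrow> 'a"  (infixr \<open>*\<^sub>C\<close> 75)

text \<open>The inner product is linear in its first argument.\<close>

class complex_hilbert_space = scaleC + banach +
  fixes cinner :: "'a \<Rightarrow> 'a \<Rightarrow> complex"
  assumes scaleC_add_right: "c *\<^sub>C (x + y) = c *\<^sub>C x + c *\<^sub>C y"
    and scaleC_add_left: "(c + d) *\<^sub>C x = c *\<^sub>C x + d *\<^sub>C x"
    and scaleC_scaleC: "c *\<^sub>C d *\<^sub>C x = (c * d) *\<^sub>C x"
    and scaleC_of_real: "complex_of_real r *\<^sub>C x = r *\<^sub>R x"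
    and cinner_commute: "cinner x y = cnj (cinner y x)"
    and cinner_add_left: "cinner (x + y) z = cinner x z + cinner y z"
    and cinner_scaleC_left: "cinner (c *\<^sub>C x) y = c * cinner x y"
    and cinner_self_nonneg: "cinner x x \<in> \<real>\<^sub>\<ge>\<^sub>0"
    and norm_eq_sqrt_cinner: "norm x = sqrt (Re (cinner x x))"

instantiation complex :: complex_hilbert_space
begin

definition scaleC_complex :: "complex \<Rightarrow> complex \<Rightarrow> complex"
  where "scaleC_complex c x = c * x"

definition cinner_complex :: "complex \<Rightarrow> complex \<Rightarrow> complex"
  where "cinner_complex x y = x * cnj y"

instance
  by standard
    (auto simp: scaleC_complex_def cinner_complex_def algebra_simps scaleR_conv_of_real
      complex_nonneg_Reals_iff cmod_def power2_eq_square)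

end

typedef (overloaded) 'a bop =
  "{T :: 'a::complex_hilbert_space \<Rightarrow> 'a.
      bounded_linear T \<and> (\<forall>c x. T (c *\<^sub>C x) = c *\<^sub>C T x)}"
  morphisms op_apply Bop
proof
  show "(\<lambda>x. x) \<in> {T :: 'a \<Rightarrow> 'a. bounded_linear T \<and> (\<forall>c x. T (c *\<^sub>C x) = c *\<^sub>C T x)}"
    by (simp add: bounded_linear_ident)
qed

setup_lifting type_definition_bop

lemma scaleC_uminus_right: "c *\<^sub>C (- x) = - (c *\<^sub>C (x :: 'a::complex_hilbert_space))"
proof -
  have "c *\<^sub>C (- x) = c *\<^sub>C (complex_of_real (- 1) *\<^sub>C x)"
    by (simp only: scaleC_of_real) simp
  also have "\<dots> = complex_of_real (- 1) *\<^sub>C (c *\<^sub>C x)"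
    by (simp only: scaleC_scaleC mult.commute)
  also have "\<dots> = - (c *\<^sub>C x)"
    by (simp only: scaleC_of_real) simp
  finally show ?thesis .
qed

lemma scaleC_zero_right: "c *\<^sub>C (0 :: 'a::complex_hilbert_space) = 0"
  using scaleC_add_right[of c "0::'a" 0] by simp

lemma scaleC_diff_right: "c *\<^sub>C (x - y) = c *\<^sub>C x - c *\<^sub>C (y :: 'a::complex_hilbert_space)"
  using scaleC_add_right[of c x "- y"] by (simp add: scaleC_uminus_right)

lemma bounded_linear_scaleC: "bounded_linear (\<lambda>x :: 'a::complex_hilbert_space. c *\<^sub>C x)"
proof (rule bounded_linear_intro[of _ "cmod c"])
  fix x y :: 'a and r :: real
  show "c *\<^sub>C (x + y) = c *\<^sub>C x + c *\<^sub>C y"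
    by (rule scaleC_add_right)
  show "c *\<^sub>C r *\<^sub>R x = r *\<^sub>R c *\<^sub>C x"
    by (simp only: scaleC_of_real[symmetric] scaleC_scaleC mult.commute)
  have "cinner (c *\<^sub>C x) (c *\<^sub>C x) = c * cnj (c * cinner x x)"
    by (metis cinner_commute cinner_scaleC_left)
  also have "\<dots> = of_real ((cmod c)\<^sup>2) * cinner x x"
    using cinner_commute[of x x] by (simp only: complex_cnj_mult complex_norm_square mult.assoc)
  finally have "Re (cinner (c *\<^sub>C x) (c *\<^sub>C x)) = (cmod c)\<^sup>2 * Re (cinner x x)"
    by simp
  then show "norm (c *\<^sub>C x) \<le> norm x * cmod c"
    by (simp add: norm_eq_sqrt_cinner[of x] norm_eq_sqrt_cinner[of "c *\<^sub>C x"] real_sqrt_mult)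
qed

instantiation bop :: (complex_hilbert_space) "{ring, monoid_mult, scaleC}"
begin

lift_definition zero_bop :: "'a bop" is "\<lambda>_. 0"
  by (simp add: scaleC_zero_right)

lift_definition one_bop :: "'a bop" is "\<lambda>x. x"
  by (simp add: bounded_linear_ident)

lift_definition plus_bop :: "'a bop \<Rightarrow> 'a bop \<Rightarrow> 'a bop" is "\<lambda>S T x. S x + T x"
  by (simp add: bounded_linear_add scaleC_add_right)

lift_definition uminus_bop :: "'a bop \<Rightarrow> 'a bop" is "\<lambda>T x. - T x"
  by (simp add: bounded_linear_minus scaleC_uminus_right)

lift_definition minus_bop :: "'a bop \<Rightarrow> 'a bop \<Rightarrow> 'a bop" is "\<lambda>S T x. S x - T x"
  by (simp add: bounded_linear_sub scaleC_diff_right)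

lift_definition times_bop :: "'a bop \<Rightarrow> 'a bop \<Rightarrow> 'a bop" is "\<lambda>S T x. S (T x)"
  by (auto intro: bounded_linear_compose)

lift_definition scaleC_bop :: "complex \<Rightarrow> 'a bop \<Rightarrow> 'a bop" is "\<lambda>c T x. c *\<^sub>C T x"
  by (auto intro: bounded_linear_compose[OF bounded_linear_scaleC]
      simp: scaleC_scaleC mult.commute)

instance
  by standard
    (transfer; auto simp: fun_eq_iff linear_add[OF bounded_linear.linear] algebra_simps)+

end

text \<open>Hilbert space adjoint.\<close>

definition adj :: "'a::complex_hilbert_space bop \<Rightarrow> 'a bop" where
  "adj x = (THE y. \<forall>\<xi> \<eta>. cinner (op_apply x \<xi>) \<eta> = cinner \<xi> (op_apply y \<eta>))"

definition is_projection :: "'a::complex_hilbert_space bop \<Rightarrow> bool" where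
  "is_projection p \<longleftrightarrow> adj p = p \<and> p * p = p"

definition proj_onto :: "'a::complex_hilbert_space set \<Rightarrow> 'a bop" where
  "proj_onto S = (THE p. is_projection p \<and> range (op_apply p) = S)"

definition positive_op :: "'a::complex_hilbert_space bop \<Rightarrow> bool" where
  "positive_op x \<longleftrightarrow> (\<forall>\<xi>. cinner (op_apply x \<xi>) \<xi> \<in> \<real>\<^sub>\<ge>\<^sub>0)"


section \<open>Von Neumann algebras and traces\<close>

definition commutant :: "'a::complex_hilbert_space bop set \<Rightarrow> 'a bop set" where
  "commutant S = {T. \<forall>x\<in>S. T * x = x * T}"

text \<open>A self-adjoint set equal to its bicommutant is a complex subalgebra containing \<open>1\<close>.
  In particular all inclusions of von Neumann algebras on the same Hilbert space are unital.\<close>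

definition von_neumann_algebra :: "'a::complex_hilbert_space bop set \<Rightarrow> bool" where
  "von_neumann_algebra A \<longleftrightarrow> adj ` A \<subseteq> A \<and> commutant (commutant A) = A"

definition center :: "'a::complex_hilbert_space bop set \<Rightarrow> 'a bop set" where
  "center A = A \<inter> commutant A"

definition finite_dim :: "'a::complex_hilbert_space bop set \<Rightarrow> bool" where
  "finite_dim A \<longleftrightarrow> (\<exists>F. finite F \<and> F \<subseteq> A \<and> (\<forall>x\<in>A. \<exists>c. x = (\<Sum>y\<in>F. c y *\<^sub>C y)))"

definition linear_functional_on ::
    "'a::complex_hilbert_space bop set \<Rightarrow> ('a bop \<Rightarrow> complex) \<Rightarrow> bool" where
  "linear_functional_on A \<phi> \<longleftrightarrow>
     (\<forall>x\<in>A. \<forall>y\<in>A. \<phi> (x + y) = \<phi> x + \<phi> y) \<and>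
     (\<forall>c. \<forall>x\<in>A. \<phi> (c *\<^sub>C x) = c * \<phi> x)"

definition positive_trace ::
    "'a::complex_hilbert_space bop set \<Rightarrow> ('a bop \<Rightarrow> complex) \<Rightarrow> bool" where
  "positive_trace A \<phi> \<longleftrightarrow> linear_functional_on A \<phi> \<and>
     (\<forall>x\<in>A. \<phi> (adj x * x) \<in> \<real>\<^sub>\<ge>\<^sub>0) \<and>
     (\<forall>x\<in>A. \<forall>y\<in>A. \<phi> (x * y) = \<phi> (y * x))"

text \<open>Normality is ultraweak (\<open>\<sigma>\<close>-weak) continuity: the ultraweakly continuous linear functionals
  are exactly those of the following form.\<close>

definition normal_functional ::
    "'a::complex_hilbert_space bop set \<Rightarrow> ('a bop \<Rightarrow> complex) \<Rightarrow> bool" where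
  "normal_functional A \<phi> \<longleftrightarrow>
     (\<exists>\<xi> \<eta> :: nat \<Rightarrow> 'a.
        summable (\<lambda>k. (norm (\<xi> k))\<^sup>2) \<and> summable (\<lambda>k. (norm (\<eta> k))\<^sup>2) \<and>
        (\<forall>x\<in>A. (\<lambda>k. cinner (op_apply x (\<xi> k)) (\<eta> k)) sums \<phi> x))"

definition faithful_normal_tracial_state ::
    "'a::complex_hilbert_space bop set \<Rightarrow> ('a bop \<Rightarrow> complex) \<Rightarrow> bool" where
  "faithful_normal_tracial_state A tr \<longleftrightarrow>
     positive_trace A tr \<and> tr 1 = 1 \<and> normal_functional A tr \<and>
     (\<forall>x\<in>A. tr (adj x * x) = 0 \<longrightarrow> x = 0)"

definition II1_factor :: "'a::complex_hilbert_space bop set \<Rightarrow> bool" where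
  "II1_factor A \<longleftrightarrow> von_neumann_algebra A \<and> center A = range (\<lambda>c. c *\<^sub>C 1) \<and>
     \<not> finite_dim A \<and> (\<exists>tr. faithful_normal_tracial_state A tr)"

definition conditional_expectation ::
    "'a::complex_hilbert_space bop set \<Rightarrow> 'a bop set \<Rightarrow> ('a bop \<Rightarrow> complex) \<Rightarrow> ('a bop \<Rightarrow> 'a bop) \<Rightarrow> bool"
  where
  "conditional_expectation A B tr E \<longleftrightarrow>
     (\<forall>x\<in>B. E x \<in> A) \<and> (\<forall>a\<in>A. E a = a) \<and>
     (\<forall>x\<in>B. \<forall>y\<in>B. E (x + y) = E x + E y) \<and>
     (\<forall>c. \<forall>x\<in>B. E (c *\<^sub>C x) = c *\<^sub>C E x) \<and>
     (\<forall>a\<in>A. \<forall>x\<in>B. \<forall>b\<in>A. E (a * x * b) = a * E x * b) \<and>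
     (\<forall>x\<in>B. positive_op (E (adj x * x))) \<and>
     (\<forall>x\<in>B. tr (E x) = tr x)"

definition star_isomorphism ::
    "('a::complex_hilbert_space bop \<Rightarrow> 'b::complex_hilbert_space bop) \<Rightarrow> 'a bop set \<Rightarrow> 'b bop set \<Rightarrow> bool"
  where
  "star_isomorphism \<Phi> A B \<longleftrightarrow> bij_betw \<Phi> A B \<and>
     (\<forall>x\<in>A. \<forall>y\<in>A. \<Phi> (x + y) = \<Phi> x + \<Phi> y \<and> \<Phi> (x * y) = \<Phi> x * \<Phi> y) \<and>
     (\<forall>c. \<forall>x\<in>A. \<Phi> (c *\<^sub>C x) = c *\<^sub>C \<Phi> x) \<and>
     (\<forall>x\<in>A. \<Phi> (adj x) = adj (\<Phi> x))"


section \<open>The GNS space and the basic construction\<close>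

text \<open>\<open>GNS_space B tr \<Lambda>\<close> says that the Hilbert space \<open>'k\<close>, together with the canonical map
  \<open>\<Lambda> : B \<rightarrow> 'k\<close>, is \<open>L\<^sup>2(B, tr)\<close>, i.e. the completion of \<open>B\<close> for the inner product
  \<open>(x, y) \<mapsto> tr(y\<^sup>* x)\<close>. The space is a parameter because a type cannot depend on \<open>B\<close> and
  \<open>tr\<close>; the pair is determined up to a unique unitary.\<close>

definition GNS_space ::
    "'h::complex_hilbert_space bop set \<Rightarrow> ('h bop \<Rightarrow> complex) \<Rightarrow> ('h bop \<Rightarrow> 'k::complex_hilbert_space) \<Rightarrow> bool"
  where
  "GNS_space B tr \<Lambda> \<longleftrightarrow>
     (\<forall>x\<in>B. \<forall>y\<in>B. \<Lambda> (x + y) = \<Lambda> x + \<Lambda> y) \<and>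
     (\<forall>c. \<forall>x\<in>B. \<Lambda> (c *\<^sub>C x) = c *\<^sub>C \<Lambda> x) \<and>
     (\<forall>x\<in>B. \<forall>y\<in>B. cinner (\<Lambda> x) (\<Lambda> y) = tr (adj y * x)) \<and>
     closure (\<Lambda> ` B) = UNIV"

definition left_mult ::
    "('h::complex_hilbert_space bop \<Rightarrow> 'k::complex_hilbert_space) \<Rightarrow> 'h bop set \<Rightarrow> 'h bop \<Rightarrow> 'k bop" where
  "left_mult \<Lambda> B x = (THE T. \<forall>y\<in>B. op_apply T (\<Lambda> y) = \<Lambda> (x * y))"

text \<open>\<open>L\<^sup>2(A, tr)\<close> is the closure of \<open>A\<close> inside \<open>L\<^sup>2(B, tr)\<close>.\<close>

definition jones_projection ::
    "('h::complex_hilbert_space bop \<Rightarrow> 'k::complex_hilbert_space) \<Rightarrow> 'h bop set \<Rightarrow> 'k bop" where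
  "jones_projection \<Lambda> A = proj_onto (closure (\<Lambda> ` A))"

definition basic_construction ::
    "('h::complex_hilbert_space bop \<Rightarrow> 'k::complex_hilbert_space) \<Rightarrow> 'h bop set \<Rightarrow> 'h bop set \<Rightarrow> 'k bop set"
  where
  "basic_construction \<Lambda> A B =
     von_neumann_algebra hull (left_mult \<Lambda> B ` B \<union> {jones_projection \<Lambda> A})"

definition markov_trace ::
    "('h::complex_hilbert_space bop \<Rightarrow> 'k::complex_hilbert_space) \<Rightarrow> 'h bop set \<Rightarrow> 'h bop set \<Rightarrow>
     ('h bop \<Rightarrow> complex) \<Rightarrow> real \<Rightarrow> bool" where
  "markov_trace \<Lambda> A B tr \<sigma> \<longleftrightarrow> 0 < \<sigma> \<and>
     (\<exists>Tr. positive_trace (basic_construction \<Lambda> A B) Tr \<and>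
        (\<forall>x\<in>B. Tr (left_mult \<Lambda> B x) = tr x) \<and>
        (\<forall>x\<in>B. Tr (left_mult \<Lambda> B x * jones_projection \<Lambda> A) = complex_of_real \<sigma> * tr x))"


section \<open>The two kinds of inclusions\<close>

definition finite_vna :: "'a::complex_hilbert_space bop set \<Rightarrow> bool" where
  "finite_vna A \<longleftrightarrow> von_neumann_algebra A \<and> (\<forall>v\<in>A. adj v * v = 1 \<longrightarrow> v * adj v = 1)"

definition the_trace :: "'a::complex_hilbert_space bop set \<Rightarrow> 'a bop \<Rightarrow> complex" where
  "the_trace A = (SOME tr. faithful_normal_tracial_state A tr)"

definition cyclic_projection :: "'a::complex_hilbert_space bop set \<Rightarrow> 'a \<Rightarrow> 'a bop" where
  "cyclic_projection A \<xi> = proj_onto (closure ((\<lambda>x. op_apply x \<xi>) ` A))"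

text \<open>The Murray--von Neumann coupling constant of a \<open>II\<^sub>1\<close> factor \<open>A\<close> on a Hilbert space. When the
  commutant is finite, the traces are unique and the quotient is the same for all nonzero \<open>\<xi>\<close>,
  so that neither choice matters.\<close>

definition vn_dimension :: "'a::complex_hilbert_space bop set \<Rightarrow> ennreal" where
  "vn_dimension A =
     (if finite_vna (commutant A)
      then let \<xi> = (SOME \<xi>. \<xi> \<noteq> 0) in
        ennreal (Re (the_trace A (cyclic_projection (commutant A) \<xi>)) /
                 Re (the_trace (commutant A) (cyclic_projection A \<xi>)))
      else \<infinity>)"

text \<open>The Jones index \<open>[B : A] = dim\<^sub>A L\<^sup>2(B, tr)\<close>.\<close>

definition jones_index ::
    "('h::complex_hilbert_space bop \<Rightarrow> 'k::complex_hilbert_space) \<Rightarrow> 'h bop set \<Rightarrow> 'h bop set \<Rightarrow> ennreal"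
  where
  "jones_index \<Lambda> A B = vn_dimension (left_mult \<Lambda> B ` A)"

definition finite_index_II1_inclusion ::
    "('h::complex_hilbert_space bop \<Rightarrow> 'k::complex_hilbert_space) \<Rightarrow> 'h bop set \<Rightarrow> 'h bop set \<Rightarrow> bool"
  where
  "finite_index_II1_inclusion \<Lambda> A B \<longleftrightarrow>
     A \<subseteq> B \<and> II1_factor A \<and> II1_factor B \<and> jones_index \<Lambda> A B < \<infinity>"

definition minimal_central_projections :: "'a::complex_hilbert_space bop set \<Rightarrow> 'a bop set" where
  "minimal_central_projections A =
     {p \<in> center A. is_projection p \<and> p \<noteq> 0 \<and>
        (\<forall>q\<in>center A. is_projection q \<and> q * p = q \<longrightarrow> q = 0 \<or> q = p)}"

text \<open>The Bratteli diagram of \<open>A \<subseteq> B\<close>: one vertex for each simple summand of \<open>A\<close> and of \<open>B\<close>. The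
  entry of the inclusion matrix at \<open>(p, q)\<close>, which is the number of edges joining \<open>p\<close> to \<open>q\<close>, is
  nonzero iff \<open>p q \<noteq> 0\<close>; the multiplicities are irrelevant for connectedness.\<close>

definition bratteli_vertices ::
    "'a::complex_hilbert_space bop set \<Rightarrow> 'a bop set \<Rightarrow> ('a bop + 'a bop) set" where
  "bratteli_vertices A B = minimal_central_projections A <+> minimal_central_projections B"

definition bratteli_edges ::
    "'a::complex_hilbert_space bop set \<Rightarrow> 'a bop set \<Rightarrow> ('a bop + 'a bop) rel" where
  "bratteli_edges A B =
     {(Inl p, Inr q) | p q.
        p \<in> minimal_central_projections A \<and> q \<in> minimal_central_projections B \<and> p * q \<noteq> 0}"

definition bratteli_connected ::
    "'a::complex_hilbert_space bop set \<Rightarrow> 'a bop set \<Rightarrow> bool" where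
  "bratteli_connected A B \<longleftrightarrow>
     (\<forall>u\<in>bratteli_vertices A B. \<forall>v\<in>bratteli_vertices A B.
        (u, v) \<in> (bratteli_edges A B \<union> (bratteli_edges A B)\<inverse>)\<^sup>*)"

text \<open>A finite dimensional unital \<open>C\<^sup>*\<close>-algebra of operators is the same as a finite dimensional
  von Neumann algebra.\<close>

definition connected_findim_inclusion ::
    "'a::complex_hilbert_space bop set \<Rightarrow> 'a bop set \<Rightarrow> bool" where
  "connected_findim_inclusion A B \<longleftrightarrow>
     A \<subseteq> B \<and> von_neumann_algebra A \<and> von_neumann_algebra B \<and>
     finite_dim A \<and> finite_dim B \<and> bratteli_connected A B"


section \<open>Bases\<close>

definition is_basis ::
    "('h::complex_hilbert_space bop \<Rightarrow> 'k::complex_hilbert_space) \<Rightarrow> 'h bop set \<Rightarrow> 'h bop set \<Rightarrow>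
     ('h bop \<Rightarrow> complex) \<Rightarrow> real \<Rightarrow> ('h bop \<Rightarrow> 'h bop) \<Rightarrow> nat \<Rightarrow> (nat \<Rightarrow> 'h bop) \<Rightarrow> bool" where
  "is_basis \<Lambda> A B tr \<sigma> E n lam \<longleftrightarrow>
     0 < n \<and> (\<forall>i\<in>{1..n}. lam i \<in> B) \<and>
     (let Q = (\<lambda>i j. E (lam i * adj (lam j))); e = jones_projection \<Lambda> A; \<pi> = left_mult \<Lambda> B in
        ((\<forall>i\<in>{1..n}. \<forall>j\<in>{1..n}. adj (Q j i) = Q i j \<and> (\<Sum>k=1..n. Q i k * Q k j) = Q i j) \<and>
           (\<Sum>i=1..n. tr (Q i i)) / of_nat n = complex_of_real (inverse \<sigma> / real n)) \<or>
        (\<Sum>i=1..n. adj (\<pi> (lam i)) * e * \<pi> (lam i)) = 1 \<or>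
        (\<forall>x\<in>B. x = (\<Sum>i=1..n. E (x * adj (lam i)) * lam i)))"

end

theory Submission
  imports Defs
begin

text \<open>A basis of \<open>M/N\<close> gives \<open>\<Sum> \<lambda>\<^sub>i\<^sup>* e\<^sub>1 \<lambda>\<^sub>i = 1\<close>, so an operator \<open>T\<close> in \<open>M\<^sub>1\<close> is determined by its
  corners \<open>e\<^sub>1 \<lambda>\<^sub>i T \<lambda>\<^sub>j\<^sup>* e\<^sub>1\<close>, and these lie in \<open>N e\<^sub>1\<close>; likewise an operator in \<open>P\<close> is determined by
  its corners with respect to \<open>f\<close>, which lie in \<open>N f\<close>. As \<open>N \<cong> N e\<^sub>1 \<cong> N f\<close>, equality of the matrices
  over \<open>N\<close> defines the isomorphism; it is onto because hypothesis 2) gives \<open>P = span M f M\<close>.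

  The analytic point is \<open>e\<^sub>1 M\<^sub>1 e\<^sub>1 = N e\<^sub>1\<close>. An operator \<open>R\<close> on \<open>L\<^sup>2(N)\<close> commuting with right
  multiplication by \<open>N\<close> commutes with \<open>W'\<^sup>* W\<close> for all \<open>N\<close>-linear \<open>W, W' : L\<^sup>2(N) \<rightarrow> H\<close>, so it
  transports to an operator on \<open>H\<close> in the bicommutant of \<open>N\<close>. Normality of the trace supplies enough
  such maps \<open>W\<close>, through \<open>\<ell>\<^sup>2 \<otimes> H\<close>.\<close>

section \<open>Complex Hilbert spaces\<close>

text \<open>\<open>M1\<close> is a \<open>hull\<close>, the least von Neumann algebra containing the
  generators, so what is directly known about an arbitrary element is what it commutes with, namely
  right multiplication by N. Finite sums of terms \<open>x e y\<close> cannot be assumed to exhaust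
  it; that they do is a consequence of the corner identity, because a basis cuts any operator into
  finitely many corners. The obstacle in that identity is that \<open>von_neumann_algebra\<close>
  speaks of the bicommutant on the original space H, while the corner acts on the GNS space, which
  is another type. A commutation theorem on L2(N) alone does not produce an element of N; it serves
  to make the transport to H well defined. Two bounds that usually come from functional calculus,
  for left multiplication and for the transported operator, both reduce to one numerical lemma on
  iterated Cauchy-Schwarz. The two cases part at the injectivity of \<open>x \<mapsto> x f\<close>
  on N: it comes from factoriality and \<open>f \<noteq> 0\<close> in Case (1), and is hypothesis 3)
  in Case (2). The factor \<open>\<tau>\<close> to the power -1/2 is absorbed into the coefficients
  from M when P is written as a span.\<close>

lemma cinner_self: "cinner x x = complex_of_real ((norm (x :: 'a::complex_hilbert_space))\<^sup>2)"
proof -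
  have "cinner x x \<in> \<real>\<^sub>\<ge>\<^sub>0" by (rule cinner_self_nonneg)
  then obtain r where r: "cinner x x = complex_of_real r" "r \<ge> 0"
    by (auto elim: nonneg_Reals_cases)
  have "norm x = sqrt r" using norm_eq_sqrt_cinner[of x] r by simp
  then show ?thesis using r by simp
qed

lemma Re_cinner_self: "Re (cinner x x) = (norm (x :: 'a::complex_hilbert_space))\<^sup>2"
  by (simp add: cinner_self)

lemma cinner_add_right: "cinner x (y + z) = cinner x y + cinner x (z :: 'a::complex_hilbert_space)"
  by (metis cinner_add_left cinner_commute complex_cnj_add)

lemma cinner_scaleC_right: "cinner x (c *\<^sub>C y) = cnj c * cinner x (y :: 'a::complex_hilbert_space)"
  by (metis cinner_commute cinner_scaleC_left complex_cnj_mult)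

lemma scaleC_one: "1 *\<^sub>C (x :: 'a::complex_hilbert_space) = x"
  using scaleC_of_real[of 1 x] by simp

lemma scaleC_minus_one: "(- 1) *\<^sub>C (x :: 'a::complex_hilbert_space) = - x"
  using scaleC_of_real[of "-1" x] by simp

lemma scaleC_zero_left: "0 *\<^sub>C (x :: 'a::complex_hilbert_space) = 0"
  using scaleC_of_real[of 0 x] by simp

lemma norm_add_sqr:
  "(norm (x + y))\<^sup>2 = (norm x)\<^sup>2 + (norm y)\<^sup>2 + 2 * Re (cinner x (y :: 'a::complex_hilbert_space))"
proof -
  have "Re (cinner y x) = Re (cinner x y)" using cinner_commute[of y x] by simp
  then show ?thesis
    by (simp add: Re_cinner_self[symmetric] cinner_add_left cinner_add_right)
qed

lemma norm_scaleC: "norm (c *\<^sub>C (x :: 'a::complex_hilbert_space)) = cmod c * norm x"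
proof -
  have "complex_of_real ((norm (c *\<^sub>C x))\<^sup>2) = complex_of_real ((cmod c * norm x)\<^sup>2)"
    unfolding cinner_self[symmetric] cinner_scaleC_left cinner_scaleC_right
    by (simp add: cinner_self power_mult_distrib complex_norm_square mult.commute del: of_real_power)
  then have "(norm (c *\<^sub>C x))\<^sup>2 = (cmod c * norm x)\<^sup>2" by (simp only: of_real_eq_iff)
  then show ?thesis by (simp add: power2_eq_iff_nonneg)
qed

lemma Cauchy_Schwarz: "cmod (cinner x y) \<le> norm x * norm (y :: 'a::complex_hilbert_space)"
proof (cases "y = 0")
  case True
  then show ?thesis using cinner_scaleC_right[of x 0 0] by (simp add: scaleC_zero_left)
next
  case False
  \<comment> \<open>The coefficient that minimises the norm of \<open>x + c y\<close>.\<close>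
  define c where "c = - cinner x y / complex_of_real ((norm y)\<^sup>2)"
  have "Re (cinner x (c *\<^sub>C y)) = - (cmod (cinner x y))\<^sup>2 / (norm y)\<^sup>2"
  proof -
    have "cnj c * cinner x y = - complex_of_real ((cmod (cinner x y))\<^sup>2) / complex_of_real ((norm y)\<^sup>2)"
      by (simp add: c_def complex_norm_square mult.commute del: of_real_power)
    then show ?thesis
      by (simp only: cinner_scaleC_right of_real_divide[symmetric] of_real_minus[symmetric] Re_complex_of_real)
  qed
  moreover have "(norm (c *\<^sub>C y))\<^sup>2 = (cmod (cinner x y))\<^sup>2 / (norm y)\<^sup>2"
    using False by (simp add: norm_scaleC c_def norm_divide power2_eq_square del: of_real_mult of_real_power)
  moreover have "0 \<le> (norm (x + c *\<^sub>C y))\<^sup>2" by simp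
  ultimately have "(cmod (cinner x y))\<^sup>2 / (norm y)\<^sup>2 \<le> (norm x)\<^sup>2"
    unfolding norm_add_sqr by simp
  then have "(cmod (cinner x y))\<^sup>2 \<le> (norm x * norm y)\<^sup>2"
    using False by (simp add: field_simps power_mult_distrib)
  then show ?thesis by (simp add: power2_le_iff_abs_le)
qed

interpretation cinner: bounded_bilinear "cinner :: 'a::complex_hilbert_space \<Rightarrow> 'a \<Rightarrow> complex"
proof
  fix x y z :: 'a and r :: real
  show "cinner (x + y) z = cinner x z + cinner y z" by (rule cinner_add_left)
  show "cinner x (y + z) = cinner x y + cinner x z" by (rule cinner_add_right)
  show "cinner (r *\<^sub>R x) y = r *\<^sub>R cinner x y"
    using cinner_scaleC_left[of "complex_of_real r" x y] by (simp add: scaleC_of_real scaleR_conv_of_real)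
  show "cinner x (r *\<^sub>R y) = r *\<^sub>R cinner x y"
    using cinner_scaleC_right[of x "complex_of_real r" y] by (simp add: scaleC_of_real scaleR_conv_of_real)
  show "\<exists>K. \<forall>a b :: 'a. cmod (cinner a b) \<le> norm a * norm b * K"
    by (intro exI[of _ 1] allI) (simp add: Cauchy_Schwarz)
qed

lemma cinner_eq_0_self: "cinner x x = 0 \<longleftrightarrow> (x :: 'a::complex_hilbert_space) = 0"
  by (simp add: cinner_self)

lemma cinner_eqI: "(\<And>z. cinner x z = cinner y z) \<Longrightarrow> (x :: 'a::complex_hilbert_space) = y"
  using cinner_eq_0_self[of "x - y"] by (simp add: cinner.diff_left)

lemma orthogonal_norm:
  "cinner x y = 0 \<Longrightarrow> (norm (x + y))\<^sup>2 = (norm x)\<^sup>2 + (norm (y :: 'a::complex_hilbert_space))\<^sup>2"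
  by (simp add: norm_add_sqr)

section \<open>Complex subspaces and the projection theorem\<close>

definition csubspace :: "'a::complex_hilbert_space set \<Rightarrow> bool" where
  "csubspace S \<longleftrightarrow> 0 \<in> S \<and> (\<forall>x\<in>S. \<forall>y\<in>S. x + y \<in> S) \<and> (\<forall>c. \<forall>x\<in>S. c *\<^sub>C x \<in> S)"

lemma csubspaceI:
  "0 \<in> S \<Longrightarrow> (\<And>x y. x \<in> S \<Longrightarrow> y \<in> S \<Longrightarrow> x + y \<in> S) \<Longrightarrow> (\<And>c x. x \<in> S \<Longrightarrow> c *\<^sub>C x \<in> S) \<Longrightarrow> csubspace S"
  by (simp add: csubspace_def)

lemma csubspaceD:
  assumes "csubspace S"
  shows "0 \<in> S" "x \<in> S \<Longrightarrow> y \<in> S \<Longrightarrow> x + y \<in> S" "x \<in> S \<Longrightarrow> c *\<^sub>C x \<in> S" "x \<in> S \<Longrightarrow> r *\<^sub>R x \<in> S"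
    "x \<in> S \<Longrightarrow> y \<in> S \<Longrightarrow> x - y \<in> S"
proof -
  show 1: "0 \<in> S" "x \<in> S \<Longrightarrow> y \<in> S \<Longrightarrow> x + y \<in> S" "x \<in> S \<Longrightarrow> c *\<^sub>C x \<in> S" for x y c
    using assms by (auto simp: csubspace_def)
  show "x \<in> S \<Longrightarrow> r *\<^sub>R x \<in> S" using 1(3)[of x "complex_of_real r"] by (simp add: scaleC_of_real)
  show "x \<in> S \<Longrightarrow> y \<in> S \<Longrightarrow> x - y \<in> S"
    using 1(2)[of x "- y"] 1(3)[of y "-1"] by (simp add: scaleC_minus_one)
qed

lemmas tendsto_scaleC = bounded_linear.tendsto[OF bounded_linear_scaleC]

lemma csubspace_closure: "csubspace S \<Longrightarrow> csubspace (closure S)"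
proof (rule csubspaceI)
  assume S: "csubspace S"
  show "0 \<in> closure S" using csubspaceD(1)[OF S] closure_subset by blast
  fix x assume x: "x \<in> closure S"
  then obtain u where u: "\<And>k. u k \<in> S" "u \<longlonglongrightarrow> x" by (auto simp: closure_sequential)
  show "c *\<^sub>C x \<in> closure S" for c
    unfolding closure_sequential using csubspaceD(3)[OF S u(1)] tendsto_scaleC[OF u(2)]
    by (intro exI[of _ "\<lambda>k. c *\<^sub>C u k"]) blast
  fix y assume y: "y \<in> closure S"
  then obtain v where v: "\<And>k. v k \<in> S" "v \<longlonglongrightarrow> y" by (auto simp: closure_sequential)
  show "x + y \<in> closure S"
    unfolding closure_sequential using csubspaceD(2)[OF S u(1) v(1)] tendsto_add[OF u(2) v(2)]
    by (intro exI[of _ "\<lambda>k. u k + v k"]) blast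
qed

lemma parallelogram:
  "(norm (x + y))\<^sup>2 + (norm (x - y))\<^sup>2 = 2 * (norm x)\<^sup>2 + 2 * (norm (y :: 'a::complex_hilbert_space))\<^sup>2"
  using norm_add_sqr[of x y] norm_add_sqr[of x "- y"] by (simp add: cinner.minus_right)

theorem orthogonal_projection_exists:
  fixes S :: "'a::complex_hilbert_space set"
  assumes S: "csubspace S" "closed S"
  shows "\<exists>y\<in>S. \<forall>z\<in>S. cinner (x - y) z = 0"
proof -
  define D where "D = (\<lambda>y. (norm (x - y))\<^sup>2) ` S"
  define d where "d = Inf D"
  have D: "D \<noteq> {}" "bdd_below D" using csubspaceD(1)[OF S(1)]
    by (auto simp: D_def intro!: bdd_belowI[of _ 0])
  have d_le: "d \<le> (norm (x - y))\<^sup>2" if "y \<in> S" for y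
    unfolding d_def using D that by (auto intro!: cInf_lower simp: D_def)
  have "\<exists>y\<in>S. (norm (x - y))\<^sup>2 < d + e" if "e > 0" for e
    using cInf_lessD[OF D(1), of "d + e"] that unfolding d_def D_def by auto
  then have "\<exists>y\<in>S. (norm (x - y))\<^sup>2 < d + inverse (real (Suc k))" for k by simp
  then obtain u where u: "\<And>k. u k \<in> S" "\<And>k. (norm (x - u k))\<^sup>2 < d + inverse (real (Suc k))" by metis
  \<comment> \<open>The midpoint of \<open>u j\<close> and \<open>u k\<close> lies in
    \<open>S\<close>, so its squared distance from \<open>x\<close> is at least \<open>d\<close>;
    the parallelogram law turns this into a bound on the gap.\<close>
  have diff: "(norm (u j - u k))\<^sup>2 \<le> 2 * inverse (real (Suc j)) + 2 * inverse (real (Suc k))" for j k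
  proof -
    have "(1/2) *\<^sub>R (u j + u k) \<in> S" by (intro csubspaceD[OF S(1)] u)
    from d_le[OF this] have "4 * d \<le> 4 * (norm (x - (1/2) *\<^sub>R (u j + u k)))\<^sup>2" by simp
    also have "\<dots> = (norm (2 *\<^sub>R (x - (1/2) *\<^sub>R (u j + u k))))\<^sup>2" by (simp add: power_mult_distrib)
    also have "2 *\<^sub>R (x - (1/2) *\<^sub>R (u j + u k)) = (x - u j) + (x - u k)"
      by (simp add: algebra_simps scaleR_2)
    finally have "4 * d \<le> (norm ((x - u j) + (x - u k)))\<^sup>2" .
    moreover have "norm ((x - u j) - (x - u k)) = norm (u j - u k)" by (simp add: norm_minus_commute)
    ultimately show ?thesis using parallelogram[of "x - u j" "x - u k"] u(2)[of j] u(2)[of k] by simp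
  qed
  have "Cauchy u"
  proof (rule metric_CauchyI)
    fix e :: real assume e: "e > 0"
    then obtain K where K: "inverse (real (Suc K)) < e\<^sup>2 / 4"
      using reals_Archimedean[of "e\<^sup>2 / 4"] by auto
    have inv: "inverse (real (Suc j)) \<le> inverse (real (Suc K))" if "j \<ge> K" for j using that by simp
    have "dist (u j) (u k) < e" if "j \<ge> K" "k \<ge> K" for j k
    proof -
      have "(norm (u j - u k))\<^sup>2 < e\<^sup>2" using diff[of j k] inv[OF that(1)] inv[OF that(2)] K by linarith
      then show ?thesis using e by (simp add: dist_norm power2_less_imp_less)
    qed
    then show "\<exists>K. \<forall>j\<ge>K. \<forall>k\<ge>K. dist (u j) (u k) < e" by blast
  qed
  then obtain y where y: "u \<longlonglongrightarrow> y" using Cauchy_convergent convergent_def by blast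
  have yS: "y \<in> S" using closed_sequentially[OF S(2)] u(1) y by blast
  have "(norm (x - y))\<^sup>2 \<le> d"
  proof (rule LIMSEQ_le)
    show "(\<lambda>k. (norm (x - u k))\<^sup>2) \<longlonglongrightarrow> (norm (x - y))\<^sup>2" by (intro tendsto_intros y)
    show "(\<lambda>k. d + inverse (real (Suc k))) \<longlonglongrightarrow> d"
      using tendsto_add[OF tendsto_const LIMSEQ_inverse_real_of_nat, of d] by simp
    show "\<exists>N. \<forall>k\<ge>N. (norm (x - u k))\<^sup>2 \<le> d + inverse (real (Suc k))" using u(2) less_imp_le by blast
  qed
  then have min: "(norm (x - y))\<^sup>2 \<le> (norm (x - z))\<^sup>2" if "z \<in> S" for z using d_le[OF that] by linarith
  have "cinner (x - y) z = 0" if z: "z \<in> S" for z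
  proof (cases "z = 0")
    case False
    \<comment> \<open>\<open>c z\<close> is the component of \<open>x - y\<close> along
      \<open>z\<close>; removing it would shorten \<open>x - y\<close>, so minimality forces it to
      vanish.\<close>
    define c where "c = cinner (x - y) z / complex_of_real ((norm z)\<^sup>2)"
    have "y + c *\<^sub>C z \<in> S" by (intro csubspaceD[OF S(1)] yS z)
    note le = min[OF this]
    have "(norm (x - y))\<^sup>2 \<le> (norm ((x - y) + (- c) *\<^sub>C z))\<^sup>2"
    proof -
      have "(- c) *\<^sub>C z = - (c *\<^sub>C z)"
        using scaleC_add_left[of c "- c" z] by (simp add: scaleC_zero_left eq_neg_iff_add_eq_0 add.commute)
      then show ?thesis using le by (simp add: diff_diff_eq)
    qed
    also have "\<dots> = (norm (x - y))\<^sup>2 + (cmod c * norm z)\<^sup>2 + 2 * Re (cnj (- c) * cinner (x - y) z)"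
      by (simp add: norm_add_sqr norm_scaleC cinner_scaleC_right)
    also have "cnj (- c) * cinner (x - y) z = - complex_of_real ((cmod c * norm z)\<^sup>2)"
    proof -
      have "cinner (x - y) z = c * complex_of_real ((norm z)\<^sup>2)" using False by (simp add: c_def)
      then show ?thesis
        by (simp add: power_mult_distrib complex_norm_square mult_ac del: of_real_power)
    qed
    finally have "(cmod c * norm z)\<^sup>2 \<le> 0" by simp
    then have "c = 0" using False by simp
    then show ?thesis using False by (simp add: c_def)
  qed (simp add: cinner.zero_right)
  then show ?thesis using yS by blast
qed

text \<open>\<open>bop\<close> consists of operators on one space; intertwiners, amplified vectors
  and their adjoints need maps between \<open>'k\<close>, \<open>'h\<close> and
  \<open>'h ell2\<close>.\<close>

definition bounded_clinear :: "('a::complex_hilbert_space \<Rightarrow> 'b::complex_hilbert_space) \<Rightarrow> bool" where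
  "bounded_clinear T \<longleftrightarrow> bounded_linear T \<and> (\<forall>c x. T (c *\<^sub>C x) = c *\<^sub>C T x)"

lemma bounded_clinearI:
  assumes "\<And>x y. T (x + y) = T x + T y" "\<And>c x. T (c *\<^sub>C x) = c *\<^sub>C T x" "\<And>x. norm (T x) \<le> C * norm x"
  shows "bounded_clinear T"
  unfolding bounded_clinear_def
proof (intro conjI allI)
  show "bounded_linear T"
    by (rule bounded_linear_intro[of _ C])
      (use assms in \<open>auto simp: scaleC_of_real[symmetric] mult.commute\<close>)
qed (rule assms)

lemma bounded_clinearD:
  assumes "bounded_clinear T"
  shows "bounded_linear T" "T (x + y) = T x + T y" "T (c *\<^sub>C x) = c *\<^sub>C T x" "T 0 = 0" "T (x - y) = T x - T y"
    "continuous_on UNIV T" "\<exists>C\<ge>0. \<forall>x. norm (T x) \<le> C * norm x"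
proof -
  show bl: "bounded_linear T" using assms by (simp add: bounded_clinear_def)
  interpret bounded_linear T by (rule bl)
  show "T (x + y) = T x + T y" "T 0 = 0" "T (x - y) = T x - T y" by (auto simp: add zero diff)
  show "continuous_on UNIV T" by (rule linear_continuous_on[OF bl])
  show "\<exists>C\<ge>0. \<forall>x. norm (T x) \<le> C * norm x" using nonneg_bounded by (auto simp: mult.commute)
  show "T (c *\<^sub>C x) = c *\<^sub>C T x" using assms by (simp add: bounded_clinear_def)
qed

lemma bounded_clinear_compose:
  "bounded_clinear S \<Longrightarrow> bounded_clinear T \<Longrightarrow> bounded_clinear (\<lambda>x. S (T x))"
  by (auto simp: bounded_clinear_def intro: bounded_linear_compose)

lemma bounded_clinear_op_apply [simp]: "bounded_clinear (op_apply T)"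
  using op_apply[of T] by (simp add: bounded_clinear_def)

lemma op_apply_Bop: "bounded_clinear T \<Longrightarrow> op_apply (Bop T) = T"
  by (rule Bop_inverse) (simp add: bounded_clinear_def)

lemma op_add: "op_apply T (x + y) = op_apply T x + op_apply T y"
  and op_diff: "op_apply T (x - y) = op_apply T x - op_apply T y"
  and op_zero: "op_apply T 0 = 0"
  and op_tendsto: "(f \<longlongrightarrow> x) F \<Longrightarrow> ((\<lambda>k. op_apply T (f k)) \<longlongrightarrow> op_apply T x) F"
  using bounded_clinearD[OF bounded_clinear_op_apply, of T]
  by (auto intro: bounded_linear.tendsto)

lemma op_scaleC: "op_apply T (c *\<^sub>C x) = c *\<^sub>C op_apply T x"
  using op_apply[of T] by simp

lemma op_norm_bound: "\<exists>C\<ge>0. \<forall>x. norm (op_apply T x) \<le> C * norm x"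
  by (rule bounded_clinearD(7)) simp

lemma op_eqI: "(\<And>x. op_apply S x = op_apply T x) \<Longrightarrow> S = T"
  by (metis op_apply_inject ext)

lemma op_simps [simp]:
  "op_apply (S + T) x = op_apply S x + op_apply T x" "op_apply (S - T) x = op_apply S x - op_apply T x"
  "op_apply (- T) x = - op_apply T x" "op_apply (S * T) x = op_apply S (op_apply T x)"
  "op_apply (c *\<^sub>C T) x = c *\<^sub>C op_apply T x" "op_apply 0 x = 0" "op_apply 1 x = x"
  by (transfer; simp)+

lemma op_sum: "op_apply (\<Sum>i\<in>I. T i) x = (\<Sum>i\<in>I. op_apply (T i) x)"
  by (induction I rule: infinite_finite_induct) auto

lemma bop_scaleC [simp]:
  fixes S T :: "'a::complex_hilbert_space bop"
  shows "(c *\<^sub>C S) * T = c *\<^sub>C (S * T)" "S * (c *\<^sub>C T) = c *\<^sub>C (S * T)" "c *\<^sub>C (S + T) = c *\<^sub>C S + c *\<^sub>C T"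
    "c *\<^sub>C d *\<^sub>C T = (c * d) *\<^sub>C T" "1 *\<^sub>C T = T" "0 *\<^sub>C T = 0" "c *\<^sub>C (0 :: 'a bop) = 0" "(- 1) *\<^sub>C T = - T"
  by (auto intro!: op_eqI simp: op_scaleC scaleC_add_right scaleC_scaleC scaleC_one scaleC_zero_left
      scaleC_zero_right scaleC_minus_one)

section \<open>Riesz representation, adjoints and projections as operators\<close>

theorem Riesz:
  fixes \<phi> :: "'a::complex_hilbert_space \<Rightarrow> complex"
  assumes "\<And>x y. \<phi> (x + y) = \<phi> x + \<phi> y" "\<And>c x. \<phi> (c *\<^sub>C x) = c * \<phi> x" "\<And>x. cmod (\<phi> x) \<le> C * norm x"
  shows "\<exists>y. \<forall>x. \<phi> x = cinner x y"
proof (cases "\<forall>x. \<phi> x = 0")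
  case True
  then show ?thesis by (intro exI[of _ 0]) (simp add: cinner.zero_right)
next
  case False
  have "bounded_clinear \<phi>"
    by (rule bounded_clinearI[of _ C]) (use assms in \<open>auto simp: scaleC_complex_def\<close>)
  note \<phi> = bounded_clinearD[OF this]
  define S where "S = \<phi> -` {0}"
  have S: "csubspace S"
    by (rule csubspaceI) (auto simp: S_def \<phi> scaleC_complex_def)
  have "closed S" unfolding S_def using continuous_on_closed_vimage[of UNIV \<phi>] \<phi>(6) by auto
  from False obtain x where x: "\<phi> x \<noteq> 0" by blast
  from orthogonal_projection_exists[OF S \<open>closed S\<close>] obtain y
    where y: "y \<in> S" "\<And>z. z \<in> S \<Longrightarrow> cinner (x - y) z = 0" by blast
  \<comment> \<open>\<open>w\<close> is orthogonal to the kernel \<open>S\<close>, which has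
    codimension one, so the representing vector has to be a multiple of \<open>w\<close>.\<close>
  define w where "w = x - y"
  have "\<phi> w = \<phi> x" using y(1) by (simp add: w_def \<phi> S_def)
  then have w: "\<phi> w \<noteq> 0" using x by simp
  then have w0: "w \<noteq> 0" using \<phi>(4) by auto
  have "\<phi> z = cinner z (cnj (\<phi> w / complex_of_real ((norm w)\<^sup>2)) *\<^sub>C w)" for z
  proof -
    have "z - (\<phi> z / \<phi> w) *\<^sub>C w \<in> S" using w by (simp add: S_def \<phi> scaleC_complex_def)
    then have "cinner w (z - (\<phi> z / \<phi> w) *\<^sub>C w) = 0" using y(2) by (simp add: w_def)
    then have "cinner (z - (\<phi> z / \<phi> w) *\<^sub>C w) w = 0" by (metis cinner_commute complex_cnj_zero)
    then have "cinner z w = (\<phi> z / \<phi> w) * complex_of_real ((norm w)\<^sup>2)"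
      by (simp only: cinner.diff_left cinner_scaleC_left cinner_self) simp
    then show ?thesis using w w0 by (simp add: cinner_scaleC_right)
  qed
  then show ?thesis by blast
qed

theorem adjoint_exists:
  fixes T :: "'a::complex_hilbert_space \<Rightarrow> 'b::complex_hilbert_space"
  assumes T: "bounded_clinear T"
  shows "\<exists>T'. bounded_clinear T' \<and> (\<forall>x y. cinner (T x) y = cinner x (T' y))"
proof -
  note TD = bounded_clinearD[OF T]
  obtain C where C: "C \<ge> 0" "\<And>x. norm (T x) \<le> C * norm x" using TD(7) by auto
  have "\<exists>z. \<forall>x. cinner (T x) y = cinner x z" for y
  proof (rule Riesz)
    show "cmod (cinner (T x) y) \<le> C * norm y * norm x" for x
      using order_trans[OF Cauchy_Schwarz mult_right_mono[OF C(2)], of y x] by (simp add: mult_ac)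
  qed (simp_all add: TD cinner_add_left cinner_scaleC_left)
  then obtain T' where T': "\<And>x y. cinner (T x) y = cinner x (T' y)" by metis
  have T'2: "cinner (T' y) x = cinner y (T x)" for x y by (metis T' cinner_commute)
  have "bounded_clinear T'"
  proof (rule bounded_clinearI[of _ C])
    fix y
    \<comment> \<open>The bound of \<open>T\<close> passes to its adjoint by testing
      \<open>T' y\<close> against itself.\<close>
    have "complex_of_real ((norm (T' y))\<^sup>2) = cinner (T (T' y)) y" by (simp add: T' cinner_self)
    then have "(norm (T' y))\<^sup>2 = cmod (cinner (T (T' y)) y)" by (metis norm_of_real abs_of_nonneg zero_le_power2)
    also have "\<dots> \<le> C * norm (T' y) * norm y"
      using order_trans[OF Cauchy_Schwarz mult_right_mono[OF C(2)]] by simp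
    finally have "norm (T' y) * norm (T' y) \<le> norm (T' y) * (C * norm y)" by (simp add: power2_eq_square mult_ac)
    then show "norm (T' y) \<le> C * norm y"
      using C(1) by (cases "T' y = 0") (simp_all add: mult_le_cancel_left)
  qed (rule cinner_eqI, simp add: T'2 cinner_add_left cinner_scaleC_left)+
  then show ?thesis using T' by blast
qed

lemma adj_exists_unique: "\<exists>!y. \<forall>\<xi> \<eta>. cinner (op_apply x \<xi>) \<eta> = cinner \<xi> (op_apply y \<eta>)"
proof -
  obtain T' where T': "bounded_clinear T'" "\<forall>\<xi> \<eta>. cinner (op_apply x \<xi>) \<eta> = cinner \<xi> (T' \<eta>)"
    using adjoint_exists[of "op_apply x"] by auto
  show ?thesis
  proof (rule ex1I[of _ "Bop T'"])
    show "\<forall>\<xi> \<eta>. cinner (op_apply x \<xi>) \<eta> = cinner \<xi> (op_apply (Bop T') \<eta>)"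
      using T' by (simp add: op_apply_Bop)
    fix y assume y: "\<forall>\<xi> \<eta>. cinner (op_apply x \<xi>) \<eta> = cinner \<xi> (op_apply y \<eta>)"
    show "y = Bop T'"
    proof (rule op_eqI, rule cinner_eqI)
      fix \<eta> z
      have "cinner z (op_apply y \<eta>) = cinner z (op_apply (Bop T') \<eta>)" using y T' by (simp add: op_apply_Bop)
      then show "cinner (op_apply y \<eta>) z = cinner (op_apply (Bop T') \<eta>) z" by (metis cinner_commute)
    qed
  qed
qed

lemma cinner_adj: "cinner (op_apply x \<xi>) \<eta> = cinner \<xi> (op_apply (adj x) \<eta>)"
  using theI'[OF adj_exists_unique[of x]] unfolding adj_def by blast

lemma cinner_adj2: "cinner (op_apply (adj x) \<xi>) \<eta> = cinner \<xi> (op_apply x \<eta>)"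
  by (metis cinner_adj cinner_commute)

lemma adj_eqI: "(\<And>\<xi> \<eta>. cinner (op_apply x \<xi>) \<eta> = cinner \<xi> (op_apply y \<eta>)) \<Longrightarrow> adj x = y"
  using the1_equality[OF adj_exists_unique[of x], of y] unfolding adj_def by blast

lemma adj_simps [simp]:
  "adj (adj x) = x" "adj (x * y) = adj y * adj x" "adj (x + y) = adj x + adj y"
  "adj (x - y) = adj x - adj y" "adj (c *\<^sub>C x) = cnj c *\<^sub>C adj x" "adj 1 = 1" "adj 0 = 0"
  by ((rule adj_eqI, simp add: cinner_adj2); fail | (rule adj_eqI, simp add: cinner_adj cinner_add_left
      cinner_add_right cinner.diff_left cinner.diff_right cinner_scaleC_left cinner_scaleC_right
      cinner.zero_left cinner.zero_right))+

lemma adj_sum: "adj (\<Sum>i\<in>I. T i) = (\<Sum>i\<in>I. adj (T i))"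
  by (induction I rule: infinite_finite_induct) auto

text \<open>The two compressions say that \<open>a\<close> and \<open>adj a\<close> leave the range
  of \<open>f\<close> invariant, so \<open>a\<close> also preserves its orthogonal complement. This
  is how the compression hypothesis makes \<open>f\<close> commute with N.\<close>

lemma compression_commutes:
  assumes "adj f = f" "f * a * f = a * f" "f * adj a * f = adj a * f"
  shows "f * a = a * f"
proof -
  have "f * a * f = f * a"
    using arg_cong[OF assms(3), of adj] by (simp add: assms(1) mult.assoc)
  then show ?thesis by (rule trans[OF sym assms(2)])
qed

lemma projection_range:
  assumes "is_projection p"
  shows "x \<in> range (op_apply p) \<longleftrightarrow> op_apply p x = x"
proof
  assume "x \<in> range (op_apply p)"
  then obtain y where "x = op_apply p y" by blast
  then show "op_apply p x = x" using assms by (simp add: is_projection_def flip: op_simps(4))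
qed (metis rangeI)

text \<open>Each projection fixes the range of the other, so \<open>p q = q\<close> and
  \<open>q p = p\<close>; adjoints identify them. This justifies the \<open>THE\<close> in
  \<open>proj_onto\<close>.\<close>

lemma projection_unique:
  assumes p: "is_projection p" and q: "is_projection q" and r: "range (op_apply p) = range (op_apply q)"
  shows "p = q"
proof -
  have "p * q = q"
    by (rule op_eqI) (use projection_range[OF p] r in auto)
  moreover have "q * p = p"
    by (rule op_eqI) (use projection_range[OF q] r in auto)
  moreover have "adj p = p" "adj q = q" using p q by (auto simp: is_projection_def)
  ultimately show ?thesis by (metis adj_simps(2))
qed

lemma proj_onto:
  assumes S: "csubspace S" "closed S"
  shows "is_projection (proj_onto S)" "range (op_apply (proj_onto S)) = S"
    "cinner (x - op_apply (proj_onto S) x) z = 0 \<or> z \<notin> S"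
proof -
  obtain P where P: "\<And>x. P x \<in> S" "\<And>x z. z \<in> S \<Longrightarrow> cinner (x - P x) z = 0"
    using orthogonal_projection_exists[OF S] by metis
  \<comment> \<open>Orthogonality of the remainder determines the point of \<open>S\<close>; the
    linearity of \<open>P\<close> is read off from this characterisation.\<close>
  have uniq: "P x = y" if "y \<in> S" "\<And>z. z \<in> S \<Longrightarrow> cinner (x - y) z = 0" for x y
  proof -
    have d: "P x - y \<in> S" by (intro csubspaceD[OF S(1)] P that)
    have "cinner (P x - y) (P x - y) = cinner (x - y) (P x - y) - cinner (x - P x) (P x - y)"
      by (simp add: cinner.diff_left[symmetric])
    also have "\<dots> = 0" using that(2)[OF d] P(2)[OF d] by simp
    finally show ?thesis by (simp add: cinner_eq_0_self)
  qed
  have blP: "bounded_clinear P"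
  proof (rule bounded_clinearI[of _ 1])
    fix x y c
    show "P (x + y) = P x + P y"
    proof (rule uniq)
      show "P x + P y \<in> S" by (intro csubspaceD[OF S(1)] P)
      have "x + y - (P x + P y) = (x - P x) + (y - P y)" by simp
      then show "cinner (x + y - (P x + P y)) z = 0" if "z \<in> S" for z
        using P(2)[OF that] by (simp only: cinner_add_left) simp
    qed
    show "P (c *\<^sub>C x) = c *\<^sub>C P x"
    proof (rule uniq)
      show "c *\<^sub>C P x \<in> S" by (intro csubspaceD[OF S(1)] P)
      show "cinner (c *\<^sub>C x - c *\<^sub>C P x) z = 0" if "z \<in> S" for z
        using P(2)[OF that] by (simp add: scaleC_diff_right[symmetric] cinner_scaleC_left)
    qed
    have "(norm (x - P x + P x))\<^sup>2 = (norm (x - P x))\<^sup>2 + (norm (P x))\<^sup>2"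
      by (rule orthogonal_norm) (rule P(2)[OF P(1)])
    then have "(norm (P x))\<^sup>2 \<le> (norm x)\<^sup>2" by simp
    then show "norm (P x) \<le> 1 * norm x" by simp
  qed
  define p where "p = Bop P"
  have ap: "op_apply p = P" using blP by (simp add: p_def op_apply_Bop)
  have fixP: "P x = x" if "x \<in> S" for x by (rule uniq) (use that in \<open>auto simp: cinner.zero_left\<close>)
  have "adj p = p"
  proof (rule adj_eqI)
    fix x y
    have "cinner (P x) (y - P y) = 0" using P by (metis cinner_commute complex_cnj_zero)
    moreover have "cinner (x - P x) (P y) = 0" using P by blast
    ultimately show "cinner (op_apply p x) y = cinner x (op_apply p y)"
      by (simp add: ap cinner.diff_left cinner.diff_right)
  qed
  moreover have "p * p = p" by (rule op_eqI) (simp add: ap fixP P(1))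
  ultimately have p: "is_projection p" by (simp add: is_projection_def)
  have r: "range (op_apply p) = S" 
    unfolding ap
  proof
    show "range P \<subseteq> S" using P(1) by blast
    show "S \<subseteq> range P" using fixP by (metis rangeI subsetI)
  qed
  have pr: "proj_onto S = p" unfolding proj_onto_def
    by (rule the_equality) (use p r projection_unique in auto)
  show "is_projection (proj_onto S)" "range (op_apply (proj_onto S)) = S"
    "cinner (x - op_apply (proj_onto S) x) z = 0 \<or> z \<notin> S"
    using pr p r P(2) by (auto simp: ap)
qed

lemma proj_onto_mem:
  assumes S: "csubspace S" "closed S"
  shows "op_apply (proj_onto S) x \<in> S" "x \<in> S \<longleftrightarrow> op_apply (proj_onto S) x = x"
    "z \<in> S \<Longrightarrow> cinner (x - op_apply (proj_onto S) x) z = 0"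
  using proj_onto(2)[OF S] projection_range[OF proj_onto(1)[OF S], of x] proj_onto(3)[OF S] by auto

lemma proj_onto_eqI:
  assumes S: "csubspace S" "closed S" and y: "y \<in> S" "\<And>z. z \<in> S \<Longrightarrow> cinner (x - y) z = 0"
  shows "op_apply (proj_onto S) x = y"
proof -
  let ?p = "op_apply (proj_onto S) x"
  have d: "?p - y \<in> S" by (intro csubspaceD[OF S(1)] proj_onto_mem[OF S] y)
  have "cinner (?p - y) (?p - y) = cinner (x - y) (?p - y) - cinner (x - ?p) (?p - y)"
    by (simp add: cinner.diff_left[symmetric])
  also have "\<dots> = 0" using y(2)[OF d] proj_onto_mem(3)[OF S d] by simp
  finally show ?thesis by (simp add: cinner_eq_0_self)
qed

section \<open>Extension by continuity\<close>

text \<open>\<open>G\<close> is a relation rather than a function because in the applications a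
  vector has many presentations, such as lists of summands. The bound applied to differences makes
  \<open>G\<close> single-valued and Lipschitz on a dense set, so it extends by uniform
  continuity.\<close>

lemma bounded_clinear_extension:
  fixes G :: "('a::complex_hilbert_space \<times> 'b::complex_hilbert_space) set"
  assumes add: "\<And>a b a' b'. (a, b) \<in> G \<Longrightarrow> (a', b') \<in> G \<Longrightarrow> (a + a', b + b') \<in> G"
    and scale: "\<And>c a b. (a, b) \<in> G \<Longrightarrow> (c *\<^sub>C a, c *\<^sub>C b) \<in> G"
    and bound: "\<And>a b. (a, b) \<in> G \<Longrightarrow> norm b \<le> C * norm a"
    and dense: "closure (fst ` G) = UNIV"
  shows "\<exists>T. bounded_clinear T \<and> (\<forall>(a, b)\<in>G. T a = b)"
proof -
  define D where "D = fst ` G"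
  \<comment> \<open>\<open>C\<close> carries no sign, whereas a Lipschitz constant must not be
    negative.\<close>
  define C' where "C' = max C 0 + 1"
  have C': "C' > 0" by (simp add: C'_def)
  have bound': "norm b \<le> C' * norm a" if "(a, b) \<in> G" for a b
  proof -
    have "C * norm a \<le> C' * norm a" by (rule mult_right_mono) (auto simp: C'_def)
    then show ?thesis using bound[OF that] by linarith
  qed
  have diff: "(a - a', b - b') \<in> G" if "(a, b) \<in> G" "(a', b') \<in> G" for a b a' b'
    using add[OF that(1) scale[OF that(2), of "-1"]] by (simp add: scaleC_minus_one)
  define g where "g a = (SOME b. (a, b) \<in> G)" for a
  have g: "(a, g a) \<in> G" if "a \<in> D" for a
    unfolding g_def using that by (intro someI_ex[of "\<lambda>b. (a, b) \<in> G"]) (auto simp: D_def)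
  have g_eq: "g a = b" if "(a, b) \<in> G" for a b
  proof -
    have "(a, g a) \<in> G" by (rule g) (use that in \<open>force simp: D_def\<close>)
    from bound'[OF diff[OF this that]] show ?thesis by simp
  qed
  have "C'-lipschitz_on D g"
  proof (rule lipschitz_onI)
    show "dist (g x) (g y) \<le> C' * dist x y" if "x \<in> D" "y \<in> D" for x y
      using bound'[OF diff[OF g g], OF that] by (simp add: dist_norm)
  qed (use C' in simp)
  then have "uniformly_continuous_on D g" by (rule lipschitz_on_uniformly_continuous)
  then obtain T where T: "uniformly_continuous_on (closure D) T" "\<And>x. x \<in> D \<Longrightarrow> g x = T x"
    using uniformly_continuous_on_extension_on_closure by metis
  have contT: "continuous_on UNIV T"
    using uniformly_continuous_imp_continuous[OF T(1)] dense by (simp add: D_def)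
  have TG: "T a = b" if "(a, b) \<in> G" for a b
    using T(2)[of a] g_eq[OF that] that by (force simp: D_def)
  have app: "\<exists>u. (\<forall>k. (u k, T (u k)) \<in> G) \<and> u \<longlonglongrightarrow> x" for x
  proof -
    have "x \<in> closure D" using dense by (simp add: D_def)
    then obtain u where u: "\<And>k. u k \<in> D" "u \<longlonglongrightarrow> x" by (auto simp: closure_sequential)
    then show ?thesis using g T(2) by (intro exI[of _ u]) (metis)
  qed
  have limT: "(\<lambda>k. T (u k)) \<longlonglongrightarrow> T x" if "u \<longlonglongrightarrow> x" for u x
    using continuous_on_tendsto_compose[OF contT that] by simp
  have "bounded_clinear T"
  proof (rule bounded_clinearI[of _ C'])
    fix x y c
    obtain u where u: "\<And>k. (u k, T (u k)) \<in> G" "u \<longlonglongrightarrow> x" using app by blast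
    obtain v where v: "\<And>k. (v k, T (v k)) \<in> G" "v \<longlonglongrightarrow> y" using app by blast
    have "(\<lambda>k. T (u k + v k)) \<longlonglongrightarrow> T (x + y)" by (intro limT tendsto_add u v)
    moreover have "(\<lambda>k. T (u k + v k)) \<longlonglongrightarrow> T x + T y"
      using TG[OF add[OF u(1) v(1)]] tendsto_add[OF limT[OF u(2)] limT[OF v(2)]] by simp
    ultimately show "T (x + y) = T x + T y" by (rule LIMSEQ_unique)
    have "(\<lambda>k. T (c *\<^sub>C u k)) \<longlonglongrightarrow> T (c *\<^sub>C x)" by (intro limT tendsto_scaleC u)
    moreover have "(\<lambda>k. T (c *\<^sub>C u k)) \<longlonglongrightarrow> c *\<^sub>C T x"
      using TG[OF scale[OF u(1)]] tendsto_scaleC[OF limT[OF u(2)]] by simp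
    ultimately show "T (c *\<^sub>C x) = c *\<^sub>C T x" by (rule LIMSEQ_unique)
    show "norm (T x) \<le> C' * norm x"
    proof (rule LIMSEQ_le)
      show "(\<lambda>k. norm (T (u k))) \<longlonglongrightarrow> norm (T x)" by (intro tendsto_norm limT u)
      show "(\<lambda>k. C' * norm (u k)) \<longlonglongrightarrow> C' * norm x" by (intro tendsto_intros u)
    qed (use bound'[OF u(1)] in blast)
  qed
  then show ?thesis using TG by blast
qed

lemma continuous_eq_on_dense:
  fixes S T :: "'a::complex_hilbert_space \<Rightarrow> 'b::complex_hilbert_space"
  assumes "bounded_clinear S" "bounded_clinear T" "\<And>x. x \<in> D \<Longrightarrow> S x = T x" "x \<in> closure D"
  shows "S x = T x"
proof -
  obtain u where u: "\<And>k. u k \<in> D" "u \<longlonglongrightarrow> x" using assms(4) by (auto simp: closure_sequential)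
  have "(\<lambda>k. S (u k)) \<longlonglongrightarrow> S x" "(\<lambda>k. T (u k)) \<longlonglongrightarrow> T x"
    using bounded_linear.tendsto[OF bounded_clinearD(1)] assms(1,2) u(2) by blast+
  then show ?thesis using assms(3)[OF u(1)] LIMSEQ_unique by simp
qed

lemma orthogonal_dense:
  fixes x :: "'a::complex_hilbert_space"
  assumes "\<And>z. z \<in> D \<Longrightarrow> cinner x z = 0" "z \<in> closure D"
  shows "cinner x z = 0"
proof -
  obtain u where u: "\<And>k. u k \<in> D" "u \<longlonglongrightarrow> z" using assms(2) by (auto simp: closure_sequential)
  have "(\<lambda>k. cinner x (u k)) \<longlonglongrightarrow> cinner x z" by (intro cinner.tendsto tendsto_const u)
  then have "(\<lambda>k. 0) \<longlonglongrightarrow> cinner x z" using assms(1)[OF u(1)] by simp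
  then show ?thesis by (simp add: LIMSEQ_const_iff)
qed

text \<open>The C*-inequality \<open>\<phi>(a) \<le> \<parallel>a\<parallel> \<phi>(1)\<close> for positive functionals will be read off from the
  Cauchy--Schwarz inequality for powers of \<open>a\<close>, which avoids square roots of operators.\<close>

lemma power_iteration_bound:
  fixes u :: "nat \<Rightarrow> real"
  assumes nonneg: "\<And>m. 0 \<le> u m" and r: "0 \<le> r"
    and sq: "\<And>m. (u m)\<^sup>2 \<le> u (2 * m) * u 0" and growth: "\<And>m. u m \<le> K * r ^ m"
  shows "u 1 \<le> r * u 0"
proof (cases "u 0 = 0 \<or> r = 0")
  case True
  then have "u 1 \<le> 0" using sq[of 1] growth[of 1] by (auto simp: power2_eq_square mult_le_0_iff)
  then show ?thesis using r nonneg[of 0] by (meson mult_nonneg_nonneg order_trans)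
next
  case False
  then have u0: "u 0 > 0" and r0: "r > 0" using nonneg[of 0] r by auto
  \<comment> \<open>Cauchy-Schwarz at \<open>m = 2 ^ j\<close> doubles the exponent, so the ratio
    \<open>u 1 / u 0\<close> survives along powers of two.\<close>
  have pw: "(u 1 / u 0) ^ (2 ^ j) \<le> u (2 ^ j) / u 0" for j
  proof (induction j)
    case (Suc j)
    have "(u 1 / u 0) ^ (2 ^ Suc j) = ((u 1 / u 0) ^ (2 ^ j))\<^sup>2" by (simp add: power_mult[symmetric] mult.commute)
    also have "\<dots> \<le> (u (2 ^ j) / u 0)\<^sup>2" by (intro power_mono Suc.IH) (use nonneg in simp)
    also have "\<dots> \<le> u (2 * 2 ^ j) * u 0 / (u 0)\<^sup>2"
      using divide_right_mono[OF sq[of "2 ^ j"], of "(u 0)\<^sup>2"] by (simp add: power_divide)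
    also have "\<dots> = u (2 ^ Suc j) / u 0" using u0 by (simp add: power2_eq_square)
    finally show ?case .
  qed simp
  show ?thesis
  proof (rule ccontr)
    assume "\<not> ?thesis"
    then have q: "1 < u 1 / u 0 / r" using u0 r0 by (simp add: field_simps)
    \<comment> \<open>If the claim failed, \<open>q > 1\<close> would have unbounded powers, while
      the growth condition keeps \<open>q ^ (2 ^ j)\<close> below \<open>K / u 0\<close>.\<close>
    define q where "q = u 1 / u 0 / r"
    have "q ^ (2 ^ j) \<le> K / u 0" for j
    proof -
      have "q ^ (2 ^ j) = (u 1 / u 0) ^ (2 ^ j) / r ^ (2 ^ j)" by (simp only: q_def power_divide)
      also have "\<dots> \<le> (u (2 ^ j) / u 0) / r ^ (2 ^ j)" using r0 by (intro divide_right_mono pw) simp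
      also have "\<dots> \<le> (K * r ^ (2 ^ j) / u 0) / r ^ (2 ^ j)" using r0 u0 by (intro divide_right_mono growth) simp_all
      finally show ?thesis using r0 by simp
    qed
    moreover obtain m where m: "K / u 0 < q ^ m" using real_arch_pow[OF q] by (auto simp: q_def)
    moreover have "q ^ m \<le> q ^ (2 ^ m)" by (rule power_increasing) (use q in \<open>auto simp: q_def intro: less_imp_le\<close>)
    ultimately show False by (meson not_le order_trans)
  qed
qed

section \<open>Von Neumann algebras\<close>

lemma commutantI: "(\<And>x. x \<in> S \<Longrightarrow> T * x = x * T) \<Longrightarrow> T \<in> commutant S"
  by (simp add: commutant_def)

lemma commutantD: "T \<in> commutant S \<Longrightarrow> x \<in> S \<Longrightarrow> T * x = x * T"
  by (simp add: commutant_def)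

lemma commutant_antimono: "S \<subseteq> T \<Longrightarrow> commutant T \<subseteq> commutant S"
  by (auto simp: commutant_def)

lemma subset_bicommutant: "S \<subseteq> commutant (commutant S)"
  by (auto simp: commutant_def)

lemma commutant_algebra:
  "1 \<in> commutant S" "0 \<in> commutant S"
  "x \<in> commutant S \<Longrightarrow> y \<in> commutant S \<Longrightarrow> x + y \<in> commutant S"
  "x \<in> commutant S \<Longrightarrow> y \<in> commutant S \<Longrightarrow> x - y \<in> commutant S"
  "x \<in> commutant S \<Longrightarrow> y \<in> commutant S \<Longrightarrow> x * y \<in> commutant S"
  "x \<in> commutant S \<Longrightarrow> c *\<^sub>C x \<in> commutant S"
  by (auto simp: commutant_def algebra_simps) (metis mult.assoc)

lemma commutant_adj: "adj ` S \<subseteq> S \<Longrightarrow> x \<in> commutant S \<Longrightarrow> adj x \<in> commutant S"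
proof (rule commutantI)
  fix y assume "adj ` S \<subseteq> S" "x \<in> commutant S" "y \<in> S"
  then have "x * adj y = adj y * x" by (auto intro: commutantD)
  then show "adj x * y = y * adj x" using adj_simps(1,2) by metis
qed

text \<open>A commutant equals its own bicommutant. This supplies upper bounds for a von Neumann
  algebra given only by generators.\<close>

lemma von_neumann_algebra_commutant: "adj ` S \<subseteq> S \<Longrightarrow> von_neumann_algebra (commutant S)"
  unfolding von_neumann_algebra_def
  using commutant_adj[of S] subset_bicommutant[of S] subset_bicommutant[of "commutant S"]
    commutant_antimono[of S "commutant (commutant S)"]
  by blast

lemma von_neumann_algebraD:
  assumes "von_neumann_algebra A"
  shows "1 \<in> A" "0 \<in> A" "x \<in> A \<Longrightarrow> y \<in> A \<Longrightarrow> x + y \<in> A" "x \<in> A \<Longrightarrow> y \<in> A \<Longrightarrow> x - y \<in> A"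
    "x \<in> A \<Longrightarrow> y \<in> A \<Longrightarrow> x * y \<in> A" "x \<in> A \<Longrightarrow> c *\<^sub>C x \<in> A" "x \<in> A \<Longrightarrow> adj x \<in> A"
    "commutant (commutant A) = A"
  using assms commutant_algebra[where S = "commutant A"] unfolding von_neumann_algebra_def by auto

lemma von_neumann_algebra_sum:
  assumes "von_neumann_algebra A" "\<And>i. i \<in> I \<Longrightarrow> g i \<in> A"
  shows "(\<Sum>i\<in>I. g i) \<in> A"
  using assms(2) by (induction I rule: infinite_finite_induct) (auto intro: von_neumann_algebraD[OF assms(1)])

lemma von_neumann_algebra_power:
  assumes "von_neumann_algebra A" "x \<in> A"
  shows "x ^ m \<in> A"
  by (induction m) (auto intro: von_neumann_algebraD[OF assms(1)] assms(2))

text \<open>The bicommutant is monotone, so the bicommutant of an intersection lies in every member.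
  Hence the intersection that defines \<open>hull\<close> is itself a von Neumann algebra.\<close>

lemma von_neumann_algebra_hull: "von_neumann_algebra (von_neumann_algebra hull S)"
proof (rule hull_in)
  fix T :: "'a bop set set" assume T: "Ball T von_neumann_algebra"
  have "commutant (commutant (\<Inter>T)) \<subseteq> A" if "A \<in> T" for A
  proof -
    have "commutant (commutant (\<Inter>T)) \<subseteq> commutant (commutant A)"
      by (intro commutant_antimono) (use that in blast)
    then show ?thesis using T that von_neumann_algebraD(8) by blast
  qed
  then have "commutant (commutant (\<Inter>T)) = \<Inter>T" using subset_bicommutant[of "\<Inter>T"] by blast
  moreover have "adj ` \<Inter>T \<subseteq> \<Inter>T" using T by (auto intro: von_neumann_algebraD)
  ultimately show "von_neumann_algebra (\<Inter>T)" by (simp add: von_neumann_algebra_def)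
qed

section \<open>Square-summable sequences of vectors\<close>

text \<open>The Hilbert space tensor product of l2 with H. A normal functional is a series of vector
  functionals on H; on this space it becomes a single one.\<close>

typedef (overloaded) 'a ell2 = "{f :: nat \<Rightarrow> 'a::complex_hilbert_space. summable (\<lambda>k. (norm (f k))\<^sup>2)}"
  morphisms ell2_nth Ell2
  by (rule exI[of _ "\<lambda>_. 0"]) simp

setup_lifting type_definition_ell2

lemma sq_summable_add:
  fixes f g :: "nat \<Rightarrow> 'a::real_normed_vector"
  assumes "summable (\<lambda>k. (norm (f k))\<^sup>2)" "summable (\<lambda>k. (norm (g k))\<^sup>2)"
  shows "summable (\<lambda>k. (norm (f k + g k))\<^sup>2)"
proof (rule summable_comparison_test')
  show "summable (\<lambda>k. 2 * (norm (f k))\<^sup>2 + 2 * (norm (g k))\<^sup>2)"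
    by (intro summable_add summable_mult assms)
  fix k
  have "(norm (f k + g k))\<^sup>2 \<le> (norm (f k) + norm (g k))\<^sup>2" by (intro power_mono norm_triangle_ineq) simp
  also have "\<dots> \<le> 2 * (norm (f k))\<^sup>2 + 2 * (norm (g k))\<^sup>2"
    using sum_squares_bound[of "norm (f k)" "norm (g k)"] by (simp add: power2_sum)
  finally show "norm ((norm (f k + g k))\<^sup>2) \<le> 2 * (norm (f k))\<^sup>2 + 2 * (norm (g k))\<^sup>2" by simp
qed

lemma sq_summable_bound:
  fixes f :: "nat \<Rightarrow> 'a::real_normed_vector" and g :: "nat \<Rightarrow> 'b::real_normed_vector"
  assumes "summable (\<lambda>k. (norm (f k))\<^sup>2)" "\<And>k. norm (g k) \<le> C * norm (f k)"
  shows "summable (\<lambda>k. (norm (g k))\<^sup>2)"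
proof (rule summable_comparison_test')
  show "summable (\<lambda>k. C\<^sup>2 * (norm (f k))\<^sup>2)" by (intro summable_mult assms)
  show "norm ((norm (g k))\<^sup>2) \<le> C\<^sup>2 * (norm (f k))\<^sup>2" for k
    using power_mono[OF assms(2)[of k], of 2] by (simp add: power_mult_distrib)
qed

lemma summable_cinner:
  fixes f g :: "nat \<Rightarrow> 'a::complex_hilbert_space"
  assumes "summable (\<lambda>k. (norm (f k))\<^sup>2)" "summable (\<lambda>k. (norm (g k))\<^sup>2)"
  shows "summable (\<lambda>k. cinner (f k) (g k))"
proof (rule summable_comparison_test')
  show "summable (\<lambda>k. (norm (f k))\<^sup>2 + (norm (g k))\<^sup>2)" by (intro summable_add assms)
  fix k
  have "0 \<le> norm (f k) * norm (g k)" by simp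
  then show "cmod (cinner (f k) (g k)) \<le> (norm (f k))\<^sup>2 + (norm (g k))\<^sup>2"
    using Cauchy_Schwarz[of "f k" "g k"] sum_squares_bound[of "norm (f k)" "norm (g k)"] by linarith
qed

instantiation ell2 :: (complex_hilbert_space) real_vector
begin

lift_definition zero_ell2 :: "'a ell2" is "\<lambda>_. 0" by simp
lift_definition plus_ell2 :: "'a ell2 \<Rightarrow> 'a ell2 \<Rightarrow> 'a ell2" is "\<lambda>f g k. f k + g k"
  by (rule sq_summable_add)
lift_definition uminus_ell2 :: "'a ell2 \<Rightarrow> 'a ell2" is "\<lambda>f k. - f k" by simp
lift_definition minus_ell2 :: "'a ell2 \<Rightarrow> 'a ell2 \<Rightarrow> 'a ell2" is "\<lambda>f g k. f k - g k"
  using sq_summable_add[of f "\<lambda>k. - g k" for f g] by simp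
lift_definition scaleR_ell2 :: "real \<Rightarrow> 'a ell2 \<Rightarrow> 'a ell2" is "\<lambda>r f k. r *\<^sub>R f k"
  by (rule sq_summable_bound[of _ _ "\<bar>r\<bar>" for r]) auto

instance by standard (transfer; auto simp: algebra_simps)+

end

instantiation ell2 :: (complex_hilbert_space) real_normed_vector
begin

definition norm_ell2 :: "'a ell2 \<Rightarrow> real" where
  "norm_ell2 f = sqrt (\<Sum>k. (norm (ell2_nth f k))\<^sup>2)"
definition dist_ell2 :: "'a ell2 \<Rightarrow> 'a ell2 \<Rightarrow> real" where "dist_ell2 f g = norm (f - g)"
definition sgn_ell2 :: "'a ell2 \<Rightarrow> 'a ell2" where "sgn_ell2 f = f /\<^sub>R norm f"
definition uniformity_ell2 :: "('a ell2 \<times> 'a ell2) filter" where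
  "uniformity_ell2 = (INF e\<in>{0 <..}. principal {(x, y). dist x y < e})"
definition open_ell2 :: "'a ell2 set \<Rightarrow> bool" where
  "open_ell2 U \<longleftrightarrow> (\<forall>x\<in>U. eventually (\<lambda>(x', y). x' = x \<longrightarrow> y \<in> U) uniformity)"

lemma ell2_summable: "summable (\<lambda>k. (norm (ell2_nth f k))\<^sup>2)"
  using ell2_nth[of f] by simp

instance
proof
  fix f g :: "'a ell2" and r :: real
  show "norm f = 0 \<longleftrightarrow> f = 0"
    unfolding norm_ell2_def using suminf_eq_zero_iff[OF ell2_summable[of f]]
    by (simp add: zero_ell2.rep_eq fun_eq_iff ell2_nth_inject[symmetric])
  have "(\<Sum>k. (norm (ell2_nth (r *\<^sub>R f) k))\<^sup>2) = (\<Sum>k. r\<^sup>2 * (norm (ell2_nth f k))\<^sup>2)"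
    by (simp add: scaleR_ell2.rep_eq power_mult_distrib)
  also have "\<dots> = r\<^sup>2 * (\<Sum>k. (norm (ell2_nth f k))\<^sup>2)" by (rule suminf_mult[OF ell2_summable])
  finally show "norm (r *\<^sub>R f) = \<bar>r\<bar> * norm f" by (simp add: norm_ell2_def real_sqrt_mult)
  have part: "L2_set (\<lambda>k. norm (ell2_nth h k)) {..<m} \<le> norm h" for h :: "'a ell2" and m
    unfolding L2_set_def norm_ell2_def by (intro real_sqrt_le_mono sum_le_suminf ell2_summable) auto
  have "(\<lambda>m. L2_set (\<lambda>k. norm (ell2_nth (f + g) k)) {..<m}) \<longlonglongrightarrow> norm (f + g)"
    unfolding L2_set_def norm_ell2_def by (intro tendsto_real_sqrt summable_LIMSEQ ell2_summable)
  moreover have "L2_set (\<lambda>k. norm (ell2_nth (f + g) k)) {..<m} \<le> norm f + norm g" for m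
  proof -
    have "L2_set (\<lambda>k. norm (ell2_nth (f + g) k)) {..<m}
        \<le> L2_set (\<lambda>k. norm (ell2_nth f k) + norm (ell2_nth g k)) {..<m}"
      by (rule L2_set_mono) (auto simp: plus_ell2.rep_eq norm_triangle_ineq)
    also have "\<dots> \<le> L2_set (\<lambda>k. norm (ell2_nth f k)) {..<m} + L2_set (\<lambda>k. norm (ell2_nth g k)) {..<m}"
      by (rule L2_set_triangle_ineq)
    finally show ?thesis using part[of f m] part[of g m] by linarith
  qed
  ultimately show "norm (f + g) \<le> norm f + norm g" by (blast intro: LIMSEQ_le_const2)
qed (simp_all add: dist_ell2_def sgn_ell2_def uniformity_ell2_def open_ell2_def)

end

lemma norm_ell2_sq: "(norm f)\<^sup>2 = (\<Sum>k. (norm (ell2_nth f k))\<^sup>2)"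
  unfolding norm_ell2_def by (simp add: suminf_nonneg ell2_summable)

lemma sum_le_norm_ell2: "(\<Sum>k<m. (norm (ell2_nth f k))\<^sup>2) \<le> (norm f)\<^sup>2"
  unfolding norm_ell2_sq by (intro sum_le_suminf ell2_summable) auto

lemma norm_ell2_nth: "norm (ell2_nth f k) \<le> norm f"
proof -
  have "(norm (ell2_nth f k))\<^sup>2 \<le> (\<Sum>k<Suc k. (norm (ell2_nth f k))\<^sup>2)"
    by (rule member_le_sum) auto
  then have "(norm (ell2_nth f k))\<^sup>2 \<le> (norm f)\<^sup>2" using sum_le_norm_ell2[of f "Suc k"] by linarith
  then show ?thesis by simp
qed

text \<open>\<open>Ell2 f\<close> is unspecified unless \<open>f\<close> is square summable, so
  summability and the norm bound are delivered together.\<close>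

lemma norm_ell2_leI:
  assumes "0 \<le> C" "\<And>m. (\<Sum>k<m. (norm (f k))\<^sup>2) \<le> C\<^sup>2"
  shows "summable (\<lambda>k. (norm (f k))\<^sup>2)" "norm (Ell2 f) \<le> C"
proof -
  show s: "summable (\<lambda>k. (norm (f k))\<^sup>2)"
    by (rule summableI_nonneg_bounded[of _ "C\<^sup>2"]) (use assms in auto)
  then have "(norm (Ell2 f))\<^sup>2 = (\<Sum>k. (norm (f k))\<^sup>2)" by (simp add: norm_ell2_sq Ell2_inverse)
  also have "\<dots> \<le> C\<^sup>2" by (rule suminf_le_const[OF s]) (rule assms)
  finally show "norm (Ell2 f) \<le> C" using assms(1) by (rule power2_le_imp_le)
qed

instance ell2 :: (complex_hilbert_space) banach
proof
  fix X :: "nat \<Rightarrow> 'a ell2"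
  assume X: "Cauchy X"
  have "Cauchy (\<lambda>m. ell2_nth (X m) k)" for k
  proof (rule metric_CauchyI)
    fix e :: real assume "e > 0"
    then obtain K where "\<forall>m\<ge>K. \<forall>n\<ge>K. dist (X m) (X n) < e" using metric_CauchyD[OF X] by blast
    moreover have "dist (ell2_nth (X m) k) (ell2_nth (X n) k) \<le> dist (X m) (X n)" for m n
      using norm_ell2_nth[of "X m - X n" k] by (simp add: dist_norm minus_ell2.rep_eq)
    ultimately show "\<exists>K. \<forall>m\<ge>K. \<forall>n\<ge>K. dist (ell2_nth (X m) k) (ell2_nth (X n) k) < e"
      by (meson order_le_less_trans)
  qed
  then have "\<exists>y. (\<lambda>m. ell2_nth (X m) k) \<longlonglongrightarrow> y" for k
    using Cauchy_convergent convergent_def by blast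
  then obtain Y where Y: "\<And>k. (\<lambda>m. ell2_nth (X m) k) \<longlonglongrightarrow> Y k" by metis
  \<comment> \<open>The limit in the second index is taken inside finite partial sums, where it
    commutes with the sum; the bound then holds for all partial sums at once.\<close>
  have close: "\<exists>K. \<forall>m\<ge>K. summable (\<lambda>k. (norm (ell2_nth (X m) k - Y k))\<^sup>2) \<and>
      norm (Ell2 (\<lambda>k. ell2_nth (X m) k - Y k)) \<le> e" if "e > 0" for e :: real
  proof -
    obtain K where K: "\<And>m n. m \<ge> K \<Longrightarrow> n \<ge> K \<Longrightarrow> dist (X m) (X n) < e"
      using metric_CauchyD[OF X \<open>e > 0\<close>] by blast
    have "(\<Sum>k<j. (norm (ell2_nth (X m) k - Y k))\<^sup>2) \<le> e\<^sup>2" if m: "m \<ge> K" for m j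
    proof (rule LIMSEQ_le_const2)
      show "(\<lambda>n. \<Sum>k<j. (norm (ell2_nth (X m) k - ell2_nth (X n) k))\<^sup>2)
          \<longlonglongrightarrow> (\<Sum>k<j. (norm (ell2_nth (X m) k - Y k))\<^sup>2)" by (intro tendsto_intros Y)
      have "(\<Sum>k<j. (norm (ell2_nth (X m) k - ell2_nth (X n) k))\<^sup>2) \<le> e\<^sup>2" if "n \<ge> K" for n
      proof -
        have "(norm (X m - X n))\<^sup>2 \<le> e\<^sup>2"
          using K[OF m that] by (intro power_mono) (auto simp: dist_norm)
        then show ?thesis using sum_le_norm_ell2[of "X m - X n" j] by (simp add: minus_ell2.rep_eq)
      qed
      then show "\<exists>K. \<forall>n\<ge>K. (\<Sum>k<j. (norm (ell2_nth (X m) k - ell2_nth (X n) k))\<^sup>2) \<le> e\<^sup>2" by blast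
    qed
    then show ?thesis using norm_ell2_leI[of e "\<lambda>k. ell2_nth (X m) k - Y k" for m] that
      by (intro exI[of _ K] allI impI conjI) simp_all
  qed
  obtain K0 where "summable (\<lambda>k. (norm (ell2_nth (X K0) k - Y k))\<^sup>2)" using close[of 1] by auto
  from sq_summable_add[OF ell2_summable[of "X K0"] this[unfolded norm_minus_commute[of "ell2_nth _ _"]]]
  have sY: "summable (\<lambda>k. (norm (Y k))\<^sup>2)" by simp
  have "X \<longlonglongrightarrow> Ell2 Y"
  proof (rule metric_LIMSEQ_I)
    fix e :: real assume "e > 0"
    then obtain K where K: "\<And>m. m \<ge> K \<Longrightarrow> summable (\<lambda>k. (norm (ell2_nth (X m) k - Y k))\<^sup>2) \<and>
      norm (Ell2 (\<lambda>k. ell2_nth (X m) k - Y k)) \<le> e / 2" using close[of "e/2"] by auto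
    have "dist (X m) (Ell2 Y) < e" if "m \<ge> K" for m
    proof -
      have "X m - Ell2 Y = Ell2 (\<lambda>k. ell2_nth (X m) k - Y k)"
        using K[OF that] sY by (simp add: ell2_nth_inject[symmetric] minus_ell2.rep_eq Ell2_inverse)
      then show ?thesis using K[OF that] \<open>e > 0\<close> by (simp add: dist_norm)
    qed
    then show "\<exists>K. \<forall>m\<ge>K. dist (X m) (Ell2 Y) < e" by blast
  qed
  then show "convergent X" by (auto simp: convergent_def)
qed

instantiation ell2 :: (complex_hilbert_space) complex_hilbert_space
begin

lift_definition scaleC_ell2 :: "complex \<Rightarrow> 'a ell2 \<Rightarrow> 'a ell2" is "\<lambda>c f k. c *\<^sub>C f k"
  by (rule sq_summable_bound[of _ _ "cmod c" for c]) (auto simp: norm_scaleC)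

definition cinner_ell2 :: "'a ell2 \<Rightarrow> 'a ell2 \<Rightarrow> complex" where
  "cinner_ell2 f g = (\<Sum>k. cinner (ell2_nth f k) (ell2_nth g k))"

instance
proof
  fix f g h :: "'a ell2" and c d :: complex and r :: real
  note s = summable_cinner[OF ell2_summable ell2_summable]
  show "c *\<^sub>C (f + g) = c *\<^sub>C f + c *\<^sub>C g" by transfer (simp add: scaleC_add_right)
  show "(c + d) *\<^sub>C f = c *\<^sub>C f + d *\<^sub>C f" by transfer (simp add: scaleC_add_left)
  show "c *\<^sub>C d *\<^sub>C f = (c * d) *\<^sub>C f" by transfer (simp add: scaleC_scaleC)
  show "complex_of_real r *\<^sub>C f = r *\<^sub>R f" by transfer (simp add: scaleC_of_real)
  show "cinner f g = cnj (cinner g f)"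
    unfolding cinner_ell2_def
    using bounded_linear.suminf[OF bounded_linear_cnj s, of g f]
    by (simp add: cinner_commute[of "ell2_nth f _"])
  show "cinner (f + g) h = cinner f h + cinner g h"
    unfolding cinner_ell2_def plus_ell2.rep_eq cinner_add_left by (rule suminf_add[OF s s, symmetric])
  show "cinner (c *\<^sub>C f) g = c * cinner f g"
    unfolding cinner_ell2_def scaleC_ell2.rep_eq cinner_scaleC_left by (rule suminf_mult[OF s])
  have ff: "cinner f f = complex_of_real ((norm f)\<^sup>2)"
    unfolding cinner_ell2_def norm_ell2_sq cinner_self by (rule suminf_of_real[OF ell2_summable, symmetric])
  show "cinner f f \<in> \<real>\<^sub>\<ge>\<^sub>0" unfolding ff by simp
  show "norm f = sqrt (Re (cinner f f))" unfolding ff by simp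
qed

end

section \<open>Amplification of operators to sequences of vectors\<close>

lemma bounded_clinear_ell2_nth: "bounded_clinear (\<lambda>f. ell2_nth f k)"
  by (rule bounded_clinearI[of _ 1]) (auto simp: plus_ell2.rep_eq scaleC_ell2.rep_eq norm_ell2_nth)

text \<open>The operator 1 tensor \<open>T\<close>, through which \<open>B\<close> acts on
  \<open>'h ell2\<close>.\<close>

lift_definition amplify :: "'a::complex_hilbert_space bop \<Rightarrow> 'a ell2 \<Rightarrow> 'a ell2" is
  "\<lambda>T f k. op_apply T (f k)"
proof -
  fix T :: "'a bop" and f :: "nat \<Rightarrow> 'a" assume f: "summable (\<lambda>k. (norm (f k))\<^sup>2)"
  obtain C where "\<forall>x. norm (op_apply T x) \<le> C * norm x" using op_norm_bound by blast
  then show "summable (\<lambda>k. (norm (op_apply T (f k)))\<^sup>2)" by (intro sq_summable_bound[OF f]) auto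
qed

lemma cinner_amplify: "cinner (amplify T f) g = cinner f (amplify (adj T) g)"
  by (simp add: cinner_ell2_def amplify.rep_eq cinner_adj)

lemma amplify_simps:
  "amplify (S + T) f = amplify S f + amplify T f" "amplify (c *\<^sub>C S) f = c *\<^sub>C amplify S f"
  "amplify (S * T) f = amplify S (amplify T f)" "amplify S (f + g) = amplify S f + amplify S g"
  by (transfer; simp add: op_add)+

lemma bounded_clinear_amplify: "bounded_clinear (amplify T)"
proof -
  obtain C where C: "C \<ge> 0" "\<And>x. norm (op_apply T x) \<le> C * norm x" using op_norm_bound[of T] by blast
  show ?thesis
  proof (rule bounded_clinearI[of _ C])
    fix f g :: "'a ell2" and c
    show "amplify T (c *\<^sub>C f) = c *\<^sub>C amplify T f" by transfer (simp add: op_scaleC)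
    have "(\<Sum>k<m. (norm (op_apply T (ell2_nth f k)))\<^sup>2) \<le> (C * norm f)\<^sup>2" for m
    proof -
      have "(\<Sum>k<m. (norm (op_apply T (ell2_nth f k)))\<^sup>2) \<le> (\<Sum>k<m. C\<^sup>2 * (norm (ell2_nth f k))\<^sup>2)"
        by (intro sum_mono) (use power_mono[OF C(2), of _ 2] in \<open>simp add: power_mult_distrib\<close>)
      also have "\<dots> \<le> C\<^sup>2 * (norm f)\<^sup>2"
        unfolding sum_distrib_left[symmetric] by (intro mult_left_mono sum_le_norm_ell2) simp
      finally show ?thesis by (simp add: power_mult_distrib)
    qed
    then have "norm (Ell2 (\<lambda>k. op_apply T (ell2_nth f k))) \<le> C * norm f"
      by (intro norm_ell2_leI) (use C(1) in auto)
    then show "norm (amplify T f) \<le> C * norm f"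
      by (simp only: amplify.rep_eq[symmetric] ell2_nth_inverse)
  qed (rule amplify_simps)
qed

section \<open>The GNS space of a tracial von Neumann algebra\<close>

locale tracial_gns =
  fixes B :: "'h::complex_hilbert_space bop set"
    and tr :: "'h bop \<Rightarrow> complex"
    and \<Lambda> :: "'h bop \<Rightarrow> 'k::complex_hilbert_space"
  assumes vna: "von_neumann_algebra B"
    and state: "faithful_normal_tracial_state B tr"
    and gns: "GNS_space B tr \<Lambda>"
begin

abbreviation \<pi> :: "'h bop \<Rightarrow> 'k bop" where "\<pi> \<equiv> left_mult \<Lambda> B"

lemmas B = von_neumann_algebraD(1-7)[OF vna]

lemma tr_add: "x \<in> B \<Longrightarrow> y \<in> B \<Longrightarrow> tr (x + y) = tr x + tr y"
  and tr_scaleC: "x \<in> B \<Longrightarrow> tr (c *\<^sub>C x) = c * tr x"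
  and tr_comm: "x \<in> B \<Longrightarrow> y \<in> B \<Longrightarrow> tr (x * y) = tr (y * x)"
  and tr_one: "tr 1 = 1"
  and tr_faithful: "x \<in> B \<Longrightarrow> tr (adj x * x) = 0 \<Longrightarrow> x = 0"
  and tr_normal: "normal_functional B tr"
  using state
  by (auto simp: faithful_normal_tracial_state_def positive_trace_def linear_functional_on_def)

lemma tr_zero: "tr 0 = 0"
  using tr_scaleC[OF B(1), of 0] by simp

lemma tr_sum: "(\<And>i. i \<in> I \<Longrightarrow> g i \<in> B) \<Longrightarrow> tr (\<Sum>i\<in>I. g i) = (\<Sum>i\<in>I. tr (g i))"
proof (induction I rule: infinite_finite_induct)
  case (insert i I)
  then show ?case using von_neumann_algebra_sum[OF vna, of I g] by (simp add: tr_add)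
qed (auto simp: tr_zero)

lemma \<Lambda>_add: "x \<in> B \<Longrightarrow> y \<in> B \<Longrightarrow> \<Lambda> (x + y) = \<Lambda> x + \<Lambda> y"
  and \<Lambda>_scaleC: "x \<in> B \<Longrightarrow> \<Lambda> (c *\<^sub>C x) = c *\<^sub>C \<Lambda> x"
  and cinner_\<Lambda>: "x \<in> B \<Longrightarrow> y \<in> B \<Longrightarrow> cinner (\<Lambda> x) (\<Lambda> y) = tr (adj y * x)"
  and \<Lambda>_dense: "closure (\<Lambda> ` B) = UNIV"
  using gns by (auto simp: GNS_space_def)

lemma \<Lambda>_diff: "x \<in> B \<Longrightarrow> y \<in> B \<Longrightarrow> \<Lambda> (x - y) = \<Lambda> x - \<Lambda> y"
  using \<Lambda>_add[of "x - y" y] B(4) by simp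

lemma \<Lambda>_zero: "\<Lambda> 0 = 0"
  using \<Lambda>_add[OF B(2) B(2)] by simp

lemma \<Lambda>_sum: "(\<And>i. i \<in> I \<Longrightarrow> g i \<in> B) \<Longrightarrow> \<Lambda> (\<Sum>i\<in>I. g i) = (\<Sum>i\<in>I. \<Lambda> (g i))"
proof (induction I rule: infinite_finite_induct)
  case (insert i I)
  then show ?case using von_neumann_algebra_sum[OF vna, of I g] by (simp add: \<Lambda>_add)
qed (auto simp: \<Lambda>_zero)

lemma \<Lambda>_eq_0: "x \<in> B \<Longrightarrow> \<Lambda> x = 0 \<Longrightarrow> x = 0"
  using cinner_\<Lambda>[of x x] tr_faithful by (simp add: cinner.zero_left)

lemma \<Lambda>_inj: "x \<in> B \<Longrightarrow> y \<in> B \<Longrightarrow> \<Lambda> x = \<Lambda> y \<Longrightarrow> x = y"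
  using \<Lambda>_eq_0[of "x - y"] \<Lambda>_diff[of x y] B(4) by simp

lemma csubspace_\<Lambda>:
  assumes "von_neumann_algebra A" "A \<subseteq> B"
  shows "csubspace (\<Lambda> ` A)"
proof (rule csubspaceI)
  note A = von_neumann_algebraD[OF assms(1)]
  show "0 \<in> \<Lambda> ` A" using \<Lambda>_zero A(2) by (metis imageI)
  show "x + y \<in> \<Lambda> ` A" if xy: "x \<in> \<Lambda> ` A" "y \<in> \<Lambda> ` A" for x y
  proof -
    from xy obtain a b where ab: "a \<in> A" "b \<in> A" "x = \<Lambda> a" "y = \<Lambda> b" by blast
    then have "x + y = \<Lambda> (a + b)" using \<Lambda>_add assms(2) by (metis subsetD)
    then show ?thesis using A(3) ab by blast
  qed
  show "c *\<^sub>C x \<in> \<Lambda> ` A" if x: "x \<in> \<Lambda> ` A" for c x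
  proof -
    from x obtain a where a: "a \<in> A" "x = \<Lambda> a" by blast
    then have "c *\<^sub>C x = \<Lambda> (c *\<^sub>C a)" using \<Lambda>_scaleC assms(2) by (metis subsetD)
    then show ?thesis using A(6) a by blast
  qed
qed

lemma op_eq_on_\<Lambda>: "(\<And>y. y \<in> B \<Longrightarrow> op_apply S (\<Lambda> y) = op_apply T (\<Lambda> y)) \<Longrightarrow> S = T"
  by (rule op_eqI, rule continuous_eq_on_dense[where D = "\<Lambda> ` B"]) (auto simp: \<Lambda>_dense)

text \<open>Cauchy-Schwarz in each vector functional of the normal series. \<open>bop\<close>
  carries no norm here, so any admissible bound \<open>D\<close> of the operator stands in for
  it.\<close>

lemma tr_bounded:
  "\<exists>K\<ge>0. \<forall>z\<in>B. \<forall>D\<ge>0. (\<forall>\<xi>. norm (op_apply z \<xi>) \<le> D * norm \<xi>) \<longrightarrow> cmod (tr z) \<le> D * K"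
proof -
  obtain \<xi> \<eta> :: "nat \<Rightarrow> 'h" where s: "summable (\<lambda>k. (norm (\<xi> k))\<^sup>2)" "summable (\<lambda>k. (norm (\<eta> k))\<^sup>2)"
    and tr: "\<And>x. x \<in> B \<Longrightarrow> (\<lambda>k. cinner (op_apply x (\<xi> k)) (\<eta> k)) sums tr x"
    using tr_normal by (auto simp: normal_functional_def)
  let ?w = "\<lambda>k. (norm (\<xi> k))\<^sup>2 + (norm (\<eta> k))\<^sup>2"
  have sw: "summable ?w" by (intro summable_add s)
  have "cmod (tr z) \<le> D * suminf ?w"
    if z: "z \<in> B" and D: "D \<ge> 0" "\<forall>\<xi>. norm (op_apply z \<xi>) \<le> D * norm \<xi>" for z D
  proof -
    have le: "cmod (cinner (op_apply z (\<xi> k)) (\<eta> k)) \<le> D * ?w k" for k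
    proof -
      have "cmod (cinner (op_apply z (\<xi> k)) (\<eta> k)) \<le> D * norm (\<xi> k) * norm (\<eta> k)"
        using D(2) by (intro order_trans[OF Cauchy_Schwarz] mult_right_mono) auto
      also have "\<dots> \<le> D * ?w k"
      proof -
        have "0 \<le> norm (\<xi> k) * norm (\<eta> k)" by simp
        then have "norm (\<xi> k) * norm (\<eta> k) \<le> ?w k"
          using sum_squares_bound[of "norm (\<xi> k)" "norm (\<eta> k)"] by linarith
        then show ?thesis using D(1) by (simp add: mult.assoc mult_left_mono)
      qed
      finally show ?thesis .
    qed
    have "cmod (\<Sum>k. cinner (op_apply z (\<xi> k)) (\<eta> k)) \<le> (\<Sum>k. D * ?w k)"
      by (rule norm_suminf_le[OF le summable_mult[OF sw]])
    then show ?thesis using sums_unique[OF tr[OF z]] suminf_mult[OF sw] by simp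
  qed
  then show ?thesis by (intro exI[of _ "suminf ?w"]) (auto intro: suminf_nonneg[OF sw])
qed

text \<open>Put \<open>a = adj x * x\<close>. The norms of \<open>\<Lambda> (a ^ m * y)\<close>
  satisfy the hypotheses of \<open>power_iteration_bound\<close>, which gives the L2 bound
  \<open>r\<close> for \<open>a\<close> and hence \<open>sqrt r\<close> for \<open>x\<close>; no
  square root of \<open>r - a\<close> is taken.\<close>

lemma \<Lambda>_mult_bounded:
  assumes x: "x \<in> B"
  shows "\<exists>C. \<forall>y\<in>B. norm (\<Lambda> (x * y)) \<le> C * norm (\<Lambda> y)"
proof -
  define a where "a = adj x * x"
  have a: "a \<in> B" "adj a = a" using x B by (auto simp: a_def)
  have am: "a ^ m \<in> B" for m by (rule von_neumann_algebra_power[OF vna a(1)])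
  have adj_am: "adj (a ^ m) = a ^ m" for m
    by (induction m) (simp_all add: a(2) power_commutes)
  obtain r where r: "r \<ge> 0" "\<And>\<xi>. norm (op_apply a \<xi>) \<le> r * norm \<xi>" using op_norm_bound[of a] by blast
  have am_bound: "norm (op_apply (a ^ m) \<xi>) \<le> r ^ m * norm \<xi>" for m \<xi>
  proof (induction m)
    case (Suc m)
    have "norm (op_apply (a ^ Suc m) \<xi>) \<le> r * norm (op_apply (a ^ m) \<xi>)" using r(2) by simp
    also have "\<dots> \<le> r * (r ^ m * norm \<xi>)" by (intro mult_left_mono Suc.IH r(1))
    finally show ?case by (simp add: mult.assoc)
  qed simp
  obtain K where K: "K \<ge> 0" "\<And>z D. z \<in> B \<Longrightarrow> D \<ge> 0 \<Longrightarrow> (\<And>\<xi>. norm (op_apply z \<xi>) \<le> D * norm \<xi>) \<Longrightarrow> cmod (tr z) \<le> D * K"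
    using tr_bounded by blast
  have "norm (\<Lambda> (x * y)) \<le> sqrt r * norm (\<Lambda> y)" if y: "y \<in> B" for y
  proof -
    define u where "u m = norm (\<Lambda> (a ^ m * y))" for m
    have shift: "cinner (\<Lambda> (a ^ m * y)) (\<Lambda> (a ^ l * y)) = cinner (\<Lambda> (a ^ (l + m) * y)) (\<Lambda> y)" for m l
      using am y B by (simp add: cinner_\<Lambda> adj_am power_add mult.assoc)
    obtain C where C: "C \<ge> 0" "\<And>\<xi>. norm (op_apply y \<xi>) \<le> C * norm \<xi>" using op_norm_bound[of y] by blast
    obtain C' where C': "C' \<ge> 0" "\<And>\<xi>. norm (op_apply (adj y) \<xi>) \<le> C' * norm \<xi>" using op_norm_bound[of "adj y"] by blast
    have "u 1 \<le> r * u 0"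
    proof (rule power_iteration_bound)
      show "0 \<le> u m" for m by (simp add: u_def)
      have usq: "complex_of_real ((u m)\<^sup>2) = cinner (\<Lambda> (a ^ (2 * m) * y)) (\<Lambda> y)" for m
        using shift[of m m] by (simp add: u_def cinner_self mult_2 del: of_real_power)
      then have usq': "(u m)\<^sup>2 = cmod (cinner (\<Lambda> (a ^ (2 * m) * y)) (\<Lambda> y))" for m
        by (metis norm_of_real abs_of_nonneg zero_le_power2)
      then show "(u m)\<^sup>2 \<le> u (2 * m) * u 0" for m by (simp add: u_def Cauchy_Schwarz)
      \<comment> \<open>The square of \<open>u m\<close> is the trace of
        \<open>adj y * (a ^ (2 * m) * y)\<close>, whose operator bound grows like
        \<open>r ^ (2 * m)\<close>; \<open>tr_bounded\<close> carries this over to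
        \<open>u\<close>.\<close>
      show "u m \<le> sqrt (C' * C * K) * r ^ m" for m
      proof -
        have "norm (op_apply (adj y * (a ^ (2 * m) * y)) \<xi>) \<le> (C' * (r ^ (2 * m) * C)) * norm \<xi>" for \<xi>
        proof -
          have "norm (op_apply (adj y * (a ^ (2 * m) * y)) \<xi>) \<le> C' * (r ^ (2 * m) * (C * norm \<xi>))"
            unfolding op_simps
            by (intro order_trans[OF C'(2)] mult_left_mono order_trans[OF am_bound] C) (use C' r in auto)
          then show ?thesis by (simp add: mult_ac)
        qed
        then have "cmod (tr (adj y * (a ^ (2 * m) * y))) \<le> (C' * (r ^ (2 * m) * C)) * K"
          by (intro K(2)) (use y am B C C' r in auto)
        then have "(u m)\<^sup>2 \<le> (C' * C * K) * (r ^ m)\<^sup>2"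
          using y am[of "2 * m"] B(5) unfolding usq'
          by (simp add: cinner_\<Lambda> mult_ac power_mult[of r, symmetric])
        then have "sqrt ((u m)\<^sup>2) \<le> sqrt ((C' * C * K) * (r ^ m)\<^sup>2)" by (rule real_sqrt_le_mono)
        then show ?thesis using r by (simp add: u_def real_sqrt_mult)
      qed
    qed (rule r)
    have "complex_of_real ((norm (\<Lambda> (x * y)))\<^sup>2) = cinner (\<Lambda> (a * y)) (\<Lambda> y)"
      unfolding cinner_self[symmetric] a_def using x y B by (simp add: cinner_\<Lambda> mult.assoc)
    then have "(norm (\<Lambda> (x * y)))\<^sup>2 = cmod (cinner (\<Lambda> (a * y)) (\<Lambda> y))"
      by (metis norm_of_real abs_of_nonneg zero_le_power2)
    also have "\<dots> \<le> u 1 * u 0" by (simp add: u_def Cauchy_Schwarz)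
    also have "\<dots> \<le> r * u 0 * u 0" by (intro mult_right_mono \<open>u 1 \<le> r * u 0\<close>) (simp add: u_def)
    also have "\<dots> = (sqrt r * norm (\<Lambda> y))\<^sup>2" using r by (simp add: u_def power2_eq_square)
    finally show ?thesis by (rule power2_le_imp_le) (use r in simp)
  qed
  then show ?thesis by blast
qed

section \<open>Left and right multiplication as operators on the GNS space\<close>

lemma op_on_\<Lambda>_exists:
  assumes g: "\<And>y. y \<in> B \<Longrightarrow> g y \<in> B" "\<And>y z. y \<in> B \<Longrightarrow> z \<in> B \<Longrightarrow> g (y + z) = g y + g z"
    "\<And>c y. y \<in> B \<Longrightarrow> g (c *\<^sub>C y) = c *\<^sub>C g y"
    and bound: "\<And>y. y \<in> B \<Longrightarrow> norm (\<Lambda> (g y)) \<le> C * norm (\<Lambda> y)"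
  shows "\<exists>!T. \<forall>y\<in>B. op_apply T (\<Lambda> y) = \<Lambda> (g y)"
proof -
  define G where "G = (\<lambda>y. (\<Lambda> y, \<Lambda> (g y))) ` B"
  have GI: "(\<Lambda> y, \<Lambda> (g y)) \<in> G" if "y \<in> B" for y using that by (auto simp: G_def)
  have "\<exists>T. bounded_clinear T \<and> (\<forall>(a, b)\<in>G. T a = b)"
  proof (rule bounded_clinear_extension)
    fix a b a' b' assume "(a, b) \<in> G" "(a', b') \<in> G"
    then obtain y y' where y: "y \<in> B" "a = \<Lambda> y" "b = \<Lambda> (g y)" and y': "y' \<in> B" "a' = \<Lambda> y'" "b' = \<Lambda> (g y')"
      by (auto simp: G_def)
    then show "(a + a', b + b') \<in> G"
      using GI[OF B(3)[OF y(1) y'(1)]] g by (simp add: \<Lambda>_add)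
  next
    fix c a b assume "(a, b) \<in> G"
    then obtain y where y: "y \<in> B" "a = \<Lambda> y" "b = \<Lambda> (g y)" by (auto simp: G_def)
    then show "(c *\<^sub>C a, c *\<^sub>C b) \<in> G" using GI[OF B(6)[OF y(1)], of c] g by (simp add: \<Lambda>_scaleC)
  next
    show "norm b \<le> C * norm a" if "(a, b) \<in> G" for a b using that bound by (auto simp: G_def)
    have "fst ` G = \<Lambda> ` B" by (force simp: G_def)
    then show "closure (fst ` G) = UNIV" by (simp add: \<Lambda>_dense)
  qed
  then obtain T where T: "bounded_clinear T" "\<And>a b. (a, b) \<in> G \<Longrightarrow> T a = b" by fastforce
  show ?thesis
  proof (rule ex1I[of _ "Bop T"])
    show "\<forall>y\<in>B. op_apply (Bop T) (\<Lambda> y) = \<Lambda> (g y)" using T(2)[OF GI] by (simp add: op_apply_Bop[OF T(1)])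
    then show "S = Bop T" if "\<forall>y\<in>B. op_apply S (\<Lambda> y) = \<Lambda> (g y)" for S
      using that by (intro op_eq_on_\<Lambda>) simp
  qed
qed

lemma \<pi>_\<Lambda>: "x \<in> B \<Longrightarrow> y \<in> B \<Longrightarrow> op_apply (\<pi> x) (\<Lambda> y) = \<Lambda> (x * y)"
proof -
  assume x: "x \<in> B" and y: "y \<in> B"
  obtain C where "\<And>y. y \<in> B \<Longrightarrow> norm (\<Lambda> (x * y)) \<le> C * norm (\<Lambda> y)" using \<Lambda>_mult_bounded[OF x] by blast
  then have "\<exists>!T. \<forall>y\<in>B. op_apply T (\<Lambda> y) = \<Lambda> (x * y)"
    using x B by (intro op_on_\<Lambda>_exists) (auto simp: distrib_left)
  from theI'[OF this] show ?thesis using y unfolding left_mult_def by blast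
qed

text \<open>The right action, which commutes with every \<open>\<pi> x\<close>; the basic
  construction is controlled from above by commutation with its restriction to
  \<open>A\<close>.\<close>

definition \<rho> :: "'h bop \<Rightarrow> 'k bop" where
  "\<rho> x = (THE T. \<forall>y\<in>B. op_apply T (\<Lambda> y) = \<Lambda> (y * x))"

text \<open>Traciality makes the adjoint isometric in L2 (Tomita's conjugation on the dense part),
  so bounds for left multiplication become bounds for right multiplication.\<close>

lemma norm_\<Lambda>_adj: "y \<in> B \<Longrightarrow> norm (\<Lambda> (adj y)) = norm (\<Lambda> y)"
proof -
  assume y: "y \<in> B"
  have "complex_of_real ((norm (\<Lambda> (adj y)))\<^sup>2) = complex_of_real ((norm (\<Lambda> y))\<^sup>2)"
    unfolding cinner_self[symmetric] using y B by (simp add: cinner_\<Lambda> tr_comm)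
  then show ?thesis by (simp del: of_real_power add: power2_eq_iff_nonneg)
qed

lemma \<rho>_\<Lambda>: "x \<in> B \<Longrightarrow> y \<in> B \<Longrightarrow> op_apply (\<rho> x) (\<Lambda> y) = \<Lambda> (y * x)"
proof -
  assume x: "x \<in> B" and y: "y \<in> B"
  obtain C where C: "\<And>y. y \<in> B \<Longrightarrow> norm (\<Lambda> (adj x * y)) \<le> C * norm (\<Lambda> y)"
    using \<Lambda>_mult_bounded[OF B(7)[OF x]] by blast
  have "norm (\<Lambda> (y * x)) \<le> C * norm (\<Lambda> y)" if "y \<in> B" for y
    using C[OF B(7)[OF that]] norm_\<Lambda>_adj[OF B(5)[OF that x]] norm_\<Lambda>_adj[OF that] by simp
  then have "\<exists>!T. \<forall>y\<in>B. op_apply T (\<Lambda> y) = \<Lambda> (y * x)"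
    using x B by (intro op_on_\<Lambda>_exists) (auto simp: distrib_right)
  from theI'[OF this] show ?thesis using y unfolding \<rho>_def by blast
qed

lemma \<pi>_one: "\<pi> 1 = 1"
  and \<pi>_add: "x \<in> B \<Longrightarrow> y \<in> B \<Longrightarrow> \<pi> (x + y) = \<pi> x + \<pi> y"
  and \<pi>_diff: "x \<in> B \<Longrightarrow> y \<in> B \<Longrightarrow> \<pi> (x - y) = \<pi> x - \<pi> y"
  and \<pi>_mult: "x \<in> B \<Longrightarrow> y \<in> B \<Longrightarrow> \<pi> (x * y) = \<pi> x * \<pi> y"
  and \<pi>_scaleC: "x \<in> B \<Longrightarrow> \<pi> (c *\<^sub>C x) = c *\<^sub>C \<pi> x"
  and \<pi>_\<rho>: "x \<in> B \<Longrightarrow> y \<in> B \<Longrightarrow> \<pi> x * \<rho> y = \<rho> y * \<pi> x"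
  by (rule op_eq_on_\<Lambda>; simp add: \<pi>_\<Lambda> \<rho>_\<Lambda> B distrib_right left_diff_distrib \<Lambda>_add \<Lambda>_diff \<Lambda>_scaleC mult.assoc)+

lemma adj_eq_on_\<Lambda>:
  assumes "\<And>y z. y \<in> B \<Longrightarrow> z \<in> B \<Longrightarrow> cinner (op_apply S (\<Lambda> y)) (\<Lambda> z) = cinner (\<Lambda> y) (op_apply T (\<Lambda> z))"
  shows "adj S = T"
proof (rule op_eq_on_\<Lambda>)
  fix z assume z: "z \<in> B"
  have "cinner (op_apply (adj S) (\<Lambda> z) - op_apply T (\<Lambda> z)) w = 0" for w
  proof (rule orthogonal_dense[where D = "\<Lambda> ` B"])
    fix w assume "w \<in> \<Lambda> ` B"
    then obtain y where y: "y \<in> B" "w = \<Lambda> y" by blast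
    have "cinner w (op_apply (adj S) (\<Lambda> z) - op_apply T (\<Lambda> z)) = 0"
      using assms[OF y(1) z] y by (simp add: cinner.diff_right cinner_adj)
    then show "cinner (op_apply (adj S) (\<Lambda> z) - op_apply T (\<Lambda> z)) w = 0"
      by (metis cinner_commute complex_cnj_zero)
  qed (simp add: \<Lambda>_dense)
  then show "op_apply (adj S) (\<Lambda> z) = op_apply T (\<Lambda> z)"
    by (metis cinner_eq_0_self eq_iff_diff_eq_0)
qed

lemma adj_\<pi>: "x \<in> B \<Longrightarrow> adj (\<pi> x) = \<pi> (adj x)"
  by (rule adj_eq_on_\<Lambda>) (simp add: \<pi>_\<Lambda> cinner_\<Lambda> B mult.assoc)

lemma adj_\<rho>: "x \<in> B \<Longrightarrow> adj (\<rho> x) = \<rho> (adj x)"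
proof (rule adj_eq_on_\<Lambda>)
  fix y z assume x: "x \<in> B" and y: "y \<in> B" and z: "z \<in> B"
  have "tr (adj z * (y * x)) = tr (x * (adj z * y))"
    using tr_comm[of "adj z * y" x] x y z B by (simp add: mult.assoc)
  then show "cinner (op_apply (\<rho> x) (\<Lambda> y)) (\<Lambda> z) = cinner (\<Lambda> y) (op_apply (\<rho> (adj x)) (\<Lambda> z))"
    using x y z B by (simp add: \<rho>_\<Lambda> cinner_\<Lambda> mult.assoc)
qed

end

section \<open>The Jones projection\<close>

locale gns_inclusion = tracial_gns B tr \<Lambda>
  for B :: "'h::complex_hilbert_space bop set" and tr and \<Lambda> :: "'h bop \<Rightarrow> 'k::complex_hilbert_space" +
  fixes A :: "'h bop set" and E :: "'h bop \<Rightarrow> 'h bop"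
  assumes vnaA: "von_neumann_algebra A" and AB: "A \<subseteq> B"
    and cond_exp: "conditional_expectation A B tr E"
begin

abbreviation e :: "'k bop" where "e \<equiv> jones_projection \<Lambda> A"
abbreviation M1 :: "'k bop set" where "M1 \<equiv> basic_construction \<Lambda> A B"

lemmas A = von_neumann_algebraD(1-7)[OF vnaA]

lemma AB': "x \<in> A \<Longrightarrow> x \<in> B" using AB by blast

lemma E_in: "x \<in> B \<Longrightarrow> E x \<in> A"
  and E_bimod: "a \<in> A \<Longrightarrow> x \<in> B \<Longrightarrow> b \<in> A \<Longrightarrow> E (a * x * b) = a * E x * b"
  and E_id: "a \<in> A \<Longrightarrow> E a = a"
  and tr_E: "x \<in> B \<Longrightarrow> tr (E x) = tr x"
  using cond_exp unfolding conditional_expectation_def by blast+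

lemma E_inB: "x \<in> B \<Longrightarrow> E x \<in> B" using E_in AB by blast

lemma E_left: "a \<in> A \<Longrightarrow> x \<in> B \<Longrightarrow> E (a * x) = a * E x"
  and E_right: "x \<in> B \<Longrightarrow> b \<in> A \<Longrightarrow> E (x * b) = E x * b"
  using E_bimod[of a x 1] E_bimod[of 1 x b] A(1) by simp_all

lemma L2A: "csubspace (closure (\<Lambda> ` A))" "closed (closure (\<Lambda> ` A))"
  by (rule csubspace_closure[OF csubspace_\<Lambda>[OF vnaA AB]]) simp

lemma \<Lambda>_in_L2A: "a \<in> A \<Longrightarrow> \<Lambda> a \<in> closure (\<Lambda> ` A)"
  by (rule subsetD[OF closure_subset imageI])

lemmas e_mem = proj_onto_mem[OF L2A, folded jones_projection_def]

lemma e_projection: "adj e = e" "e * e = e" "op_apply e (op_apply e \<xi>) = op_apply e \<xi>"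
proof -
  show "adj e = e" and *: "e * e = e"
    using proj_onto(1)[OF L2A] by (simp_all only: is_projection_def jones_projection_def)
  show "op_apply e (op_apply e \<xi>) = op_apply e \<xi>"
    using arg_cong[OF *, of "\<lambda>T. op_apply T \<xi>"] by simp
qed

lemma cinner_e: "cinner (op_apply e \<xi>) \<eta> = cinner \<xi> (op_apply e \<eta>)"
  using cinner_adj[of e] e_projection(1) by simp

text \<open>Trace invariance and the module property of \<open>E\<close> make \<open>x - E x\<close>
  orthogonal to \<open>A\<close>, hence to its closure.\<close>

lemma e_\<Lambda>: "x \<in> B \<Longrightarrow> op_apply e (\<Lambda> x) = \<Lambda> (E x)"
  unfolding jones_projection_def
proof (rule proj_onto_eqI[OF L2A \<Lambda>_in_L2A])
  assume x: "x \<in> B"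
  show "E x \<in> A" by (rule E_in[OF x])
  show "cinner (\<Lambda> x - \<Lambda> (E x)) z = 0" if "z \<in> closure (\<Lambda> ` A)" for z
  proof (rule orthogonal_dense[OF _ that])
    fix z assume "z \<in> \<Lambda> ` A"
    then obtain a where a: "a \<in> A" "z = \<Lambda> a" by blast
    have "tr (adj a * x) = tr (adj a * E x)"
      using tr_E[of "adj a * x"] E_left[of "adj a" x] a x A(7) B(5) AB' by simp
    then show "cinner (\<Lambda> x - \<Lambda> (E x)) z = 0"
      using a x AB' E_inB by (simp add: cinner.diff_left cinner_\<Lambda>)
  qed
qed

lemma e_\<Lambda>_A: "a \<in> A \<Longrightarrow> op_apply e (\<Lambda> a) = \<Lambda> a"
  using e_\<Lambda> E_id AB' by simp

lemma e_\<pi>_e: "x \<in> B \<Longrightarrow> e * \<pi> x * e = \<pi> (E x) * e"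
  by (rule op_eq_on_\<Lambda>) (simp add: e_\<Lambda> \<pi>_\<Lambda> E_inB B E_right E_in mult.assoc)

lemma e_\<pi>: "a \<in> A \<Longrightarrow> e * \<pi> a = \<pi> a * e"
  by (rule op_eq_on_\<Lambda>) (simp add: e_\<Lambda> \<pi>_\<Lambda> AB' E_inB B E_left)

lemma e_\<rho>: "a \<in> A \<Longrightarrow> e * \<rho> a = \<rho> a * e"
  by (rule op_eq_on_\<Lambda>) (simp add: e_\<Lambda> \<rho>_\<Lambda> AB' E_inB B E_right)

text \<open>Evaluate at \<open>\<Lambda> 1\<close>, which \<open>e\<close> fixes and which separates
  by faithfulness of the trace.\<close>

lemma \<pi>_e_inj: "a \<in> A \<Longrightarrow> \<pi> a * e = 0 \<Longrightarrow> a = 0"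
proof -
  assume a: "a \<in> A" and "\<pi> a * e = 0"
  then have "op_apply (\<pi> a * e) (\<Lambda> 1) = 0" by simp
  then have "\<Lambda> a = 0" using a e_\<Lambda>_A[OF A(1)] by (simp add: \<pi>_\<Lambda> AB' B)
  then show ?thesis using \<Lambda>_eq_0 a AB' by blast
qed

text \<open>Not among the clauses of \<open>conditional_expectation\<close>; it comes from taking
  adjoints in \<open>e x e = E(x) e\<close> and cancelling \<open>e\<close> by
  \<open>\<pi>_e_inj\<close>.\<close>

lemma E_adj: "x \<in> B \<Longrightarrow> E (adj x) = adj (E x)"
proof -
  assume x: "x \<in> B"
  have "\<pi> (E (adj x)) * e = e * \<pi> (adj x) * e" using x B e_\<pi>_e by simp
  also have "\<dots> = adj (e * \<pi> x * e)" using x by (simp add: e_projection adj_\<pi> mult.assoc)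
  also have "\<dots> = \<pi> (adj (E x)) * e"
    using x e_\<pi>[of "adj (E x)"] by (simp add: e_\<pi>_e e_projection adj_\<pi> E_inB E_in A)
  finally have "\<pi> (E (adj x) - adj (E x)) * e = 0"
    using x by (simp add: \<pi>_diff E_inB B left_diff_distrib)
  then show ?thesis using \<pi>_e_inj[of "E (adj x) - adj (E x)"] x A B E_in by simp
qed

lemma vna_M1: "von_neumann_algebra M1"
  unfolding basic_construction_def by (rule von_neumann_algebra_hull)

lemmas M1 = von_neumann_algebraD(1-7)[OF vna_M1]

lemma e_in_M1: "e \<in> M1" and \<pi>_in_M1: "x \<in> B \<Longrightarrow> \<pi> x \<in> M1"
  using hull_subset[of "\<pi> ` B \<union> {e}" von_neumann_algebra] unfolding basic_construction_def by auto

lemma M1_\<rho>: "T \<in> M1 \<Longrightarrow> y \<in> A \<Longrightarrow> T * \<rho> y = \<rho> y * T"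
proof -
  have "adj ` \<rho> ` A \<subseteq> \<rho> ` A" by (auto simp: adj_\<rho> AB' A)
  moreover have "\<pi> ` B \<union> {e} \<subseteq> commutant (\<rho> ` A)"
    by (auto intro!: commutantI simp: \<pi>_\<rho> e_\<rho> AB')
  ultimately have "M1 \<subseteq> commutant (\<rho> ` A)"
    unfolding basic_construction_def by (intro hull_minimal von_neumann_algebra_commutant)
  then show "T \<in> M1 \<Longrightarrow> y \<in> A \<Longrightarrow> T * \<rho> y = \<rho> y * T" by (blast intro: commutantD)
qed

end

section \<open>Bases\<close>

text \<open>Near \<open>c = 0\<close> the terms linear in \<open>c\<close> dominate the quadratic
  one, and they change sign with \<open>c\<close>; nonnegativity therefore forces them to
  vanish.\<close>

lemma nonneg_quadratic_imp_zero:
  fixes \<alpha> \<beta> :: complex and g :: real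
  assumes "\<And>c. c * \<beta> + cnj c * \<alpha> + complex_of_real ((cmod c)\<^sup>2 * g) \<in> \<real>\<^sub>\<ge>\<^sub>0"
  shows "\<alpha> = 0"
proof -
  have "c * \<beta> + cnj c * \<alpha> = 0" for c
  proof (rule complex_eqI)
    show "Im (c * \<beta> + cnj c * \<alpha>) = Im 0"
      using assms[of c] by (simp add: complex_nonneg_Reals_iff)
    define R where "R = Re (c * \<beta> + cnj c * \<alpha>)"
    define K where "K = \<bar>(cmod c)\<^sup>2 * g\<bar> + 1"
    have K: "K > 0" by (simp add: K_def add_nonneg_pos)
    \<comment> \<open>With this real multiple, \<open>t R + t^2 (K - 1)\<close> equals
      \<open>-(R / K)^2\<close>; the summand 1 in \<open>K\<close> keeps \<open>K\<close> positive
      and leaves this strictly negative remainder unless \<open>R = 0\<close>.\<close>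
    define t where "t = - R / K"
    have "0 \<le> Re (complex_of_real t * (c * \<beta> + cnj c * \<alpha>) + complex_of_real ((cmod (complex_of_real t * c))\<^sup>2 * g))"
      using assms[of "complex_of_real t * c"] by (simp add: complex_nonneg_Reals_iff algebra_simps)
    also have "\<dots> = t * R + t\<^sup>2 * ((cmod c)\<^sup>2 * g)"
      unfolding R_def by (simp add: norm_mult power_mult_distrib algebra_simps)
    also have "\<dots> \<le> t * R + t\<^sup>2 * (K - 1)"
      by (intro add_left_mono mult_left_mono) (auto simp: K_def)
    also have "\<dots> = - (R / K)\<^sup>2"
      using K by (simp add: t_def field_simps power2_eq_square)
    finally have "(R / K)\<^sup>2 = 0" using zero_le_power2[of "R / K"] by linarith
    then show "Re (c * \<beta> + cnj c * \<alpha>) = Re 0" using K by (simp add: R_def)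
  qed
  \<comment> \<open>\<open>c = 1\<close> gives \<open>\<alpha> = - \<beta>\<close> and
    \<open>c = \<i>\<close> gives \<open>\<alpha> = \<beta>\<close>.\<close>
  from this[of 1] this[of \<i>] show ?thesis by (auto simp: complex_eq_iff)
qed

text \<open>Cauchy-Schwarz for a possibly unfaithful trace, by expanding positivity at
  \<open>r + c (adj S)\<close>: the term free of \<open>c\<close> is
  \<open>\<phi> (adj r * r) = 0\<close>, so the coefficient of \<open>cnj c\<close> must vanish
  too.\<close>

lemma positive_trace_null:
  assumes A: "von_neumann_algebra A" and \<phi>: "positive_trace A \<phi>"
    and r: "r \<in> A" "\<phi> (adj r * r) = 0" and S: "S \<in> A"
  shows "\<phi> (S * r) = 0"
proof -
  note A = von_neumann_algebraD[OF A]
  have add: "\<phi> (x + y) = \<phi> x + \<phi> y" if "x \<in> A" "y \<in> A" for x y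
    using \<phi> that by (simp add: positive_trace_def linear_functional_on_def)
  have scale: "\<phi> (c *\<^sub>C x) = c * \<phi> x" if "x \<in> A" for c x
    using \<phi> that by (simp add: positive_trace_def linear_functional_on_def)
  have pos: "\<phi> (adj x * x) \<in> \<real>\<^sub>\<ge>\<^sub>0" if "x \<in> A" for x
    using \<phi> that by (simp add: positive_trace_def)
  have "\<phi> (S * adj S) \<in> \<real>\<^sub>\<ge>\<^sub>0" using pos[of "adj S"] S A by simp
  then obtain g where g: "\<phi> (S * adj S) = complex_of_real g" by (auto elim: nonneg_Reals_cases)
  show ?thesis
  proof (rule nonneg_quadratic_imp_zero)
    fix c
    have "\<phi> (adj (r + c *\<^sub>C adj S) * (r + c *\<^sub>C adj S)) \<in> \<real>\<^sub>\<ge>\<^sub>0" by (intro pos A r S)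
    also have "adj (r + c *\<^sub>C adj S) * (r + c *\<^sub>C adj S)
        = adj r * r + c *\<^sub>C (adj r * adj S) + cnj c *\<^sub>C (S * r) + (cnj c * c) *\<^sub>C (S * adj S)"
      by (simp add: distrib_left distrib_right add.assoc mult.commute)
    also have "\<phi> \<dots> = c * \<phi> (adj r * adj S) + cnj c * \<phi> (S * r) + complex_of_real ((cmod c)\<^sup>2 * g)"
      using r S A by (simp add: add scale g complex_norm_square mult.commute[of "cnj c" c] del: of_real_power)
    finally show "c * \<phi> (adj r * adj S) + cnj c * \<phi> (S * r) + complex_of_real ((cmod c)\<^sup>2 * g) \<in> \<real>\<^sub>\<ge>\<^sub>0" .
  qed
qed

section \<open>The basis conditions and their consequences\<close>

context gns_inclusion
begin

text \<open>The resolution of the identity, evaluated on \<open>\<Lambda> x\<close>, is the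
  expansion of \<open>x\<close>; since \<open>\<Lambda>\<close> is injective with dense range,
  neither side loses information.\<close>

lemma basis_resolution:
  assumes l: "\<And>i. i \<in> I \<Longrightarrow> l i \<in> B"
  shows "(\<Sum>i\<in>I. \<pi> (adj (l i)) * e * \<pi> (l i)) = 1 \<longleftrightarrow> (\<forall>x\<in>B. x = (\<Sum>i\<in>I. adj (l i) * E (l i * x)))"
proof -
  have eval: "op_apply (\<Sum>i\<in>I. \<pi> (adj (l i)) * e * \<pi> (l i)) (\<Lambda> x) = \<Lambda> (\<Sum>i\<in>I. adj (l i) * E (l i * x))"
    if "x \<in> B" for x
    using that l B E_inB by (simp add: op_sum \<pi>_\<Lambda> e_\<Lambda> \<Lambda>_sum)
  have mem: "(\<Sum>i\<in>I. adj (l i) * E (l i * x)) \<in> B" if "x \<in> B" for x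
    using that l by (intro von_neumann_algebra_sum[OF vna] B E_inB)
  show ?thesis
  proof
    assume 1: "(\<Sum>i\<in>I. \<pi> (adj (l i)) * e * \<pi> (l i)) = 1"
    show "\<forall>x\<in>B. x = (\<Sum>i\<in>I. adj (l i) * E (l i * x))"
    proof
      fix x assume x: "x \<in> B"
      have "\<Lambda> x = \<Lambda> (\<Sum>i\<in>I. adj (l i) * E (l i * x))"
        using eval[OF x] unfolding 1 op_simps .
      then show "x = (\<Sum>i\<in>I. adj (l i) * E (l i * x))" by (rule \<Lambda>_inj[OF x mem[OF x]])
    qed
  next
    assume *: "\<forall>x\<in>B. x = (\<Sum>i\<in>I. adj (l i) * E (l i * x))"
    show "(\<Sum>i\<in>I. \<pi> (adj (l i)) * e * \<pi> (l i)) = 1"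
    proof (rule op_eq_on_\<Lambda>)
      fix x assume x: "x \<in> B"
      from * x have "\<Lambda> (\<Sum>i\<in>I. adj (l i) * E (l i * x)) = \<Lambda> x" by metis
      then show "op_apply (\<Sum>i\<in>I. \<pi> (adj (l i)) * e * \<pi> (l i)) (\<Lambda> x) = op_apply 1 (\<Lambda> x)"
        using eval[OF x] by simp
    qed
  qed
qed

text \<open>Replace \<open>x\<close> by \<open>adj x\<close> and take adjoints; \<open>E_adj\<close>
  exchanges the two forms.\<close>

lemma basis_expansion_adj:
  assumes l: "\<And>i. i \<in> I \<Longrightarrow> l i \<in> B"
  shows "(\<forall>x\<in>B. x = (\<Sum>i\<in>I. E (x * adj (l i)) * l i)) \<longleftrightarrow> (\<forall>x\<in>B. x = (\<Sum>i\<in>I. adj (l i) * E (l i * x)))"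
proof -
  have *: "adj (\<Sum>i\<in>I. E (x * adj (l i)) * l i) = (\<Sum>i\<in>I. adj (l i) * E (l i * adj x))" if "x \<in> B" for x
  proof -
    have "adj (E (x * adj (l i))) = E (l i * adj x)" if "i \<in> I" for i
      using E_adj[of "x * adj (l i)"] l[OF that] B \<open>x \<in> B\<close> by simp
    then show ?thesis by (simp add: adj_sum)
  qed
  show ?thesis
  proof (intro iffI ballI)
    fix x assume x: "x \<in> B" and "\<forall>x\<in>B. x = (\<Sum>i\<in>I. E (x * adj (l i)) * l i)"
    then have "adj x = (\<Sum>i\<in>I. E (adj x * adj (l i)) * l i)" using B(7)[OF x] by blast
    then have "adj (adj x) = adj (\<Sum>i\<in>I. E (adj x * adj (l i)) * l i)" by (rule arg_cong)
    then show "x = (\<Sum>i\<in>I. adj (l i) * E (l i * x))"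
      unfolding *[OF B(7)[OF x]] adj_simps(1) .
  next
    fix x assume x: "x \<in> B" and "\<forall>x\<in>B. x = (\<Sum>i\<in>I. adj (l i) * E (l i * x))"
    then have "adj x = (\<Sum>i\<in>I. adj (l i) * E (l i * adj x))" using B(7)[OF x] by blast
    then have "adj (adj x) = adj (adj (\<Sum>i\<in>I. E (x * adj (l i)) * l i))"
      unfolding *[OF x] by (rule arg_cong)
    then show "x = (\<Sum>i\<in>I. E (x * adj (l i)) * l i)" unfolding adj_simps(1) .
  qed
qed

text \<open>If \<open>Q\<close> is a projection, then \<open>p = \<Sum> l\<^sub>i\<^sup>* e l\<^sub>i\<close> satisfies \<open>Tr((1 - p)\<^sup>2) = 0\<close>, so \<open>1 - p\<close> lies in
  the null space of the Markov trace. Faithfulness of \<open>Tr\<close> on \<open>\<langle>B, e\<rangle>\<close> is not available, but testing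
  \<open>1 - p\<close> against \<open>x e y\<close> only involves the faithful trace of \<open>B\<close>.\<close>

lemma markov_basis_expansion:
  assumes markov: "markov_trace \<Lambda> A B tr \<sigma>" and l: "\<And>i. i \<in> I \<Longrightarrow> l i \<in> B" and fin: "finite I"
    and Q: "\<And>j. j \<in> I \<Longrightarrow> (\<Sum>i\<in>I. E (l j * adj (l i)) * E (l i * adj (l j))) = E (l j * adj (l j))"
    and trQ: "(\<Sum>i\<in>I. tr (E (l i * adj (l i)))) = complex_of_real (inverse \<sigma>)"
    and x: "x \<in> B"
  shows "x = (\<Sum>i\<in>I. adj (l i) * E (l i * x))"
proof -
  have \<sigma>: "\<sigma> > 0" using markov by (simp add: markov_trace_def)
  obtain Tr where Tr: "positive_trace M1 Tr" "\<And>x. x \<in> B \<Longrightarrow> Tr (\<pi> x) = tr x"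
    "\<And>x. x \<in> B \<Longrightarrow> Tr (\<pi> x * e) = complex_of_real \<sigma> * tr x"
    using markov by (auto simp: markov_trace_def)
  have Tr_add: "Tr (S + T) = Tr S + Tr T" if "S \<in> M1" "T \<in> M1" for S T
    using Tr(1) that by (simp add: positive_trace_def linear_functional_on_def)
  have Tr_diff: "Tr (S - T) = Tr S - Tr T" if "S \<in> M1" "T \<in> M1" for S T
    using Tr_add[of "S - T" T] that M1 by simp
  have Tr_comm: "Tr (S * T) = Tr (T * S)" if "S \<in> M1" "T \<in> M1" for S T
    using Tr(1) that by (simp add: positive_trace_def)
  have Tr0: "Tr 0 = 0" using Tr_add[of 0 0] M1 by simp
  have Tr_sum: "Tr (\<Sum>i\<in>J. g i) = (\<Sum>i\<in>J. Tr (g i))" if "\<And>i. i \<in> J \<Longrightarrow> g i \<in> M1" for J g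
    using that
  proof (induction J rule: infinite_finite_induct)
    case (insert i J)
    then show ?case using von_neumann_algebra_sum[OF vna_M1, of J g] by (simp add: Tr_add)
  qed (auto simp: Tr0)
  have Tr_xey: "Tr (\<pi> x * e * \<pi> y) = complex_of_real \<sigma> * tr (y * x)" if "x \<in> B" "y \<in> B" for x y
  proof -
    have "Tr (\<pi> x * e * \<pi> y) = Tr (\<pi> y * (\<pi> x * e))"
      using that by (intro Tr_comm M1 \<pi>_in_M1 e_in_M1)
    then show ?thesis using that Tr(3)[of "y * x"] B by (simp add: \<pi>_mult mult.assoc)
  qed
  define p where "p = (\<Sum>i\<in>I. \<pi> (adj (l i)) * e * \<pi> (l i))"
  have term_M1: "\<pi> (adj (l i)) * e * \<pi> (l i) \<in> M1" if "i \<in> I" for i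
    using that l B by (intro M1 \<pi>_in_M1 e_in_M1) auto
  have p: "p \<in> M1" unfolding p_def by (intro von_neumann_algebra_sum[OF vna_M1] term_M1)
  have adjp: "adj p = p"
    unfolding p_def adj_sum using l B by (intro sum.cong refl) (simp add: adj_\<pi> e_projection mult.assoc)
  \<comment> \<open>Each summand contributes \<open>\<sigma>\<close> times the trace of a diagonal
    entry of the matrix \<open>Q\<close>, and these traces add up to
    \<open>inverse \<sigma>\<close>.\<close>
  have Trp: "Tr p = 1"
  proof -
    have "Tr p = (\<Sum>i\<in>I. complex_of_real \<sigma> * tr (E (l i * adj (l i))))"
      unfolding p_def using l B by (simp add: Tr_sum term_M1 Tr_xey tr_E)
    then show ?thesis using trQ \<sigma> by (simp add: sum_distrib_left[symmetric])
  qed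
  have term2: "(\<pi> (adj (l i)) * e * \<pi> (l i)) * (\<pi> (adj (l j)) * e * \<pi> (l j))
      = \<pi> (adj (l i) * E (l i * adj (l j))) * e * \<pi> (l j)" if "i \<in> I" "j \<in> I" for i j
  proof -
    have "(\<pi> (adj (l i)) * e * \<pi> (l i)) * (\<pi> (adj (l j)) * e * \<pi> (l j))
      = \<pi> (adj (l i)) * (e * (\<pi> (l i) * \<pi> (adj (l j))) * e) * \<pi> (l j)" by (simp add: mult.assoc)
    also have "\<dots> = \<pi> (adj (l i)) * (\<pi> (E (l i * adj (l j))) * e) * \<pi> (l j)"
      using that l B by (simp add: \<pi>_mult[symmetric] e_\<pi>_e)
    finally show ?thesis using that l B E_inB by (simp add: \<pi>_mult mult.assoc)
  qed
  \<comment> \<open>\<open>e x e = E(x) e\<close> collapses the middle of every product and leaves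
    the entries of \<open>Q\<close> times \<open>Q\<close>; idempotence of \<open>Q\<close> reduces
    this to the computation of \<open>Tr p\<close>.\<close>
  have Trpp: "Tr (p * p) = 1"
  proof -
    have "p * p = (\<Sum>j\<in>I. \<Sum>i\<in>I. (\<pi> (adj (l i)) * e * \<pi> (l i)) * (\<pi> (adj (l j)) * e * \<pi> (l j)))"
      unfolding p_def by (subst sum.swap) (simp only: sum_product)
    also have "\<dots> = (\<Sum>j\<in>I. \<Sum>i\<in>I. \<pi> (adj (l i) * E (l i * adj (l j))) * e * \<pi> (l j))"
      by (intro sum.cong refl term2)
    also have "Tr \<dots> = (\<Sum>j\<in>I. \<Sum>i\<in>I. Tr (\<pi> (adj (l i) * E (l i * adj (l j))) * e * \<pi> (l j)))"
      using l B E_inB \<pi>_in_M1 M1 e_in_M1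
      by (subst Tr_sum; (intro sum.cong refl Tr_sum)?) (auto intro!: von_neumann_algebra_sum[OF vna_M1])
    also have "\<dots> = (\<Sum>j\<in>I. \<Sum>i\<in>I. complex_of_real \<sigma> * tr (E (l j * adj (l i)) * E (l i * adj (l j))))"
    proof (intro sum.cong refl)
      fix i j assume ij: "j \<in> I" "i \<in> I"
      have "tr (l j * adj (l i) * E (l i * adj (l j))) = tr (E (l j * adj (l i)) * E (l i * adj (l j)))"
        using ij l B tr_E[of "l j * adj (l i) * E (l i * adj (l j))"] E_right[of "l j * adj (l i)" "E (l i * adj (l j))"]
          E_in E_inB by simp
      then show "Tr (\<pi> (adj (l i) * E (l i * adj (l j))) * e * \<pi> (l j))
          = complex_of_real \<sigma> * tr (E (l j * adj (l i)) * E (l i * adj (l j)))"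
        using Tr_xey[of "adj (l i) * E (l i * adj (l j))" "l j"] ij l B E_inB by (simp add: mult.assoc)
    qed
    also have "\<dots> = complex_of_real \<sigma> * (\<Sum>j\<in>I. tr (E (l j * adj (l j))))"
    proof -
      have "(\<Sum>i\<in>I. tr (E (l j * adj (l i)) * E (l i * adj (l j)))) = tr (E (l j * adj (l j)))" if "j \<in> I" for j
        unfolding Q[OF that, symmetric] using that l by (intro tr_sum[symmetric] B E_inB)
      then show ?thesis by (simp add: sum_distrib_left[symmetric])
    qed
    finally show ?thesis using trQ \<sigma> by simp
  qed
  define r where "r = 1 - p"
  have r: "r \<in> M1" unfolding r_def by (intro M1 p)
  have "adj r * r = (1 - p) - (p - p * p)" by (simp add: r_def adjp algebra_simps)
  also have "Tr \<dots> = 0"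
    using Trp Trpp Tr(2)[OF B(1)] p M1 by (simp add: Tr_diff \<pi>_one tr_one)
  finally have r0: "Tr (adj r * r) = 0" .
  \<comment> \<open>\<open>d\<close> is the defect of the expansion. Multiplication by
    \<open>r\<close> takes \<open>\<pi> x * e\<close> to \<open>\<pi> d * e\<close>, so nullity of
    \<open>r\<close> turns into \<open>tr (y * d) = 0\<close> for all \<open>y\<close>, in
    particular for \<open>y = adj d\<close>.\<close>
  define d where "d = x - (\<Sum>i\<in>I. adj (l i) * E (l i * x))"
  have sumB: "(\<Sum>i\<in>I. adj (l i) * E (l i * x)) \<in> B"
    using l x by (intro von_neumann_algebra_sum[OF vna] B E_inB)
  have d: "d \<in> B" unfolding d_def by (intro B x sumB)
  have "tr (y * d) = 0" if y: "y \<in> B" for y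
  proof -
    have "0 = Tr ((\<pi> x * e * \<pi> y) * r)"
      using x y by (intro positive_trace_null[OF vna_M1 Tr(1) r r0, symmetric] M1 \<pi>_in_M1 e_in_M1)
    also have "\<dots> = Tr (r * (\<pi> x * e * \<pi> y))"
      using x y by (intro Tr_comm r M1 \<pi>_in_M1 e_in_M1)
    also have "r * (\<pi> x * e * \<pi> y) = \<pi> d * e * \<pi> y"
    proof -
      have "p * (\<pi> x * e) = \<pi> (\<Sum>i\<in>I. adj (l i) * E (l i * x)) * e"
      proof (rule op_eq_on_\<Lambda>)
        fix z assume z: "z \<in> B"
        then show "op_apply (p * (\<pi> x * e)) (\<Lambda> z) = op_apply (\<pi> (\<Sum>i\<in>I. adj (l i) * E (l i * x)) * e) (\<Lambda> z)"
          unfolding p_def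
          using l x sumB B E_inB E_in
          by (simp add: op_sum \<pi>_\<Lambda> e_\<Lambda> \<Lambda>_sum E_right sum_distrib_right mult.assoc[symmetric])
      qed
      then show ?thesis using x sumB
        by (simp add: r_def d_def \<pi>_diff left_diff_distrib mult.assoc[symmetric])
    qed
    also have "Tr \<dots> = complex_of_real \<sigma> * tr (y * d)" by (rule Tr_xey[OF d y])
    finally show ?thesis using \<sigma> by simp
  qed
  then have "tr (adj d * d) = 0" using B(7)[OF d] by blast
  then have "d = 0" using tr_faithful d by blast
  then show ?thesis by (simp add: d_def)
qed

text \<open>\<open>is_basis\<close> offers three alternatives. Each is led to the expansion
  \<open>main\<close>, the matrix condition through the Markov trace, and the other forms are
  recovered from \<open>main\<close>.\<close>

theorem is_basisD:
  assumes markov: "markov_trace \<Lambda> A B tr \<sigma>" and basis: "is_basis \<Lambda> A B tr \<sigma> E n l"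
  shows "i \<in> {1..n} \<Longrightarrow> l i \<in> B"
    and "x \<in> B \<Longrightarrow> x = (\<Sum>i=1..n. E (x * adj (l i)) * l i)"
    and "x \<in> B \<Longrightarrow> x = (\<Sum>i=1..n. adj (l i) * E (l i * x))"
    and "(\<Sum>i=1..n. \<pi> (adj (l i)) * e * \<pi> (l i)) = 1"
proof -
  note def = basis[unfolded is_basis_def Let_def]
  have n: "0 < n" by (rule conjunct1[OF def])
  have l: "l i \<in> B" if "i \<in> {1..n}" for i using conjunct1[OF conjunct2[OF def]] that by (rule bspec)
  have res: "(\<Sum>i=1..n. \<pi> (adj (l i)) * e * \<pi> (l i)) = 1
      \<longleftrightarrow> (\<forall>x\<in>B. x = (\<Sum>i=1..n. adj (l i) * E (l i * x)))"
    by (rule basis_resolution) (rule l)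
  have exp: "(\<forall>x\<in>B. x = (\<Sum>i=1..n. E (x * adj (l i)) * l i))
      \<longleftrightarrow> (\<forall>x\<in>B. x = (\<Sum>i=1..n. adj (l i) * E (l i * x)))"
    by (rule basis_expansion_adj) (rule l)
  have main: "\<forall>x\<in>B. x = (\<Sum>i=1..n. adj (l i) * E (l i * x))"
    using conjunct2[OF conjunct2[OF def]]
  proof (elim disjE conjE)
    assume Q: "\<forall>i\<in>{1..n}. \<forall>j\<in>{1..n}. adj (E (l j * adj (l i))) = E (l i * adj (l j)) \<and>
        (\<Sum>k=1..n. E (l i * adj (l k)) * E (l k * adj (l j))) = E (l i * adj (l j))"
      and tr: "(\<Sum>i=1..n. tr (E (l i * adj (l i)))) / of_nat n = complex_of_real (inverse \<sigma> / real n)"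
    have "(\<Sum>i=1..n. tr (E (l i * adj (l i)))) = complex_of_real (inverse \<sigma>)"
      using tr n by (simp add: field_simps)
    with Q show ?thesis by (intro ballI markov_basis_expansion[OF markov l]) simp_all
  next
    assume "(\<Sum>i=1..n. adj (\<pi> (l i)) * e * \<pi> (l i)) = 1"
    then have "(\<Sum>i=1..n. \<pi> (adj (l i)) * e * \<pi> (l i)) = 1" using l by (simp add: adj_\<pi>)
    then show ?thesis by (rule res[THEN iffD1])
  next
    assume "\<forall>x\<in>B. x = (\<Sum>i=1..n. E (x * adj (l i)) * l i)"
    then show ?thesis by (rule exp[THEN iffD1])
  qed
  show "i \<in> {1..n} \<Longrightarrow> l i \<in> B" by (rule l)
  show "x \<in> B \<Longrightarrow> x = (\<Sum>i=1..n. adj (l i) * E (l i * x))" by (rule bspec[OF main])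
  show "x \<in> B \<Longrightarrow> x = (\<Sum>i=1..n. E (x * adj (l i)) * l i)"
    by (rule bspec[OF exp[THEN iffD2, OF main]])
  show "(\<Sum>i=1..n. \<pi> (adj (l i)) * e * \<pi> (l i)) = 1"
    by (rule res[THEN iffD2, OF main])
qed

end

section \<open>The corner of the basic construction\<close>

text \<open>Invariance under \<open>adj z\<close> makes the orthogonal complement of
  \<open>S\<close> invariant under \<open>z\<close>. Applied to all \<open>z\<close> in a commutant,
  this places the projection in the bicommutant.\<close>

lemma projection_commutes:
  assumes S: "csubspace S" "closed S"
    and inv: "\<And>\<xi>. \<xi> \<in> S \<Longrightarrow> op_apply z \<xi> \<in> S" "\<And>\<xi>. \<xi> \<in> S \<Longrightarrow> op_apply (adj z) \<xi> \<in> S"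
  shows "z * proj_onto S = proj_onto S * z"
proof -
  let ?q = "proj_onto S"
  have q: "adj ?q = ?q" using proj_onto(1)[OF S] by (simp add: is_projection_def)
  have qzq: "?q * z * ?q = z * ?q"
    by (rule op_eqI) (simp add: proj_onto_mem(2)[OF S, THEN iffD1, OF inv(1)] proj_onto_mem(1)[OF S])
  have "?q * adj z * ?q = adj z * ?q"
    by (rule op_eqI) (simp add: proj_onto_mem(2)[OF S, THEN iffD1, OF inv(2)] proj_onto_mem(1)[OF S])
  from arg_cong[OF this, of adj] have "?q * z * ?q = ?q * z" by (simp add: q mult.assoc)
  then show ?thesis using qzq by simp
qed

lemma op_closure_invariant:
  assumes "\<And>\<xi>. \<xi> \<in> D \<Longrightarrow> op_apply z \<xi> \<in> closure D" "\<xi> \<in> closure D"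
  shows "op_apply z \<xi> \<in> closure D"
proof -
  obtain u where u: "\<And>k. u k \<in> D" "u \<longlonglongrightarrow> \<xi>" using assms(2) by (auto simp: closure_sequential)
  show ?thesis
    by (rule closed_sequentially[OF closed_closure assms(1)[OF u(1)] op_tendsto[OF u(2)]])
qed

lemma sums_Re: "f sums z \<Longrightarrow> (\<lambda>k. Re (f k)) sums Re z"
  by (rule bounded_linear.sums[OF bounded_linear_Re])

section \<open>Intertwiners and the commutation theorem on L2(A)\<close>

context gns_inclusion
begin

text \<open>Stands for the bounded left \<open>A\<close>-linear maps from L2(A) to H. As L2(A) is
  not a type of its own, \<open>W\<close> is defined on all of \<open>'k\<close>, and the last
  clause makes it vanish on the orthogonal complement.\<close>

definition intertwiner :: "('k \<Rightarrow> 'h) \<Rightarrow> bool" where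
  "intertwiner W \<longleftrightarrow> bounded_clinear W \<and> (\<forall>y\<in>A. \<forall>\<xi>. W (op_apply (\<pi> y) \<xi>) = op_apply y (W \<xi>)) \<and>
     (\<forall>\<xi>. W (op_apply e \<xi>) = W \<xi>)"

lemma intertwinerD:
  assumes "intertwiner W"
  shows "bounded_clinear W" "y \<in> A \<Longrightarrow> W (op_apply (\<pi> y) \<xi>) = op_apply y (W \<xi>)" "W (op_apply e \<xi>) = W \<xi>"
  using assms by (auto simp: intertwiner_def)

text \<open>Normality turns the trace into a functional dominated by \<open>\<langle>\<cdot> \<zeta>, \<zeta>\<rangle>\<close> on \<open>\<ell>\<^sup>2 \<otimes> H\<close>, where
  \<open>\<zeta> = (\<xi> + \<eta>) / 2\<close>, because \<open>\<parallel>\<xi> + \<eta>\<parallel>\<^sup>2 \<ge> 4 Re \<langle>\<xi>, \<eta>\<rangle>\<close>.\<close>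

lemma trace_dominated: "\<exists>\<zeta> :: 'h ell2. \<forall>y\<in>B. norm (\<Lambda> y) \<le> norm (amplify y \<zeta>)"
proof -
  obtain \<xi> \<eta> :: "nat \<Rightarrow> 'h" where s: "summable (\<lambda>k. (norm (\<xi> k))\<^sup>2)" "summable (\<lambda>k. (norm (\<eta> k))\<^sup>2)"
    and tr: "\<And>x. x \<in> B \<Longrightarrow> (\<lambda>k. cinner (op_apply x (\<xi> k)) (\<eta> k)) sums tr x"
    using tr_normal by (auto simp: normal_functional_def)
  define z where "z k = (1/2) *\<^sub>R (\<xi> k + \<eta> k)" for k
  have z: "summable (\<lambda>k. (norm (z k))\<^sup>2)"
    unfolding z_def by (rule sq_summable_bound[OF sq_summable_add[OF s], of _ "1/2"]) simp
  have "norm (\<Lambda> y) \<le> norm (amplify y (Ell2 z))" if y: "y \<in> B" for y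
  proof -
    have yy: "adj y * y \<in> B" using y by (intro B)
    have nth: "ell2_nth (amplify y (Ell2 z)) k = op_apply y (z k)" for k
      by (simp add: amplify.rep_eq Ell2_inverse z)
    have "complex_of_real ((norm (\<Lambda> y))\<^sup>2) = tr (adj y * y)"
      using y by (simp only: cinner_self[symmetric] cinner_\<Lambda>)
    then have "(norm (\<Lambda> y))\<^sup>2 = Re (tr (adj y * y))" by (metis Re_complex_of_real)
    then have sums: "(\<lambda>k. Re (cinner (op_apply y (\<xi> k)) (op_apply y (\<eta> k)))) sums (norm (\<Lambda> y))\<^sup>2"
      using sums_Re[OF tr[OF yy]] by (simp add: cinner_adj2)
    have "Re (cinner (op_apply y (\<xi> k)) (op_apply y (\<eta> k))) \<le> (norm (ell2_nth (amplify y (Ell2 z)) k))\<^sup>2" for k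
    proof -
      have "op_apply y (z k) = (1/2) *\<^sub>R (op_apply y (\<xi> k) + op_apply y (\<eta> k))"
        using op_scaleC[of y "complex_of_real (1/2)" "\<xi> k + \<eta> k"] unfolding scaleC_of_real z_def op_add by simp
      then have "(norm (op_apply y (z k)))\<^sup>2 = (norm (op_apply y (\<xi> k) + op_apply y (\<eta> k)))\<^sup>2 / 4"
        by (simp add: power_divide)
      moreover have "0 \<le> (norm (op_apply y (\<xi> k) - op_apply y (\<eta> k)))\<^sup>2" by simp
      ultimately show ?thesis
        unfolding nth using norm_add_sqr[of "op_apply y (\<xi> k)" "op_apply y (\<eta> k)"]
          parallelogram[of "op_apply y (\<xi> k)" "op_apply y (\<eta> k)"] by linarith
    qed
    then have "(norm (\<Lambda> y))\<^sup>2 \<le> (norm (amplify y (Ell2 z)))\<^sup>2"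
      unfolding norm_ell2_sq using sums by (intro sums_le[OF _ sums summable_sums[OF ell2_summable]])
    then show ?thesis by (simp add: power2_le_iff_abs_le)
  qed
  then show ?thesis by blast
qed

text \<open>By \<open>trace_dominated\<close>,
  \<open>amplify y \<zeta> \<mapsto> \<Lambda> y\<close> is a contraction; extended by 0 it becomes
  an \<open>A\<close>-linear map \<open>V\<close> from \<open>'h ell2\<close> onto a dense part of
  L2(A). The coordinates of its adjoint are intertwiners, and a vector of L2(A) killed by all of
  them is orthogonal to the range of \<open>V\<close>.\<close>

theorem intertwiners_separate:
  assumes \<xi>: "op_apply e \<xi> = \<xi>" and zero: "\<And>W. intertwiner W \<Longrightarrow> W \<xi> = 0"
  shows "\<xi> = 0"
proof -
  obtain \<zeta> :: "'h ell2" where \<zeta>: "\<And>y. y \<in> B \<Longrightarrow> norm (\<Lambda> y) \<le> norm (amplify y \<zeta>)"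
    using trace_dominated by blast
  define D where "D = (\<lambda>y. amplify y \<zeta>) ` A"
  have D: "csubspace D"
  proof (rule csubspaceI)
    show "0 \<in> D" unfolding D_def using amplify_simps(2)[of 0 1 \<zeta>] A(2)
      by (intro image_eqI[of _ _ 0]) (simp_all add: scaleC_zero_left)
    show "x + y \<in> D" if "x \<in> D" "y \<in> D" for x y
      using that A(3) by (auto simp: D_def amplify_simps(1)[symmetric])
    show "c *\<^sub>C x \<in> D" if "x \<in> D" for x c
      using that A(6) by (auto simp: D_def amplify_simps(2)[symmetric])
  qed
  note clD = csubspace_closure[OF D] closed_closure[of D]
  \<comment> \<open>The summand \<open>\<eta>\<close> is orthogonal to \<open>D\<close> and is sent
    to 0, which makes the domain dense in \<open>'h ell2\<close> and keeps the bound.\<close>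
  define G where "G = {(amplify y \<zeta> + \<eta>, \<Lambda> y) | y \<eta>. y \<in> A \<and> (\<forall>z\<in>D. cinner \<eta> z = 0)}"
  have GI: "(amplify y \<zeta> + \<eta>, \<Lambda> y) \<in> G" if "y \<in> A" "\<And>z. z \<in> D \<Longrightarrow> cinner \<eta> z = 0" for y \<eta>
    unfolding G_def using that by blast
  have dense: "closure (fst ` G) = UNIV"
  proof -
    have "u \<in> closure (fst ` G)" for u
    proof -
      obtain p where p: "p \<in> closure D" "\<And>z. z \<in> closure D \<Longrightarrow> cinner (u - p) z = 0"
        using orthogonal_projection_exists[OF clD] by blast
      obtain w where w: "\<And>k. w k \<in> D" "w \<longlonglongrightarrow> p" using p(1) by (auto simp: closure_sequential)
      have "w k + (u - p) \<in> fst ` G" for k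
      proof -
        obtain y where y: "y \<in> A" "w k = amplify y \<zeta>" using w(1)[of k] by (auto simp: D_def)
        have "(amplify y \<zeta> + (u - p), \<Lambda> y) \<in> G"
          using y p(2) subsetD[OF closure_subset[of D]] by (intro GI) auto
        then show ?thesis unfolding y(2) by (rule image_eqI[rotated]) simp
      qed
      moreover have "(\<lambda>k. w k + (u - p)) \<longlonglongrightarrow> p + (u - p)" by (intro tendsto_intros w)
      ultimately show ?thesis unfolding closure_sequential
        by (intro exI[of _ "\<lambda>k. w k + (u - p)"]) simp
    qed
    then show ?thesis by blast
  qed
  have "\<exists>V. bounded_clinear V \<and> (\<forall>(a, b)\<in>G. V a = b)"
  proof (rule bounded_clinear_extension)
    fix a b a' b' assume "(a, b) \<in> G" "(a', b') \<in> G"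
    then obtain y \<eta> y' \<eta>' where 1: "a = amplify y \<zeta> + \<eta>" "b = \<Lambda> y" "y \<in> A" "\<forall>z\<in>D. cinner \<eta> z = 0"
      and 2: "a' = amplify y' \<zeta> + \<eta>'" "b' = \<Lambda> y'" "y' \<in> A" "\<forall>z\<in>D. cinner \<eta>' z = 0"
      unfolding G_def by blast
    have "(amplify (y + y') \<zeta> + (\<eta> + \<eta>'), \<Lambda> (y + y')) \<in> G"
      using 1 2 by (intro GI A) (auto simp: cinner_add_left)
    moreover have "amplify (y + y') \<zeta> + (\<eta> + \<eta>') = a + a'" by (simp add: 1 2 amplify_simps)
    moreover have "\<Lambda> (y + y') = b + b'" using 1 2 AB' by (simp add: \<Lambda>_add)
    ultimately show "(a + a', b + b') \<in> G" by simp
  next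
    fix c a b assume "(a, b) \<in> G"
    then obtain y \<eta> where 1: "a = amplify y \<zeta> + \<eta>" "b = \<Lambda> y" "y \<in> A" "\<forall>z\<in>D. cinner \<eta> z = 0"
      unfolding G_def by blast
    have "(amplify (c *\<^sub>C y) \<zeta> + (c *\<^sub>C \<eta>), \<Lambda> (c *\<^sub>C y)) \<in> G"
      using 1 by (intro GI A) (auto simp: cinner_scaleC_left)
    moreover have "amplify (c *\<^sub>C y) \<zeta> + c *\<^sub>C \<eta> = c *\<^sub>C a" by (simp add: 1 amplify_simps scaleC_add_right)
    moreover have "\<Lambda> (c *\<^sub>C y) = c *\<^sub>C b" using 1 AB' by (simp add: \<Lambda>_scaleC)
    ultimately show "(c *\<^sub>C a, c *\<^sub>C b) \<in> G" by simp
  next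
    fix a b assume "(a, b) \<in> G"
    then obtain y \<eta> where 1: "a = amplify y \<zeta> + \<eta>" "b = \<Lambda> y" "y \<in> A" "\<forall>z\<in>D. cinner \<eta> z = 0"
      unfolding G_def by blast
    have "cinner \<eta> (amplify y \<zeta>) = 0" using 1 by (simp add: D_def)
    from orthogonal_norm[OF this] have "(norm (amplify y \<zeta>))\<^sup>2 \<le> (norm a)\<^sup>2"
      by (simp add: 1 add.commute)
    then have "norm (amplify y \<zeta>) \<le> norm a" by simp
    then show "norm b \<le> 1 * norm a" using \<zeta>[OF AB'[OF 1(3)]] 1 by simp
  qed (rule dense)
  then obtain V where V: "bounded_clinear V" "\<And>a b. (a, b) \<in> G \<Longrightarrow> V a = b" by fastforce
  have VA: "V (amplify y \<zeta>) = \<Lambda> y" if "y \<in> A" for y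
  proof -
    have "(amplify y \<zeta> + 0, \<Lambda> y) \<in> G" by (rule GI[OF that]) (rule cinner.zero_left)
    from V(2)[OF this] show ?thesis by simp
  qed
  have V_amplify: "V (amplify y u) = op_apply (\<pi> y) (V u)" if y: "y \<in> A" for y u
  proof (rule continuous_eq_on_dense[where D = "fst ` G"])
    show "bounded_clinear (\<lambda>u. V (amplify y u))" "bounded_clinear (\<lambda>u. op_apply (\<pi> y) (V u))"
      by (rule bounded_clinear_compose[OF V(1) bounded_clinear_amplify]
          bounded_clinear_compose[OF bounded_clinear_op_apply V(1)])+
    fix u assume "u \<in> fst ` G"
    then obtain z \<eta> where u: "u = amplify z \<zeta> + \<eta>" "z \<in> A" "\<forall>z\<in>D. cinner \<eta> z = 0"
      unfolding G_def by auto
    have Vu: "V u = \<Lambda> z" unfolding u(1) using u by (intro V(2) GI) auto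
    have "(amplify (y * z) \<zeta> + amplify y \<eta>, \<Lambda> (y * z)) \<in> G"
    proof (rule GI)
      fix w assume "w \<in> D"
      then obtain x where x: "x \<in> A" "w = amplify x \<zeta>" by (auto simp: D_def)
      \<comment> \<open>\<open>D\<close> is invariant under \<open>adj y\<close>, so its orthogonal
        complement is invariant under \<open>y\<close> and the second summand is still sent to
        0.\<close>
      have "amplify (adj y * x) \<zeta> \<in> D" unfolding D_def by (intro imageI A y x)
      then show "cinner (amplify y \<eta>) w = 0" using u by (simp add: cinner_amplify x amplify_simps)
    qed (intro A y u)
    from V(2)[OF this] have "V (amplify y u) = \<Lambda> (y * z)"
      by (simp add: u(1) amplify_simps)
    then show "V (amplify y u) = op_apply (\<pi> y) (V u)"
      using y u(2) AB' by (simp add: Vu \<pi>_\<Lambda>)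
  qed (simp add: dense)
  have V_e: "op_apply e (V u) = V u" for u
  proof (rule continuous_eq_on_dense[where D = "fst ` G"])
    show "bounded_clinear (\<lambda>u. op_apply e (V u))"
      by (rule bounded_clinear_compose[OF bounded_clinear_op_apply V(1)])
    fix u assume "u \<in> fst ` G"
    then obtain z \<eta> where u: "u = amplify z \<zeta> + \<eta>" "z \<in> A" "\<forall>z\<in>D. cinner \<eta> z = 0"
      unfolding G_def by auto
    have "(u, \<Lambda> z) \<in> G" unfolding u(1) using u by (intro GI) auto
    then show "op_apply e (V u) = V u" using V(2)[of u "\<Lambda> z"] u(2) by (simp add: e_\<Lambda>_A)
  qed (simp_all add: dense V)
  obtain W where W: "bounded_clinear W" "\<And>u l. cinner (V u) l = cinner u (W l)"
    using adjoint_exists[OF V(1)] by blast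
  have W2: "cinner (W l) u = cinner l (V u)" for u l by (metis W(2) cinner_commute)
  have W_\<pi>: "W (op_apply (\<pi> y) l) = amplify y (W l)" if y: "y \<in> A" for y l
  proof (rule cinner_eqI)
    fix u
    have "cinner (W (op_apply (\<pi> y) l)) u = cinner l (op_apply (\<pi> (adj y)) (V u))"
      using y by (simp add: W2 cinner_adj adj_\<pi> AB')
    also have "\<dots> = cinner (amplify y (W l)) u"
      using y A by (simp add: V_amplify[symmetric] cinner_amplify W2)
    finally show "cinner (W (op_apply (\<pi> y) l)) u = cinner (amplify y (W l)) u" .
  qed
  have W_e: "W (op_apply e l) = W l" for l
    by (rule cinner_eqI) (simp add: W2 cinner_e V_e)
  have "intertwiner (\<lambda>l. ell2_nth (W l) k)" for k
    unfolding intertwiner_def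
    using bounded_clinear_compose[OF bounded_clinear_ell2_nth W(1)]
    by (simp add: W_\<pi> W_e amplify.rep_eq)
  then have "ell2_nth (W \<xi>) k = 0" for k by (rule zero)
  then have W0: "W \<xi> = 0" by (simp add: ell2_nth_inject[symmetric] zero_ell2.rep_eq fun_eq_iff)
  have "cinner \<xi> z = 0" if "z \<in> closure (\<Lambda> ` A)" for z
  proof (rule orthogonal_dense[OF _ that])
    fix z assume "z \<in> \<Lambda> ` A"
    then obtain y where y: "y \<in> A" "z = \<Lambda> y" by blast
    then show "cinner \<xi> z = 0" using W2[of \<xi> "amplify y \<zeta>"] by (simp add: W0 VA cinner.zero_left)
  qed
  from this[of \<xi>] have "cinner \<xi> \<xi> = 0" using e_mem(2)[of \<xi>] \<xi> by simp
  then show ?thesis by (simp add: cinner_eq_0_self)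
qed

text \<open>This is the commutation theorem for \<open>A\<close> on \<open>L\<^sup>2(A)\<close>: \<open>R\<close> is left multiplication by the vector
  \<open>R 1\<close> and \<open>T\<close> is right multiplication by \<open>T 1\<close>.\<close>

theorem commutation:
  assumes T: "T * e = T" "e * T = T" "\<And>y. y \<in> A \<Longrightarrow> T * \<pi> y = \<pi> y * T"
    and R: "R * e = R" "e * R = R" "\<And>y. y \<in> A \<Longrightarrow> R * \<rho> y = \<rho> y * R"
  shows "R * T = T * R"
proof -
  define t t' r where "t = op_apply T (\<Lambda> 1)" and "t' = op_apply (adj T) (\<Lambda> 1)" and "r = op_apply R (\<Lambda> 1)"
  have Te: "op_apply e (op_apply T \<xi>) = op_apply T \<xi>" "op_apply T (op_apply e \<xi>) = op_apply T \<xi>" for \<xi>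
    using T(1,2) by (metis op_simps(4))+
  have Re: "op_apply e (op_apply R \<xi>) = op_apply R \<xi>" "op_apply R (op_apply e \<xi>) = op_apply R \<xi>" for \<xi>
    using R(1,2) by (metis op_simps(4))+
  have "e * adj T = adj T" using arg_cong[OF T(1), of adj] by (simp add: e_projection)
  then have et': "op_apply e t' = t'" unfolding t'_def by (metis op_simps(4))
  have T': "adj T * \<pi> y = \<pi> y * adj T" if "y \<in> A" for y
    using arg_cong[OF T(3)[OF A(7)[OF that]], of adj] that A AB' by (simp add: adj_\<pi>)
  have T\<pi>: "op_apply T (op_apply (\<pi> y) \<xi>) = op_apply (\<pi> y) (op_apply T \<xi>)" if "y \<in> A" for y \<xi>
    using T(3)[OF that] by (metis op_simps(4))
  have T'\<pi>: "op_apply (adj T) (op_apply (\<pi> y) \<xi>) = op_apply (\<pi> y) (op_apply (adj T) \<xi>)" if "y \<in> A" for y \<xi>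
    using T'[OF that] by (metis op_simps(4))
  have R\<rho>: "op_apply R (op_apply (\<rho> y) \<xi>) = op_apply (\<rho> y) (op_apply R \<xi>)" if "y \<in> A" for y \<xi>
    using R(3)[OF that] by (metis op_simps(4))
  have T\<Lambda>: "op_apply T (\<Lambda> x) = op_apply (\<pi> x) t" if "x \<in> A" for x
    using T\<pi>[OF that, of "\<Lambda> 1"] that AB' A by (simp add: \<pi>_\<Lambda> t_def)
  have T'\<Lambda>: "op_apply (adj T) (\<Lambda> x) = op_apply (\<pi> x) t'" if "x \<in> A" for x
    using T'\<pi>[OF that, of "\<Lambda> 1"] that AB' A by (simp add: \<pi>_\<Lambda> t'_def)
  have R\<Lambda>: "op_apply R (\<Lambda> x) = op_apply (\<rho> x) r" if "x \<in> A" for x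
    using R\<rho>[OF that, of "\<Lambda> 1"] that AB' A by (simp add: \<rho>_\<Lambda> r_def)
  \<comment> \<open>Against \<open>\<Lambda> x\<close>, the vector
    \<open>t' - \<Lambda> (adj z)\<close> pairs as \<open>t - \<Lambda> z\<close> does against
    \<open>\<Lambda> (adj x)\<close>, which has the same norm as \<open>\<Lambda> x\<close>. So
    approximating \<open>T 1\<close> by elements of \<open>A\<close> approximates
    \<open>adj T\<close> at 1 by their adjoints.\<close>
  have close: "norm (t' - \<Lambda> (adj z)) \<le> norm (t - \<Lambda> z)" if z: "z \<in> A" for z
  proof -
    define u where "u = t' - \<Lambda> (adj z)"
    have bound: "cmod (cinner u (\<Lambda> x)) \<le> norm (\<Lambda> x) * norm (t - \<Lambda> z)" if x: "x \<in> A" for x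
    proof -
      have "cinner t' (\<Lambda> x) = cinner (\<Lambda> 1) (op_apply (\<pi> x) t)"
        using x by (simp add: t'_def cinner_adj2 T\<Lambda>)
      also have "\<dots> = cinner (\<Lambda> (adj x)) t"
        using x AB' A by (simp add: cinner_adj2[of "\<pi> x", symmetric] adj_\<pi> \<pi>_\<Lambda>)
      finally have "cinner t' (\<Lambda> x) = cinner (\<Lambda> (adj x)) t" .
      moreover have "cinner (\<Lambda> (adj z)) (\<Lambda> x) = cinner (\<Lambda> (adj x)) (\<Lambda> z)"
        using x z AB' A tr_comm[of "adj x" "adj z"] by (simp add: cinner_\<Lambda>)
      ultimately have "cinner u (\<Lambda> x) = cinner (\<Lambda> (adj x)) (t - \<Lambda> z)"
        by (simp add: u_def cinner.diff_left cinner.diff_right)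
      then show ?thesis
        using Cauchy_Schwarz[of "\<Lambda> (adj x)" "t - \<Lambda> z"] norm_\<Lambda>_adj[OF AB'[OF x]] by simp
    qed
    have "op_apply e u = u" using et' e_\<Lambda>_A[OF A(7)[OF z]] by (simp add: u_def op_diff)
    then have "u \<in> closure (\<Lambda> ` A)" using e_mem(2) by blast
    then obtain w where w: "\<And>k. w k \<in> \<Lambda> ` A" "w \<longlonglongrightarrow> u" by (auto simp: closure_sequential)
    have "cmod (cinner u u) \<le> norm u * norm (t - \<Lambda> z)"
    proof (rule LIMSEQ_le)
      show "(\<lambda>k. cmod (cinner u (w k))) \<longlonglongrightarrow> cmod (cinner u u)"
        by (intro tendsto_norm cinner.tendsto tendsto_const w)
      show "(\<lambda>k. norm (w k) * norm (t - \<Lambda> z)) \<longlonglongrightarrow> norm u * norm (t - \<Lambda> z)" by (intro tendsto_intros w)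
      have "cmod (cinner u (w k)) \<le> norm (w k) * norm (t - \<Lambda> z)" for k
        using w(1)[of k] bound by auto
      then show "\<exists>N. \<forall>k\<ge>N. cmod (cinner u (w k)) \<le> norm (w k) * norm (t - \<Lambda> z)" by blast
    qed
    then have "norm u * norm u \<le> norm u * norm (t - \<Lambda> z)"
      by (simp add: cinner_self power2_eq_square norm_mult)
    then show ?thesis unfolding u_def[symmetric] by (cases "u = 0") (simp_all add: mult_le_cancel_left)
  qed
  \<comment> \<open>The commutation relation in matrix coefficients when \<open>T\<close> is
    replaced by right multiplication by \<open>z\<close>; the general case is the limit as
    \<open>\<Lambda> z\<close> tends to \<open>t\<close>.\<close>
  have key: "cinner (op_apply (\<pi> x) (\<Lambda> z)) (op_apply (adj R) (\<Lambda> y)) = cinner (op_apply (\<rho> x) r) (op_apply (\<pi> y) (\<Lambda> (adj z)))"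
    if xyz: "x \<in> A" "y \<in> A" "z \<in> A" for x y z
  proof -
    have \<rho>1: "op_apply (\<rho> y) (\<Lambda> 1) = \<Lambda> y" if "y \<in> A" for y using that AB' A by (simp add: \<rho>_\<Lambda>)
    have "cinner (op_apply (\<pi> x) (\<Lambda> z)) (op_apply (adj R) (\<Lambda> y)) = cinner (op_apply (\<rho> (x * z)) r) (\<Lambda> y)"
      using xyz AB' A R\<Lambda>[of "x * z"] by (simp add: \<pi>_\<Lambda> cinner_adj[symmetric])
    also have "\<dots> = cinner r (\<Lambda> (y * (adj z * adj x)))"
      using xyz AB' A B by (simp add: cinner_adj adj_\<rho> \<rho>_\<Lambda>)
    also have "\<dots> = cinner (op_apply (\<rho> x) r) (op_apply (\<pi> y) (\<Lambda> (adj z)))"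
      using xyz AB' A B by (simp add: cinner_adj adj_\<rho> \<rho>_\<Lambda> \<pi>_\<Lambda> mult.assoc)
    finally show ?thesis .
  qed
  have main: "cinner (op_apply (R * T) (\<Lambda> x)) (\<Lambda> y) = cinner (op_apply (T * R) (\<Lambda> x)) (\<Lambda> y)"
    if xy: "x \<in> A" "y \<in> A" for x y
  proof -
    have "t \<in> closure (\<Lambda> ` A)" using e_mem(2)[of t] Te by (simp add: t_def)
    then obtain w where w: "\<And>k. w k \<in> \<Lambda> ` A" "w \<longlonglongrightarrow> t" by (auto simp: closure_sequential)
    have "\<exists>z. z \<in> A \<and> w k = \<Lambda> z" for k using w(1)[of k] by blast
    then obtain z where z: "\<And>k. z k \<in> A" "\<And>k. w k = \<Lambda> (z k)" by metis
    have zt: "(\<lambda>k. \<Lambda> (z k)) \<longlonglongrightarrow> t" 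
    proof -
      have "w = (\<lambda>k. \<Lambda> (z k))" by (rule ext) (rule z(2))
      with w(2) show ?thesis by simp
    qed
    have "(\<lambda>k. norm (\<Lambda> (adj (z k)) - t')) \<longlonglongrightarrow> 0"
    proof (rule tendsto_sandwich[OF _ _ tendsto_const])
      show "(\<lambda>k. norm (t - \<Lambda> (z k))) \<longlonglongrightarrow> 0"
        using tendsto_norm[OF tendsto_diff[OF tendsto_const zt], of t] by simp
    qed (use close[OF z(1)] in \<open>simp_all add: norm_minus_commute[of _ t']\<close>)
    then have zt': "(\<lambda>k. \<Lambda> (adj (z k))) \<longlonglongrightarrow> t'"
      by (simp only: tendsto_norm_zero_iff LIM_zero_iff)
    have "(\<lambda>k. cinner (op_apply (\<pi> x) (\<Lambda> (z k))) (op_apply (adj R) (\<Lambda> y)))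
        \<longlonglongrightarrow> cinner (op_apply (\<pi> x) t) (op_apply (adj R) (\<Lambda> y))"
      by (intro cinner.tendsto op_tendsto zt tendsto_const)
    moreover have "(\<lambda>k. cinner (op_apply (\<rho> x) r) (op_apply (\<pi> y) (\<Lambda> (adj (z k)))))
        \<longlonglongrightarrow> cinner (op_apply (\<rho> x) r) (op_apply (\<pi> y) t')"
      by (intro cinner.tendsto op_tendsto zt' tendsto_const)
    ultimately have "cinner (op_apply (\<pi> x) t) (op_apply (adj R) (\<Lambda> y)) = cinner (op_apply (\<rho> x) r) (op_apply (\<pi> y) t')"
      unfolding key[OF xy z(1)] by (rule LIMSEQ_unique)
    moreover have "cinner (op_apply (R * T) (\<Lambda> x)) (\<Lambda> y) = cinner (op_apply (\<pi> x) t) (op_apply (adj R) (\<Lambda> y))"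
      using xy by (simp add: T\<Lambda> cinner_adj[of R])
    moreover have "cinner (op_apply (T * R) (\<Lambda> x)) (\<Lambda> y) = cinner (op_apply (\<rho> x) r) (op_apply (\<pi> y) t')"
      using xy by (simp add: R\<Lambda> cinner_adj[of T] T'\<Lambda>)
    ultimately show ?thesis by simp
  qed
  show ?thesis
  proof (rule op_eq_on_\<Lambda>)
    fix x assume x: "x \<in> B"
    \<comment> \<open>Both products absorb \<open>e\<close> on either side, so coefficients between
      elements of \<open>A\<close> decide.\<close>
    have x': "op_apply (R * T) (\<Lambda> x) = op_apply (R * T) (\<Lambda> (E x))" "op_apply (T * R) (\<Lambda> x) = op_apply (T * R) (\<Lambda> (E x))"
      using x Te(2)[of "\<Lambda> x"] Re(2)[of "\<Lambda> x"] by (simp_all add: e_\<Lambda>)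
    define v where "v = op_apply (R * T) (\<Lambda> x) - op_apply (T * R) (\<Lambda> x)"
    have ev: "op_apply e v = v" by (simp add: v_def op_diff Te Re)
    have "cinner v z = 0" for z
    proof (rule orthogonal_dense[where D = "\<Lambda> ` B"])
      fix z assume "z \<in> \<Lambda> ` B"
      then obtain y where y: "y \<in> B" "z = \<Lambda> y" by blast
      have "cinner v z = cinner v (\<Lambda> (E y))" using cinner_e[of v z] y by (simp add: ev e_\<Lambda>)
      also have "\<dots> = 0" unfolding v_def x' cinner.diff_left using main[of "E x" "E y"] x y by (simp add: E_in)
      finally show "cinner v z = 0" .
    qed (simp add: \<Lambda>_dense)
    then have "v = 0" using cinner_eq_0_self by blast
    then show "op_apply (R * T) (\<Lambda> x) = op_apply (T * R) (\<Lambda> x)" by (simp add: v_def)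
  qed
qed

end

section \<open>Transport of operators from L2(A) to H\<close>

context gns_inclusion
begin

lemma intertwiner_commutant:
  assumes z: "z \<in> commutant A" and W: "intertwiner W"
  shows "intertwiner (\<lambda>x. op_apply z (W x))"
proof -
  have "op_apply z (op_apply y x) = op_apply y (op_apply z x)" if "y \<in> A" for x y
    using commutantD[OF z that] by (metis op_simps(4))
  then show ?thesis unfolding intertwiner_def
    using bounded_clinear_compose[OF bounded_clinear_op_apply intertwinerD(1)[OF W]] intertwinerD(2,3)[OF W]
    by simp
qed

text \<open>The vectors \<open>W\<^sub>1 \<xi>\<^sub>1 + \<dots> + W\<^sub>m \<xi>\<^sub>m\<close> with intertwiners \<open>W\<^sub>i\<close> are represented by lists of pairs
  \<open>(W\<^sub>i, \<xi>\<^sub>i)\<close>; the operator \<open>D\<close> is applied to each \<open>\<xi>\<^sub>i\<close>.\<close>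

definition lin_comb :: "'k bop \<Rightarrow> (('k \<Rightarrow> 'h) \<times> 'k) list \<Rightarrow> 'h" where
  "lin_comb D ps = sum_list (map (\<lambda>(W, \<xi>). W (op_apply D \<xi>)) ps)"

text \<open>Says that \<open>D\<close> commutes with \<open>W'\<^sup>* W\<close> for all
  intertwiners, phrased by inner products so that no adjoint of a map between two spaces has to be
  named.\<close>

definition moves :: "'k bop \<Rightarrow> bool" where
  "moves D \<longleftrightarrow> (\<forall>W W' \<xi> \<eta>. intertwiner W \<longrightarrow> intertwiner W' \<longrightarrow>
     cinner (W (op_apply D \<xi>)) (W' \<eta>) = cinner (W \<xi>) (W' (op_apply (adj D) \<eta>)))"

lemma lin_comb_simps [simp]:
  "lin_comb D [] = 0" "lin_comb D ((W, \<xi>) # ps) = W (op_apply D \<xi>) + lin_comb D ps"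
  "lin_comb D (ps @ qs) = lin_comb D ps + lin_comb D qs"
  by (simp_all add: lin_comb_def)

lemma movesD:
  "moves D \<Longrightarrow> intertwiner W \<Longrightarrow> intertwiner W' \<Longrightarrow>
     cinner (W (op_apply D \<xi>)) (W' \<eta>) = cinner (W \<xi>) (W' (op_apply (adj D) \<eta>))"
  by (simp add: moves_def)

lemma moves_one: "moves 1"
  by (simp add: moves_def)

lemma moves_mult: "moves D \<Longrightarrow> moves D' \<Longrightarrow> moves (D * D')"
  by (simp add: moves_def)

lemma moves_adj: "moves D \<Longrightarrow> moves (adj D)"
  unfolding moves_def adj_simps(1) by (metis cinner_commute)

text \<open>\<open>lin_comb D ps\<close> is not yet known to depend only on the vector
  \<open>lin_comb 1 ps\<close>. This identity nevertheless lets \<open>D\<close> behave as an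
  operator with adjoint \<open>adj D\<close> inside inner products.\<close>

lemma cinner_lin_comb:
  assumes D: "moves D" and ps: "\<And>p. p \<in> set ps \<Longrightarrow> intertwiner (fst p)" and qs: "\<And>p. p \<in> set qs \<Longrightarrow> intertwiner (fst p)"
  shows "cinner (lin_comb F ps) (lin_comb D qs) = cinner (lin_comb (adj D * F) ps) (lin_comb 1 qs)"
  using ps
proof (induction ps)
  case Nil
  show ?case by (simp add: cinner.zero_left)
next
  case (Cons p ps)
  obtain W \<xi> where p: "p = (W, \<xi>)" by fastforce
  have W: "intertwiner W" using Cons.prems[of p] by (simp add: p)
  have "cinner (W (op_apply F \<xi>)) (lin_comb D qs) = cinner (W (op_apply (adj D * F) \<xi>)) (lin_comb 1 qs)"
    using qs
  proof (induction qs)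
    case Nil
    show ?case by (simp add: cinner.zero_right)
  next
    case (Cons q qs)
    obtain W' \<eta> where q: "q = (W', \<eta>)" by fastforce
    have W': "intertwiner W'" using Cons.prems[of q] by (simp add: q)
    show ?case using movesD[OF moves_adj[OF D] W W', of "op_apply F \<xi>" \<eta>] Cons
      by (simp add: q cinner_add_right)
  qed
  then show ?case using Cons by (simp add: p cinner_add_left)
qed

text \<open>\<open>T = W'\<^sup>* W\<close> acts on L2(A) and commutes with left multiplication by
  \<open>A\<close>, while \<open>R\<close> commutes with right multiplication;
  \<open>commutation\<close> applies.\<close>

lemma intertwiner_moves:
  assumes R: "R * e = R" "e * R = R" "\<And>y. y \<in> A \<Longrightarrow> R * \<rho> y = \<rho> y * R"
  shows "moves R"
  unfolding moves_def
proof (intro allI impI)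
  fix W W' \<xi> \<eta> assume W: "intertwiner W" and W': "intertwiner W'"
  obtain V where V: "bounded_clinear V" "\<And>x y. cinner (W' x) y = cinner x (V y)"
    using adjoint_exists[OF intertwinerD(1)[OF W']] by blast
  have V2: "cinner (V y) x = cinner y (W' x)" for x y by (metis V(2) cinner_commute)
  define T where "T = Bop (\<lambda>x. V (W x))"
  have T: "op_apply T x = V (W x)" for x
    unfolding T_def by (simp add: op_apply_Bop[OF bounded_clinear_compose[OF V(1) intertwinerD(1)[OF W]]])
  have "R * T = T * R"
  proof (rule commutation[OF _ _ _ R])
    show "T * e = T" by (rule op_eqI) (simp add: T intertwinerD(3)[OF W])
    show "e * T = T"
      by (rule op_eqI, rule cinner_eqI) (simp add: T cinner_e V2 intertwinerD(3)[OF W'])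
    fix y assume y: "y \<in> A"
    have "cinner (V (op_apply y (W x))) z = cinner (op_apply (\<pi> y) (V (W x))) z" for x z
      using y A AB' intertwinerD(2)[OF W', of "adj y" z]
      by (simp add: V2 cinner_adj[of y] cinner_adj[of "\<pi> y"] adj_\<pi>)
    then show "T * \<pi> y = \<pi> y * T"
      by - (rule op_eqI, rule cinner_eqI, simp add: T intertwinerD(2)[OF W y])
  qed
  then have RT: "op_apply R (op_apply T \<xi>) = op_apply T (op_apply R \<xi>)" by (metis op_simps(4))
  have "cinner (W (op_apply R \<xi>)) (W' \<eta>) = cinner (op_apply T (op_apply R \<xi>)) \<eta>" by (simp add: T V2)
  also have "\<dots> = cinner (W \<xi>) (W' (op_apply (adj R) \<eta>))" by (simp add: RT[symmetric] cinner_adj[of R]) (simp add: T V2)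
  finally show "cinner (W (op_apply R \<xi>)) (W' \<eta>) = cinner (W \<xi>) (W' (op_apply (adj R) \<eta>))" .
qed

text \<open>The argument of \<open>\<Lambda>_mult_bounded\<close> again, with
  \<open>a = adj R * R\<close> and the norms of \<open>lin_comb (a ^ m) ps\<close>. The bound makes
  \<open>W \<xi> \<mapsto> W (R \<xi>)\<close> both well defined and bounded.\<close>

lemma lin_comb_bound:
  assumes R: "moves R" and r: "0 \<le> r" "\<And>\<xi>. norm (op_apply (adj R * R) \<xi>) \<le> r * norm \<xi>"
    and ps: "\<And>p. p \<in> set ps \<Longrightarrow> intertwiner (fst p)"
  shows "norm (lin_comb R ps) \<le> sqrt r * norm (lin_comb 1 ps)"
proof -
  define a where "a = adj R * R"
  have a: "adj a = a" "moves a" unfolding a_def by (simp, intro moves_mult moves_adj R)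
  have am: "adj (a ^ m) = a ^ m" "moves (a ^ m)" for m
  proof -
    show "adj (a ^ m) = a ^ m" by (induction m) (simp_all add: a(1) power_commutes)
    show "moves (a ^ m)" by (induction m) (simp_all add: moves_one moves_mult a(2))
  qed
  have pw: "norm (op_apply (a ^ m) \<xi>) \<le> r ^ m * norm \<xi>" for m \<xi>
  proof (induction m)
    case (Suc m)
    have "norm (op_apply (a ^ Suc m) \<xi>) \<le> r * norm (op_apply (a ^ m) \<xi>)"
      using r(2)[of "op_apply (a ^ m) \<xi>"] by (simp add: a_def)
    also have "\<dots> \<le> r * (r ^ m * norm \<xi>)" by (intro mult_left_mono Suc.IH r(1))
    finally show ?case by (simp add: mult.assoc)
  qed simp
  \<comment> \<open>\<open>K\<close> may depend on the list: the iteration uses only the rate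
    \<open>r ^ m\<close>, so the bounds of the individual intertwiners need not be uniform.\<close>
  have "\<exists>K. \<forall>m. norm (lin_comb (a ^ m) ps) \<le> K * r ^ m" using ps
  proof (induction ps)
    case Nil
    show ?case by (intro exI[of _ 0]) simp
  next
    case (Cons p ps)
    obtain W \<xi> where p: "p = (W, \<xi>)" by fastforce
    have "intertwiner W" using Cons.prems[of p] by (simp add: p)
    then obtain C where C: "C \<ge> 0" "\<And>x. norm (W x) \<le> C * norm x"
      using bounded_clinearD(7) intertwinerD(1) by blast
    obtain K where K: "\<And>m. norm (lin_comb (a ^ m) ps) \<le> K * r ^ m"
      using Cons.IH[OF Cons.prems] by auto
    have "norm (lin_comb (a ^ m) (p # ps)) \<le> (C * norm \<xi> + K) * r ^ m" for m
    proof -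
      have "norm (W (op_apply (a ^ m) \<xi>)) \<le> C * (r ^ m * norm \<xi>)"
        by (intro order_trans[OF C(2)] mult_left_mono pw C(1))
      then have "norm (W (op_apply (a ^ m) \<xi>) + lin_comb (a ^ m) ps) \<le> C * (r ^ m * norm \<xi>) + K * r ^ m"
        by (intro norm_triangle_le add_mono K)
      then show ?thesis by (simp add: p algebra_simps)
    qed
    then show ?case by blast
  qed
  then obtain K where K: "\<And>m. norm (lin_comb (a ^ m) ps) \<le> K * r ^ m" by blast
  define u where "u m = norm (lin_comb (a ^ m) ps)" for m
  have "u 1 \<le> r * u 0"
  proof (rule power_iteration_bound)
    show "0 \<le> u m" for m by (simp add: u_def)
    have "complex_of_real ((u m)\<^sup>2) = cinner (lin_comb (a ^ (2 * m)) ps) (lin_comb 1 ps)" for m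
    proof -
      have "cinner (lin_comb (a ^ m) ps) (lin_comb (a ^ m) ps) = cinner (lin_comb (adj (a ^ m) * a ^ m) ps) (lin_comb 1 ps)"
        by (rule cinner_lin_comb[OF am(2) ps ps])
      then show ?thesis unfolding u_def cinner_self am(1) power_add[symmetric] mult_2 .
    qed
    then have "(u m)\<^sup>2 = cmod (cinner (lin_comb (a ^ (2 * m)) ps) (lin_comb 1 ps))" for m
      by (metis norm_of_real abs_of_nonneg zero_le_power2)
    then show "(u m)\<^sup>2 \<le> u (2 * m) * u 0" for m by (simp add: u_def Cauchy_Schwarz)
    show "u m \<le> K * r ^ m" for m unfolding u_def by (rule K)
  qed (rule r)
  have "complex_of_real ((norm (lin_comb R ps))\<^sup>2) = cinner (lin_comb a ps) (lin_comb 1 ps)"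
    unfolding cinner_self[symmetric] a_def by (rule cinner_lin_comb[OF R ps ps])
  then have "(norm (lin_comb R ps))\<^sup>2 = cmod (cinner (lin_comb a ps) (lin_comb 1 ps))"
    by (metis norm_of_real abs_of_nonneg zero_le_power2)
  also have "\<dots> \<le> u 1 * u 0" by (simp add: u_def Cauchy_Schwarz)
  also have "\<dots> \<le> r * u 0 * u 0" by (intro mult_right_mono \<open>u 1 \<le> r * u 0\<close>) (simp add: u_def)
  also have "\<dots> = (sqrt r * norm (lin_comb 1 ps))\<^sup>2" using r by (simp add: u_def power2_eq_square)
  finally show ?thesis by (rule power2_le_imp_le) (use r in simp)
qed

text \<open>The closed span is invariant under the commutant of \<open>A\<close>, so its projection
  \<open>q\<close> lies in \<open>A\<close>. As \<open>1 - q\<close> kills every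
  \<open>W (\<Lambda> 1)\<close>, all intertwiners vanish on \<open>\<Lambda> (1 - q)\<close>, and
  separation gives \<open>q = 1\<close>.\<close>

lemma lin_comb_dense:
  "closure (lin_comb 1 ` {ps. \<forall>p\<in>set ps. intertwiner (fst p)}) = UNIV"
proof -
  define D where "D = lin_comb 1 ` {ps. \<forall>p\<in>set ps. intertwiner (fst p)}"
  have DI: "lin_comb 1 ps \<in> D" if "\<And>p. p \<in> set ps \<Longrightarrow> intertwiner (fst p)" for ps
    unfolding D_def using that by (intro imageI) simp
  \<comment> \<open>An additive map \<open>h\<close> preserves \<open>D\<close> once
    \<open>g\<close> rewrites each \<open>h (W \<xi>)\<close> as a single intertwiner applied to a
    vector, changing either the intertwiner or the vector.\<close>
  have mapD: "h (lin_comb 1 ps) \<in> D"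
    if ps: "\<And>p. p \<in> set ps \<Longrightarrow> intertwiner (fst p)"
      and h: "h 0 = 0" "\<And>x y. h (x + y) = h x + h y"
      and g: "\<And>W \<xi>. intertwiner W \<Longrightarrow> intertwiner (fst (g W \<xi>)) \<and> h (W \<xi>) = fst (g W \<xi>) (snd (g W \<xi>))"
    for h g ps
  proof -
    have "h (lin_comb 1 ps) = lin_comb 1 (map (\<lambda>(W, \<xi>). g W \<xi>) ps) \<and>
        (\<forall>p\<in>set (map (\<lambda>(W, \<xi>). g W \<xi>) ps). intertwiner (fst p))"
      using ps
    proof (induction ps)
      case Nil
      show ?case by (simp add: h)
    next
      case (Cons p ps)
      obtain W \<xi> where p: "p = (W, \<xi>)" by fastforce
      have W: "intertwiner W" using Cons.prems[of p] by (simp add: p)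
      obtain W' \<xi>' where q: "g W \<xi> = (W', \<xi>')" by fastforce
      show ?case using Cons g[OF W, of \<xi>] by (simp add: p q h)
    qed
    then have eq: "h (lin_comb 1 ps) = lin_comb 1 (map (\<lambda>(W, \<xi>). g W \<xi>) ps)"
      and int: "\<forall>p\<in>set (map (\<lambda>(W, \<xi>). g W \<xi>) ps). intertwiner (fst p)" by (rule conjunct1, rule conjunct2)
    show ?thesis unfolding eq by (rule DI) (rule bspec[OF int])
  qed
  have "csubspace D"
  proof (rule csubspaceI)
    show "0 \<in> D" using DI[of "[]"] by simp
    fix x assume "x \<in> D"
    then obtain ps where ps: "x = lin_comb 1 ps" "\<And>p. p \<in> set ps \<Longrightarrow> intertwiner (fst p)"
      unfolding D_def by blast
    show "c *\<^sub>C x \<in> D" for c unfolding ps(1)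
      by (rule mapD[where g = "\<lambda>W \<xi>. (W, c *\<^sub>C \<xi>)", OF ps(2)])
        (simp_all add: scaleC_zero_right scaleC_add_right bounded_clinearD(3)[OF intertwinerD(1)])
    fix y assume "y \<in> D"
    then obtain qs where qs: "y = lin_comb 1 qs" "\<And>p. p \<in> set qs \<Longrightarrow> intertwiner (fst p)"
      unfolding D_def by blast
    show "x + y \<in> D" using DI[of "ps @ qs"] ps qs by auto
  qed
  note S = csubspace_closure[OF this] closed_closure[of D]
  define q where "q = proj_onto (closure D)"
  have invA: "op_apply z \<xi> \<in> D" if z: "z \<in> A" and \<xi>: "\<xi> \<in> D" for z \<xi>
  proof -
    obtain ps where ps: "\<xi> = lin_comb 1 ps" "\<And>p. p \<in> set ps \<Longrightarrow> intertwiner (fst p)"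
      using \<xi> unfolding D_def by blast
    show ?thesis unfolding ps(1)
      by (rule mapD[where g = "\<lambda>W \<xi>. (W, op_apply (\<pi> z) \<xi>)", OF ps(2)])
        (simp_all add: op_zero op_add intertwinerD(2)[OF _ z])
  qed
  have invA': "op_apply z \<xi> \<in> D" if z: "z \<in> commutant A" and \<xi>: "\<xi> \<in> D" for z \<xi>
  proof -
    obtain ps where ps: "\<xi> = lin_comb 1 ps" "\<And>p. p \<in> set ps \<Longrightarrow> intertwiner (fst p)"
      using \<xi> unfolding D_def by blast
    show ?thesis unfolding ps(1)
      by (intro mapD[where g = "\<lambda>W \<xi>. (\<lambda>x. op_apply z (W x), \<xi>)", OF ps(2)])
        (simp_all add: op_zero op_add intertwiner_commutant[OF z])
  qed
  have comm: "z * q = q * z" if "\<And>\<xi>. \<xi> \<in> D \<Longrightarrow> op_apply z \<xi> \<in> D" "\<And>\<xi>. \<xi> \<in> D \<Longrightarrow> op_apply (adj z) \<xi> \<in> D" for z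
    unfolding q_def
    by (rule projection_commutes[OF S]; erule op_closure_invariant[rotated])
      (use that closure_subset in blast)+
  have adjA: "adj ` A \<subseteq> A" by (rule image_subsetI) (rule A(7))
  have "q \<in> commutant (commutant A)"
  proof (rule commutantI)
    fix z assume z: "z \<in> commutant A"
    show "q * z = z * q"
      by (rule comm[symmetric]) (rule invA'[OF z] invA'[OF commutant_adj[OF adjA z]], assumption)+
  qed
  then have q1: "1 - q \<in> A" using von_neumann_algebraD(8)[OF vnaA] A(1,4) by simp
  have "\<Lambda> (1 - q) = 0"
  proof (rule intertwiners_separate[OF e_\<Lambda>_A[OF q1]])
    fix W assume W: "intertwiner W"
    have "W (\<Lambda> 1) \<in> D" using DI[of "[(W, \<Lambda> 1)]"] W by simp
    then have "op_apply q (W (\<Lambda> 1)) = W (\<Lambda> 1)"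
      unfolding q_def using proj_onto_mem(2)[OF S] closure_subset by blast
    moreover have "W (\<Lambda> (1 - q)) = op_apply (1 - q) (W (\<Lambda> 1))"
      using intertwinerD(2)[OF W q1, of "\<Lambda> 1"] AB'[OF q1] B(1) by (simp add: \<pi>_\<Lambda>)
    ultimately show "W (\<Lambda> (1 - q)) = 0" by simp
  qed
  then have "q = 1" using \<Lambda>_eq_0[OF AB'[OF q1]] by simp
  then have "\<xi> \<in> closure D" for \<xi> using proj_onto_mem(1)[OF S, of \<xi>] by (simp add: q_def)
  then show ?thesis unfolding D_def by blast
qed

text \<open>Since \<open>R\<close> commutes with all \<open>W'\<^sup>* W\<close>, the assignment \<open>W \<xi> \<mapsto> W (R \<xi>)\<close> extends to a bounded operator
  on \<open>H\<close>; it commutes with \<open>A'\<close>, hence lies in \<open>A\<close>.\<close>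

theorem corner_in_A:
  assumes R: "R * e = R" "e * R = R" "\<And>y. y \<in> A \<Longrightarrow> R * \<rho> y = \<rho> y * R"
  shows "\<exists>a\<in>A. R = \<pi> a * e"
proof -
  have m: "moves R" by (rule intertwiner_moves[OF R(1,2)]) (rule R(3))
  define L where "L = {ps :: (('k \<Rightarrow> 'h) \<times> 'k) list. \<forall>p\<in>set ps. intertwiner (fst p)}"
  define G where "G = (\<lambda>ps. (lin_comb 1 ps, lin_comb R ps)) ` L"
  obtain r where r: "r \<ge> 0" "\<And>\<xi>. norm (op_apply (adj R * R) \<xi>) \<le> r * norm \<xi>"
    using op_norm_bound[of "adj R * R"] by blast
  have "\<exists>T. bounded_clinear T \<and> (\<forall>(a, b)\<in>G. T a = b)"
  proof (rule bounded_clinear_extension)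
    fix a b a' b' assume "(a, b) \<in> G" "(a', b') \<in> G"
    then obtain ps qs where p: "ps \<in> L" "a = lin_comb 1 ps" "b = lin_comb R ps"
      and q: "qs \<in> L" "a' = lin_comb 1 qs" "b' = lin_comb R qs" unfolding G_def by blast
    have "ps @ qs \<in> L" using p(1) q(1) by (auto simp: L_def)
    then have "(lin_comb 1 (ps @ qs), lin_comb R (ps @ qs)) \<in> G" unfolding G_def by (rule imageI)
    then show "(a + a', b + b') \<in> G" by (simp add: p q)
  next
    fix c a b assume "(a, b) \<in> G"
    then obtain ps where p: "ps \<in> L" "a = lin_comb 1 ps" "b = lin_comb R ps" unfolding G_def by blast
    define qs where "qs = map (\<lambda>(W, \<xi>). (W, c *\<^sub>C \<xi>)) ps"
    have lc: "lin_comb D (map (\<lambda>(W, \<xi>). (W, c *\<^sub>C \<xi>)) ps) = c *\<^sub>C lin_comb D ps" if "ps \<in> L" for D ps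
      using that
    proof (induction ps)
      case Nil
      show ?case by (simp add: scaleC_zero_right)
    next
      case (Cons p ps)
      obtain W \<xi> where p: "p = (W, \<xi>)" by fastforce
      have "intertwiner W" "ps \<in> L" using Cons.prems by (auto simp: p L_def)
      then show ?case using Cons.IH
        by (simp add: p op_scaleC scaleC_add_right bounded_clinearD(3)[OF intertwinerD(1)])
    qed
    have "qs \<in> L" using p(1) by (auto simp: L_def qs_def)
    then have "(lin_comb 1 qs, lin_comb R qs) \<in> G" unfolding G_def by (rule imageI)
    then show "(c *\<^sub>C a, c *\<^sub>C b) \<in> G" by (simp add: p qs_def lc)
  next
    fix a b assume "(a, b) \<in> G"
    then obtain ps where p: "ps \<in> L" "a = lin_comb 1 ps" "b = lin_comb R ps" unfolding G_def by blast
    have "intertwiner (fst q)" if "q \<in> set ps" for q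
      using p(1) that unfolding L_def by blast
    then show "norm b \<le> sqrt r * norm a"
      unfolding p(2,3) by (rule lin_comb_bound[OF m r])
  next
    have "fst ` G = lin_comb 1 ` L" by (force simp: G_def)
    then show "closure (fst ` G) = UNIV" using lin_comb_dense by (simp add: L_def)
  qed
  then obtain T where T: "bounded_clinear T" "\<And>a b. (a, b) \<in> G \<Longrightarrow> T a = b" by fastforce
  define X where "X = Bop T"
  have X: "op_apply X (lin_comb 1 ps) = lin_comb R ps" if "ps \<in> L" for ps
    unfolding X_def op_apply_Bop[OF T(1)] using that by (intro T(2)) (simp add: G_def)
  have XW: "op_apply X (W \<xi>) = W (op_apply R \<xi>)" if "intertwiner W" for W \<xi>
    using X[of "[(W, \<xi>)]"] that by (simp add: L_def)
  have "X \<in> commutant (commutant A)"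
  proof (rule commutantI)
    fix z assume z: "z \<in> commutant A"
    note int = intertwiner_commutant[OF z]
    have "op_apply (X * z) (lin_comb 1 ps) = op_apply (z * X) (lin_comb 1 ps)" if "ps \<in> L" for ps
      using that
    proof (induction ps)
      case Nil
      show ?case by (simp add: op_zero)
    next
      case (Cons p ps)
      obtain W \<xi> where p: "p = (W, \<xi>)" by fastforce
      have W: "intertwiner W" "ps \<in> L" using Cons.prems by (auto simp: p L_def)
      show ?case using Cons.IH[OF W(2)] XW[OF W(1), of \<xi>] XW[OF int[OF W(1)], of \<xi>]
        by (simp add: p op_add)
    qed
    then have *: "op_apply (X * z) \<eta> = op_apply (z * X) \<eta>" if "\<eta> \<in> lin_comb 1 ` L" for \<eta>
      using that by blast
    have "\<eta> \<in> closure (lin_comb 1 ` L)" for \<eta> by (simp add: L_def lin_comb_dense)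
    then show "X * z = z * X"
      by (intro op_eqI continuous_eq_on_dense[OF bounded_clinear_op_apply bounded_clinear_op_apply *])
  qed
  then have XA: "X \<in> A" using von_neumann_algebraD(8)[OF vnaA] by simp
  have "R = \<pi> X * e"
  proof (rule op_eqI)
    fix \<xi>
    \<comment> \<open>Every intertwiner \<open>W\<close> sends both vectors to \<open>X\<close>
      applied to \<open>W \<xi>\<close>; their difference is fixed by \<open>e\<close>, so
      separation makes it vanish.\<close>
    define v where "v = op_apply (\<pi> X * e) \<xi> - op_apply R \<xi>"
    have "op_apply e (op_apply R \<xi>) = op_apply R \<xi>" using R(2) by (metis op_simps(4))
    moreover have "op_apply e (op_apply (\<pi> X * e) \<xi>) = op_apply (\<pi> X * e) \<xi>"
      using e_\<pi>[OF XA] e_projection(2) by (metis mult.assoc op_simps(4))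
    ultimately have "op_apply e v = v" by (simp add: v_def op_diff)
    moreover have "W v = 0" if W: "intertwiner W" for W
      unfolding v_def bounded_clinearD(5)[OF intertwinerD(1)[OF W]]
      by (simp add: intertwinerD(2,3)[OF W] XA XW[OF W, symmetric])
    ultimately have "v = 0" by (rule intertwiners_separate)
    then show "op_apply R \<xi> = op_apply (\<pi> X * e) \<xi>" by (simp add: v_def)
  qed
  then show ?thesis using XA by blast
qed

text \<open>\<open>e * T * e\<close> lives on L2(A) and commutes with right multiplication by
  \<open>A\<close>, so \<open>corner_in_A\<close> applies; uniqueness is
  \<open>\<pi>_e_inj\<close>.\<close>

corollary M1_corner: "T \<in> M1 \<Longrightarrow> \<exists>!a. a \<in> A \<and> e * T * e = \<pi> a * e"
proof -
  assume T: "T \<in> M1"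
  have "\<exists>a\<in>A. e * T * e = \<pi> a * e"
  proof (rule corner_in_A)
    show "e * T * e * e = e * T * e" "e * (e * T * e) = e * T * e"
      by (simp_all add: mult.assoc e_projection) (simp add: mult.assoc[symmetric] e_projection)
    show "e * T * e * \<rho> y = \<rho> y * (e * T * e)" if "y \<in> A" for y
      using T that by (intro M1_\<rho> M1 e_in_M1)
  qed
  moreover have "a = b" if "a \<in> A" "b \<in> A" "\<pi> a * e = \<pi> b * e" for a b
    using \<pi>_e_inj[OF A(4)[OF that(1,2)]] that AB' by (simp add: \<pi>_diff left_diff_distrib)
  ultimately show ?thesis by metis
qed

end

section \<open>The isomorphism\<close>

text \<open>An operator \<open>T\<close> in \<open>\<langle>B, e\<rangle>\<close> and an operator \<open>X\<close> in \<open>P\<close> are matched when they have the same matrix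
  over \<open>A\<close> with respect to the basis. This relation is compatible with all operations, and
  the two resolutions of the identity make it functional in both directions.\<close>

locale jones_pair = gns_inclusion B tr \<Lambda> A E
  for B :: "'h::complex_hilbert_space bop set" and tr and \<Lambda> :: "'h bop \<Rightarrow> 'k::complex_hilbert_space"
    and A E +
  fixes I :: "'i set" and l :: "'i \<Rightarrow> 'h bop" and f :: "'h bop" and P :: "'h bop set"
  assumes l: "i \<in> I \<Longrightarrow> l i \<in> B"
    and resolution_e: "(\<Sum>i\<in>I. \<pi> (adj (l i)) * e * \<pi> (l i)) = 1"
    and resolution_f: "(\<Sum>i\<in>I. adj (l i) * f * l i) = 1"
    and vnaP: "von_neumann_algebra P" and BP: "B \<subseteq> P" and fP: "f \<in> P"
    and f_proj: "adj f = f" "f * f = f"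
    and f_E: "x \<in> B \<Longrightarrow> f * x * f = E x * f"
    and f_inj: "a \<in> A \<Longrightarrow> a * f = 0 \<Longrightarrow> a = 0"
    and P_expand: "x \<in> P \<Longrightarrow> \<exists>u v. (\<forall>i\<in>I. u i \<in> B \<and> v i \<in> B) \<and> x = (\<Sum>i\<in>I. u i * f * v i)"
begin

lemmas P = von_neumann_algebraD(1-7)[OF vnaP]

lemma f_comm: "a \<in> A \<Longrightarrow> f * a = a * f"
  using f_E[of a] f_E[of "adj a"] A(7) AB'
  by (intro compression_commutes f_proj) (simp_all add: E_id)

text \<open>The matrix is an explicit argument, so that sums, products and adjoints of matched pairs
  come with computed entries. Membership in \<open>M1\<close> and \<open>P\<close> is not demanded,
  since the matrix already implies it.\<close>

definition matched :: "'k bop \<Rightarrow> 'h bop \<Rightarrow> ('i \<Rightarrow> 'i \<Rightarrow> 'h bop) \<Rightarrow> bool" where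
  "matched T X a \<longleftrightarrow> (\<forall>i\<in>I. \<forall>j\<in>I. a i j \<in> A \<and> e * \<pi> (l i) * T * \<pi> (adj (l j)) * e = \<pi> (a i j) * e \<and>
     f * l i * X * adj (l j) * f = a i j * f)"

lemma matchedI:
  assumes "\<And>i j. i \<in> I \<Longrightarrow> j \<in> I \<Longrightarrow> a i j \<in> A"
    and "\<And>i j. i \<in> I \<Longrightarrow> j \<in> I \<Longrightarrow> e * \<pi> (l i) * T * \<pi> (adj (l j)) * e = \<pi> (a i j) * e"
    and "\<And>i j. i \<in> I \<Longrightarrow> j \<in> I \<Longrightarrow> f * l i * X * adj (l j) * f = a i j * f"
  shows "matched T X a"
  using assms by (simp add: matched_def)

lemma matchedD:
  assumes "matched T X a" "i \<in> I" "j \<in> I"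
  shows "a i j \<in> A" "e * \<pi> (l i) * T * \<pi> (adj (l j)) * e = \<pi> (a i j) * e"
    "f * l i * X * adj (l j) * f = a i j * f"
  using assms by (simp_all add: matched_def)

lemma insert_resolution:
  fixes x y :: "'z :: {semiring_0, monoid_mult}"
  assumes "(\<Sum>i\<in>I. u i) = 1"
  shows "x * y = (\<Sum>i\<in>I. x * u i * y)"
proof -
  have "x * y = x * (\<Sum>i\<in>I. u i) * y" using assms by simp
  then show ?thesis by (simp only: sum_distrib_left sum_distrib_right)
qed

lemma expand_e: "T = (\<Sum>i\<in>I. \<Sum>j\<in>I. \<pi> (adj (l i)) * (e * \<pi> (l i) * T * \<pi> (adj (l j)) * e) * \<pi> (l j))"
proof -
  have "T = (\<Sum>i\<in>I. \<pi> (adj (l i)) * e * \<pi> (l i)) * T * (\<Sum>j\<in>I. \<pi> (adj (l j)) * e * \<pi> (l j))"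
    by (simp only: resolution_e mult_1_left mult_1_right)
  then show ?thesis by (simp only: sum_distrib_left sum_distrib_right mult.assoc) (subst sum.swap)
qed

lemma expand_f: "X = (\<Sum>i\<in>I. \<Sum>j\<in>I. adj (l i) * (f * l i * X * adj (l j) * f) * l j)"
proof -
  have "X = (\<Sum>i\<in>I. adj (l i) * f * l i) * X * (\<Sum>j\<in>I. adj (l j) * f * l j)"
    by (simp only: resolution_f mult_1_left mult_1_right)
  then show ?thesis by (simp only: sum_distrib_left sum_distrib_right mult.assoc) (subst sum.swap)
qed

text \<open>Inserting the resolution of the identity on both sides recovers each operator from the
  matrix alone.\<close>

lemma matched_expand:
  assumes "matched T X a"
  shows "T = (\<Sum>i\<in>I. \<Sum>j\<in>I. \<pi> (adj (l i)) * (\<pi> (a i j) * e) * \<pi> (l j))"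
    and "X = (\<Sum>i\<in>I. \<Sum>j\<in>I. adj (l i) * (a i j * f) * l j)"
proof -
  have "(\<Sum>i\<in>I. \<Sum>j\<in>I. \<pi> (adj (l i)) * (e * \<pi> (l i) * T * \<pi> (adj (l j)) * e) * \<pi> (l j)) =
      (\<Sum>i\<in>I. \<Sum>j\<in>I. \<pi> (adj (l i)) * (\<pi> (a i j) * e) * \<pi> (l j))"
    by (intro sum.cong refl) (simp only: matchedD(2)[OF assms])
  then show "T = (\<Sum>i\<in>I. \<Sum>j\<in>I. \<pi> (adj (l i)) * (\<pi> (a i j) * e) * \<pi> (l j))"
    by (rule trans[OF expand_e])
  have "(\<Sum>i\<in>I. \<Sum>j\<in>I. adj (l i) * (f * l i * X * adj (l j) * f) * l j) =
      (\<Sum>i\<in>I. \<Sum>j\<in>I. adj (l i) * (a i j * f) * l j)"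
    by (intro sum.cong refl) (simp only: matchedD(3)[OF assms])
  then show "X = (\<Sum>i\<in>I. \<Sum>j\<in>I. adj (l i) * (a i j * f) * l j)"
    by (rule trans[OF expand_f])
qed

lemma matched_in:
  assumes "matched T X a"
  shows "T \<in> M1" "X \<in> P"
proof -
  have mem: "\<pi> (adj (l i)) * (\<pi> (a i j) * e) * \<pi> (l j) \<in> M1" "adj (l i) * (a i j * f) * l j \<in> P"
    if "i \<in> I" "j \<in> I" for i j
  proof -
    have m: "adj (l i) \<in> B" "l j \<in> B" "a i j \<in> B"
      using that l B(7) AB'[OF matchedD(1)[OF assms that]] by auto
    show "\<pi> (adj (l i)) * (\<pi> (a i j) * e) * \<pi> (l j) \<in> M1"
      by (intro M1(5) \<pi>_in_M1 e_in_M1 m)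
    show "adj (l i) * (a i j * f) * l j \<in> P"
      by (intro P(5) fP m[THEN subsetD[OF BP]])
  qed
  show "T \<in> M1" by (subst matched_expand(1)[OF assms]) (intro von_neumann_algebra_sum[OF vna_M1] mem)
  show "X \<in> P" by (subst matched_expand(2)[OF assms]) (intro von_neumann_algebra_sum[OF vnaP] mem)
qed

text \<open>\<open>T\<close> determines the matrix because \<open>a \<mapsto> \<pi> a * e\<close> is
  injective on \<open>A\<close>; this makes the future isomorphism a function.\<close>

lemma matched_unique_right:
  assumes "matched T X a" "matched T X' a'"
  shows "X = X'"
proof -
  have "a i j = a' i j" if ij: "i \<in> I" "j \<in> I" for i j
  proof -
    note m = matchedD[OF assms(1) ij] matchedD[OF assms(2) ij]
    have "\<pi> (a i j - a' i j) * e = 0"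
      using m AB' by (simp add: \<pi>_diff left_diff_distrib)
    then show ?thesis using \<pi>_e_inj[OF A(4)[OF m(1,4)]] by simp
  qed
  then show ?thesis
    using matched_expand(2)[OF assms(1)] matched_expand(2)[OF assms(2)] by simp
qed

text \<open>\<open>X\<close> determines the matrix by \<open>f_inj\<close>; this becomes injectivity
  of the isomorphism.\<close>

lemma matched_unique_left:
  assumes "matched T X a" "matched T' X a'"
  shows "T = T'"
proof -
  have "a i j = a' i j" if ij: "i \<in> I" "j \<in> I" for i j
  proof -
    note m = matchedD[OF assms(1) ij] matchedD[OF assms(2) ij]
    have "(a i j - a' i j) * f = 0"
      using m by (simp add: left_diff_distrib)
    then show ?thesis using f_inj[OF A(4)[OF m(1,4)]] by simp
  qed
  then show ?thesis
    using matched_expand(1)[OF assms(1)] matched_expand(1)[OF assms(2)] by simp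
qed

lemma matched_add:
  assumes "matched T X a" "matched S Y b"
  shows "matched (T + S) (X + Y) (\<lambda>i j. a i j + b i j)"
proof (rule matchedI)
  fix i j assume ij: "i \<in> I" "j \<in> I"
  note m = matchedD[OF assms(1) ij] matchedD[OF assms(2) ij]
  show "a i j + b i j \<in> A" by (intro A m)
  show "e * \<pi> (l i) * (T + S) * \<pi> (adj (l j)) * e = \<pi> (a i j + b i j) * e"
    using m AB' by (simp add: \<pi>_add distrib_left distrib_right)
  show "f * l i * (X + Y) * adj (l j) * f = (a i j + b i j) * f"
    using m by (simp add: distrib_left distrib_right)
qed

lemma matched_scaleC:
  assumes "matched T X a"
  shows "matched (c *\<^sub>C T) (c *\<^sub>C X) (\<lambda>i j. c *\<^sub>C a i j)"
proof (rule matchedI)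
  fix i j assume ij: "i \<in> I" "j \<in> I"
  note m = matchedD[OF assms(1) ij]
  show "c *\<^sub>C a i j \<in> A" by (intro A m)
  show "e * \<pi> (l i) * (c *\<^sub>C T) * \<pi> (adj (l j)) * e = \<pi> (c *\<^sub>C a i j) * e"
    using m AB' by (simp add: \<pi>_scaleC)
  show "f * l i * (c *\<^sub>C X) * adj (l j) * f = (c *\<^sub>C a i j) * f"
    using m by simp
qed

lemma matched_adj:
  assumes "matched T X a"
  shows "matched (adj T) (adj X) (\<lambda>i j. adj (a j i))"
proof (rule matchedI)
  fix i j assume ij: "i \<in> I" "j \<in> I"
  note m = matchedD[OF assms(1) ij(2,1)]
  show "adj (a j i) \<in> A" by (intro A m)
  have "e * \<pi> (l i) * adj T * \<pi> (adj (l j)) * e = adj (e * \<pi> (l j) * T * \<pi> (adj (l i)) * e)"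
    using l[OF ij(1)] l[OF ij(2)] B(7) by (simp add: e_projection adj_\<pi> mult.assoc)
  also have "\<dots> = \<pi> (adj (a j i)) * e"
    using m(1) A(7) AB' by (simp add: m(2) e_projection adj_\<pi> e_\<pi>)
  finally show "e * \<pi> (l i) * adj T * \<pi> (adj (l j)) * e = \<pi> (adj (a j i)) * e" .
  have "f * l i * adj X * adj (l j) * f = adj (f * l j * X * adj (l i) * f)"
    by (simp add: f_proj mult.assoc)
  also have "\<dots> = adj (a j i) * f"
    using m(1) A(7) by (simp add: m(3) f_proj f_comm)
  finally show "f * l i * adj X * adj (l j) * f = adj (a j i) * f" .
qed

lemma \<pi>_sum_e: "(\<And>j. j \<in> J \<Longrightarrow> g j \<in> B) \<Longrightarrow> \<pi> (\<Sum>j\<in>J. g j) * e = (\<Sum>j\<in>J. \<pi> (g j) * e)"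
proof (induction J rule: infinite_finite_induct)
  case (insert j J)
  then show ?case using von_neumann_algebra_sum[OF vna, of J g] by (simp add: \<pi>_add distrib_right)
qed (use \<pi>_diff[OF B(1) B(1)] in simp_all)

text \<open>Insert the resolution between the two factors and split its middle projection as
  \<open>e e\<close> or \<open>f f\<close>. Since both projections commute with \<open>A\<close>,
  composition becomes the matrix product over \<open>A\<close>, by the same formula on either
  side.\<close>

lemma matched_mult:
  assumes "matched T X a" "matched S Y b"
  shows "matched (T * S) (X * Y) (\<lambda>i k. \<Sum>j\<in>I. a i j * b j k)"
proof (rule matchedI)
  fix i k assume ik: "i \<in> I" "k \<in> I"
  have aA: "a i j \<in> A" "b j k \<in> A" if "j \<in> I" for j
    using matchedD(1)[OF assms(1) ik(1) that] matchedD(1)[OF assms(2) that ik(2)] .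
  show "(\<Sum>j\<in>I. a i j * b j k) \<in> A" by (intro von_neumann_algebra_sum[OF vnaA] A aA)
  have "e * \<pi> (l i) * (T * S) * \<pi> (adj (l k)) * e = (e * \<pi> (l i) * T) * (S * \<pi> (adj (l k)) * e)"
    by (simp only: mult.assoc)
  also have "\<dots> = (\<Sum>j\<in>I. (e * \<pi> (l i) * T) * (\<pi> (adj (l j)) * e * \<pi> (l j)) * (S * \<pi> (adj (l k)) * e))"
    by (rule insert_resolution[OF resolution_e])
  also have "\<dots> = (\<Sum>j\<in>I. \<pi> (a i j * b j k) * e)"
  proof (rule sum.cong[OF refl])
    fix j assume j: "j \<in> I"
    have "(e * \<pi> (l i) * T) * (\<pi> (adj (l j)) * e * \<pi> (l j)) * (S * \<pi> (adj (l k)) * e)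
        = (e * \<pi> (l i) * T * \<pi> (adj (l j)) * e) * (e * \<pi> (l j) * S * \<pi> (adj (l k)) * e)"
      using arg_cong[OF e_projection(2), of "\<lambda>x. (e * \<pi> (l i) * T * \<pi> (adj (l j))) * (x * (\<pi> (l j) * S * \<pi> (adj (l k)) * e))"]
      by (simp only: mult.assoc)
    also have "\<dots> = \<pi> (a i j) * e * (\<pi> (b j k) * e)"
      by (simp only: matchedD(2)[OF assms(1) ik(1) j] matchedD(2)[OF assms(2) j ik(2)])
    also have "\<dots> = \<pi> (a i j) * (e * \<pi> (b j k)) * e" by (simp only: mult.assoc)
    also have "\<dots> = \<pi> (a i j * b j k) * e"
      using aA[OF j] AB' by (simp add: e_\<pi> e_projection \<pi>_mult mult.assoc)
    finally show "(e * \<pi> (l i) * T) * (\<pi> (adj (l j)) * e * \<pi> (l j)) * (S * \<pi> (adj (l k)) * e) = \<pi> (a i j * b j k) * e" .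
  qed
  also have "\<dots> = \<pi> (\<Sum>j\<in>I. a i j * b j k) * e"
    by (rule \<pi>_sum_e[symmetric]) (intro B AB' aA)
  finally show "e * \<pi> (l i) * (T * S) * \<pi> (adj (l k)) * e = \<pi> (\<Sum>j\<in>I. a i j * b j k) * e" .
  have "f * l i * (X * Y) * adj (l k) * f = (f * l i * X) * (Y * adj (l k) * f)"
    by (simp only: mult.assoc)
  also have "\<dots> = (\<Sum>j\<in>I. (f * l i * X) * (adj (l j) * f * l j) * (Y * adj (l k) * f))"
    by (rule insert_resolution[OF resolution_f])
  also have "\<dots> = (\<Sum>j\<in>I. a i j * b j k * f)"
  proof (rule sum.cong[OF refl])
    fix j assume j: "j \<in> I"
    have "(f * l i * X) * (adj (l j) * f * l j) * (Y * adj (l k) * f)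
        = (f * l i * X * adj (l j) * f) * (f * l j * Y * adj (l k) * f)"
      using arg_cong[OF f_proj(2), of "\<lambda>x. (f * l i * X * adj (l j)) * (x * (l j * Y * adj (l k) * f))"]
      by (simp only: mult.assoc)
    also have "\<dots> = a i j * f * (b j k * f)"
      by (simp only: matchedD(3)[OF assms(1) ik(1) j] matchedD(3)[OF assms(2) j ik(2)])
    also have "\<dots> = a i j * (f * b j k) * f" by (simp only: mult.assoc)
    also have "\<dots> = a i j * b j k * f"
      using aA[OF j] by (simp add: f_comm f_proj mult.assoc)
    finally show "(f * l i * X) * (adj (l j) * f * l j) * (Y * adj (l k) * f) = a i j * b j k * f" .
  qed
  finally show "f * l i * (X * Y) * adj (l k) * f = (\<Sum>j\<in>I. a i j * b j k) * f"
    by (simp only: sum_distrib_right)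
qed

lemma matched_zero: "matched 0 0 (\<lambda>_ _. 0)"
  using A(2) \<pi>_diff[OF B(1) B(1)] by (intro matchedI) simp_all

lemma matched_sum: "(\<And>i. i \<in> J \<Longrightarrow> \<exists>a. matched (T i) (X i) a) \<Longrightarrow> \<exists>a. matched (\<Sum>i\<in>J. T i) (\<Sum>i\<in>J. X i) a"
proof (induction J rule: infinite_finite_induct)
  case (insert i J)
  then obtain a b where "matched (T i) (X i) a" "matched (\<Sum>i\<in>J. T i) (\<Sum>i\<in>J. X i) b" by blast
  from matched_add[OF this] show ?case using insert(1,2) by (intro exI) simp
qed (use matched_zero in \<open>simp, blast\<close>)+

lemma matched_\<pi>:
  assumes x: "x \<in> B"
  shows "matched (\<pi> x) x (\<lambda>i j. E (l i * x * adj (l j)))"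
proof (rule matchedI)
  fix i j assume ij: "i \<in> I" "j \<in> I"
  have mem: "l i * x * adj (l j) \<in> B" by (intro B l ij x)
  show "E (l i * x * adj (l j)) \<in> A" by (rule E_in[OF mem])
  show "e * \<pi> (l i) * \<pi> x * \<pi> (adj (l j)) * e = \<pi> (E (l i * x * adj (l j))) * e"
    using e_\<pi>_e[OF mem] l[OF ij(1)] l[OF ij(2)] x B by (simp add: \<pi>_mult mult.assoc)
  show "f * l i * x * adj (l j) * f = E (l i * x * adj (l j)) * f"
    using f_E[OF mem] by (simp add: mult.assoc)
qed

lemma matched_e: "matched e f (\<lambda>i j. E (l i) * E (adj (l j)))"
proof (rule matchedI)
  fix i j assume ij: "i \<in> I" "j \<in> I"
  have mem: "l i \<in> B" "adj (l j) \<in> B" by (intro B l ij)+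
  show "E (l i) * E (adj (l j)) \<in> A" by (intro A E_in mem)
  have "e * \<pi> (l i) * e * \<pi> (adj (l j)) * e = \<pi> (E (l i)) * (e * \<pi> (adj (l j)) * e)"
    using e_\<pi>_e[OF mem(1)] by (simp add: mult.assoc)
  then show "e * \<pi> (l i) * e * \<pi> (adj (l j)) * e = \<pi> (E (l i) * E (adj (l j))) * e"
    using e_\<pi>_e[OF mem(2)] mem E_inB by (simp add: \<pi>_mult mult.assoc)
  have "f * l i * f * adj (l j) * f = E (l i) * (f * adj (l j) * f)"
    using f_E[OF mem(1)] by (simp add: mult.assoc)
  then show "f * l i * f * adj (l j) * f = E (l i) * E (adj (l j)) * f"
    using f_E[OF mem(2)] by (simp add: mult.assoc)
qed

lemma matched_xey: "x \<in> B \<Longrightarrow> y \<in> B \<Longrightarrow> \<exists>a. matched (\<pi> x * e * \<pi> y) (x * f * y) a"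
  using matched_mult[OF matched_mult[OF matched_\<pi> matched_e] matched_\<pi>] by blast

text \<open>By \<open>M1_corner\<close> every \<open>T\<close> in the hull is a finite sum of terms
  \<open>\<pi> x * e * \<pi> y\<close>; the same sum with \<open>f\<close> in place of
  \<open>e\<close> is its partner.\<close>

lemma matched_left_total:
  assumes T: "T \<in> M1"
  shows "\<exists>X a. matched T X a"
proof -
  have "\<exists>a. a \<in> A \<and> e * (\<pi> (l i) * T * \<pi> (adj (l j))) * e = \<pi> a * e" if "i \<in> I" "j \<in> I" for i j
  proof -
    have "\<pi> (l i) * T * \<pi> (adj (l j)) \<in> M1" by (intro M1 \<pi>_in_M1 T B l that)
    from ex1_implies_ex[OF M1_corner[OF this]] show ?thesis .
  qed
  then obtain a where a: "\<And>i j. i \<in> I \<Longrightarrow> j \<in> I \<Longrightarrow> a i j \<in> A"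
    "\<And>i j. i \<in> I \<Longrightarrow> j \<in> I \<Longrightarrow> e * (\<pi> (l i) * T * \<pi> (adj (l j))) * e = \<pi> (a i j) * e" by metis
  have eq: "T = (\<Sum>i\<in>I. \<Sum>j\<in>I. \<pi> (adj (l i) * a i j) * e * \<pi> (l j))"
  proof (rule trans[OF expand_e], intro sum.cong refl)
    fix i j assume ij: "i \<in> I" "j \<in> I"
    have "e * \<pi> (l i) * T * \<pi> (adj (l j)) * e = \<pi> (a i j) * e"
      using a(2)[OF ij] by (simp only: mult.assoc)
    then show "\<pi> (adj (l i)) * (e * \<pi> (l i) * T * \<pi> (adj (l j)) * e) * \<pi> (l j) = \<pi> (adj (l i) * a i j) * e * \<pi> (l j)"
      using l[OF ij(1)] B(7) AB'[OF a(1)[OF ij]] by (simp add: \<pi>_mult mult.assoc)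
  qed
  have "\<exists>b. matched (\<Sum>i\<in>I. \<Sum>j\<in>I. \<pi> (adj (l i) * a i j) * e * \<pi> (l j)) (\<Sum>i\<in>I. \<Sum>j\<in>I. adj (l i) * a i j * f * l j) b"
    by (intro matched_sum matched_xey B l AB' a)
  then show ?thesis unfolding eq[symmetric] by blast
qed

text \<open>Here the finite sum of terms \<open>x f y\<close> is supplied by
  \<open>P_expand\<close>, and the partner is built with \<open>e\<close>.\<close>

lemma matched_right_total:
  assumes X: "X \<in> P"
  shows "\<exists>T a. matched T X a"
proof -
  obtain u v where uv: "\<And>i. i \<in> I \<Longrightarrow> u i \<in> B \<and> v i \<in> B" "X = (\<Sum>i\<in>I. u i * f * v i)"
    using P_expand[OF X] by blast
  have "\<exists>b. matched (\<Sum>i\<in>I. \<pi> (u i) * e * \<pi> (v i)) X b"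
    unfolding uv(2) by (intro matched_sum matched_xey) (use uv(1) in blast)+
  then show ?thesis by blast
qed

text \<open>Each homomorphism law is closure of matched pairs under that operation, followed by
  uniqueness on the right; totality on the two sides gives the domain and surjectivity.\<close>

theorem basic_construction_isomorphism: "\<exists>\<Phi>. star_isomorphism \<Phi> M1 P \<and> \<Phi> e = f"
proof -
  define \<Phi> where "\<Phi> T = (THE X. \<exists>a. matched T X a)" for T
  have \<Phi>_eq: "\<Phi> T = X" if "matched T X a" for T X a
    unfolding \<Phi>_def using that matched_unique_right by (intro the_equality) blast+
  have \<Phi>: "\<exists>a. matched T (\<Phi> T) a" if "T \<in> M1" for T
    using matched_left_total[OF that] \<Phi>_eq by blast
  have "star_isomorphism \<Phi> M1 P"
    unfolding star_isomorphism_def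
  proof (intro conjI ballI allI bij_betwI')
    fix S T assume S: "S \<in> M1" and T: "T \<in> M1"
    obtain a b where ab: "matched S (\<Phi> S) a" "matched T (\<Phi> T) b" using \<Phi>[OF S] \<Phi>[OF T] by blast
    show "\<Phi> S = \<Phi> T \<longleftrightarrow> S = T" using matched_unique_left[OF ab(1), of T b] ab(2) by auto
    show "\<Phi> (S + T) = \<Phi> S + \<Phi> T" by (rule \<Phi>_eq[OF matched_add[OF ab]])
    show "\<Phi> (S * T) = \<Phi> S * \<Phi> T" by (rule \<Phi>_eq[OF matched_mult[OF ab]])
  next
    fix T assume T: "T \<in> M1"
    obtain a where a: "matched T (\<Phi> T) a" using \<Phi>[OF T] by blast
    show "\<Phi> T \<in> P" by (rule matched_in[OF a])
    show "\<Phi> (c *\<^sub>C T) = c *\<^sub>C \<Phi> T" for c by (rule \<Phi>_eq[OF matched_scaleC[OF a]])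
    show "\<Phi> (adj T) = adj (\<Phi> T)" by (rule \<Phi>_eq[OF matched_adj[OF a]])
  next
    fix X assume X: "X \<in> P"
    obtain T a where T: "matched T X a" using matched_right_total[OF X] by blast
    show "\<exists>T\<in>M1. X = \<Phi> T" using matched_in(1)[OF T] \<Phi>_eq[OF T] by blast
  qed
  then show ?thesis using \<Phi>_eq[OF matched_e] by blast
qed

end

text \<open>For a factor \<open>A\<close>, the common kernel of all \<open>z \<in> A\<close> with \<open>z f = 0\<close> is invariant under \<open>A\<close> and
  under \<open>A'\<close>, so the projection onto it is a scalar; it fixes the range of \<open>f\<close>.\<close>

lemma factor_mult_injective:
  assumes A: "von_neumann_algebra A" and factor: "center A = range (\<lambda>c. c *\<^sub>C 1)"
    and f: "\<And>a. a \<in> A \<Longrightarrow> f * a = a * f" "f \<noteq> 0" and x: "x \<in> A" "x * f = 0"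
  shows "x = 0"
proof -
  define S where "S = {\<xi>. \<forall>z\<in>A. z * f = 0 \<longrightarrow> op_apply z \<xi> = 0}"
  have S: "csubspace S"
    by (rule csubspaceI) (auto simp: S_def op_zero op_add op_scaleC scaleC_zero_right)
  have cl: "closed S"
  proof -
    have "S = (\<Inter>z\<in>{z\<in>A. z * f = 0}. op_apply z -` {0})" by (auto simp: S_def)
    moreover have "closed (op_apply z -` {0})" for z
      using continuous_on_closed_vimage[of UNIV "op_apply z"] bounded_clinearD(6)[OF bounded_clinear_op_apply, of z]
      by auto
    ultimately show ?thesis by (auto intro: closed_INT)
  qed
  define q where "q = proj_onto S"
  note AD = von_neumann_algebraD[OF A]
  have invA: "op_apply y \<xi> \<in> S" if y: "y \<in> A" and \<xi>: "\<xi> \<in> S" for y \<xi>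
    unfolding S_def
  proof (intro CollectI ballI impI)
    fix z assume z: "z \<in> A" "z * f = 0"
    have "z * y * f = z * f * y" using f(1)[OF y] by (simp add: mult.assoc)
    then have "z * y * f = 0" using z by simp
    then have "op_apply (z * y) \<xi> = 0" using \<xi> AD(5)[OF z(1) y] unfolding S_def by blast
    then show "op_apply z (op_apply y \<xi>) = 0" by simp
  qed
  have invA': "op_apply y \<xi> \<in> S" if y: "y \<in> commutant A" and \<xi>: "\<xi> \<in> S" for y \<xi>
    unfolding S_def
  proof (intro CollectI ballI impI)
    fix z assume z: "z \<in> A" "z * f = 0"
    have "op_apply z \<xi> = 0" using \<xi> z unfolding S_def by blast
    moreover have "op_apply z (op_apply y \<xi>) = op_apply y (op_apply z \<xi>)"
      using commutantD[OF y z(1)] by (metis op_simps(4))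
    ultimately show "op_apply z (op_apply y \<xi>) = 0" by (simp add: op_zero)
  qed
  have adjA: "adj ` A \<subseteq> A" by (rule image_subsetI) (rule AD(7))
  have "q \<in> commutant A"
  proof (rule commutantI)
    fix y assume y: "y \<in> A"
    show "q * y = y * q" unfolding q_def
      by (rule projection_commutes[OF S cl, symmetric]) (rule invA[OF y] invA[OF AD(7)[OF y]], assumption)+
  qed
  moreover have "q \<in> commutant (commutant A)"
  proof (rule commutantI)
    fix y assume y: "y \<in> commutant A"
    show "q * y = y * q" unfolding q_def
      by (rule projection_commutes[OF S cl, symmetric])
        (rule invA'[OF y] invA'[OF commutant_adj[OF adjA y]], assumption)+
  qed
  ultimately have "q \<in> center A" by (simp add: center_def AD(8))
  then obtain c where c: "q = c *\<^sub>C 1" using factor by blast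
  have "q * f = f"
  proof (rule op_eqI)
    fix \<xi>
    have "op_apply f \<xi> \<in> S"
      unfolding S_def
    proof (intro CollectI ballI impI)
      fix z assume "z \<in> A" "z * f = 0"
      then show "op_apply z (op_apply f \<xi>) = 0" by (metis op_simps(4,6))
    qed
    then show "op_apply (q * f) \<xi> = op_apply f \<xi>" using proj_onto_mem(2)[OF S cl] by (simp add: q_def)
  qed
  then have cf: "c *\<^sub>C f = f" by (simp add: c)
  have "c \<noteq> 0" using cf f(2) by auto
  show ?thesis
  proof (rule op_eqI)
    fix \<xi>
    \<comment> \<open>A nonzero scalar projection has full range, so \<open>S\<close> is the whole
      space and \<open>x\<close> annihilates every vector.\<close>
    have "op_apply q (inverse c *\<^sub>C \<xi>) \<in> S" unfolding q_def by (rule proj_onto_mem(1)[OF S cl])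
    then have "\<xi> \<in> S" using \<open>c \<noteq> 0\<close> by (simp add: c scaleC_scaleC scaleC_one)
    then show "op_apply x \<xi> = op_apply 0 \<xi>" using x by (simp add: S_def)
  qed
qed

text \<open>What remains is to supply the assumptions of \<open>jones_pair\<close>: the basis of M/N
  gives the resolution by the Jones projection, and the basis of P/M gives
  \<open>P_expand\<close>.\<close>

theorem lemma3p4:
  fixes N M P :: "'h::complex_hilbert_space bop set"
    and tr tr_P :: "'h bop \<Rightarrow> complex"
    and \<Lambda> :: "'h bop \<Rightarrow> 'k::complex_hilbert_space"
    and \<Lambda>_P :: "'h bop \<Rightarrow> 'l::complex_hilbert_space"
    and \<tau> \<sigma> :: real
    and E_N E_M :: "'h bop \<Rightarrow> 'h bop"
    and n :: nat and lam :: "nat \<Rightarrow> 'h bop" and f :: "'h bop"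
  assumes cases:
      "(finite_index_II1_inclusion \<Lambda> N M \<and> finite_index_II1_inclusion \<Lambda>_P M P) \<or>
       (connected_findim_inclusion N M \<and> connected_findim_inclusion M P \<and>
          inj_on (\<lambda>x. x * f) N)"
    and tr: "faithful_normal_tracial_state M tr" "GNS_space M tr \<Lambda>"
      "markov_trace \<Lambda> N M tr \<tau>"
    and E_N: "conditional_expectation N M tr E_N"
    and basis: "is_basis \<Lambda> N M tr \<tau> E_N n lam"
    and tr_P: "faithful_normal_tracial_state P tr_P" "GNS_space P tr_P \<Lambda>_P"
      "markov_trace \<Lambda>_P M P tr_P \<sigma>"
    and E_M: "conditional_expectation M P tr_P E_M"
    and f: "f \<in> P" "is_projection f" "(\<Sum>i=1..n. adj (lam i) * f * lam i) = 1"
    and hyp1: "\<forall>x\<in>M. f * x * f = E_N x * f"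
    and hyp2: "is_basis \<Lambda>_P M P tr_P \<sigma> E_M n
                 (\<lambda>i. complex_of_real (\<tau> powr (- 1 / 2)) *\<^sub>C (f * lam i))"
  shows "\<exists>\<Phi>. star_isomorphism \<Phi> (basic_construction \<Lambda> N M) P \<and>
              \<Phi> (jones_projection \<Lambda> N) = f"
proof -
  have vna: "von_neumann_algebra N" "von_neumann_algebra M" "von_neumann_algebra P" "N \<subseteq> M" "M \<subseteq> P"
    using cases by (auto simp: finite_index_II1_inclusion_def II1_factor_def connected_findim_inclusion_def)
  interpret NM: gns_inclusion M tr \<Lambda> N E_N
    by unfold_locales (fact vna tr E_N)+
  interpret MP: gns_inclusion P tr_P \<Lambda>_P M E_M
    by unfold_locales (fact vna tr_P E_M)+
  have fp: "adj f = f" "f * f = f" using f(2) by (simp_all add: is_projection_def)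
  \<comment> \<open>\<open>E_N\<close> fixes N, so \<open>hyp1\<close> at \<open>a\<close> and at
    \<open>adj a\<close> gives both compressions.\<close>
  have comm: "f * a = a * f" if a: "a \<in> N" for a
    using hyp1 a NM.A(7)[OF a] NM.AB' by (intro compression_commutes fp) (simp_all add: NM.E_id)
  have inj: "a = 0" if a: "a \<in> N" "a * f = 0" for a
    using cases
  proof (elim disjE conjE)
    assume "finite_index_II1_inclusion \<Lambda> N M"
    then have "center N = range (\<lambda>c. c *\<^sub>C 1)"
      by (simp add: finite_index_II1_inclusion_def II1_factor_def)
    moreover have "f \<noteq> 0"
    \<comment> \<open>If \<open>f\<close> were 0, the resolution by \<open>f\<close> would read
      \<open>0 = 1\<close>, against \<open>tr 1 = 1\<close>.\<close>
    proof
      assume "f = 0"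
      then have "(0 :: 'h bop) = 1" using f(3) by simp
      then show False using NM.tr_zero NM.tr_one by simp
    qed
    ultimately show ?thesis using factor_mult_injective[OF vna(1) _ comm _ a] by blast
  next
    assume "inj_on (\<lambda>x. x * f) N"
    from inj_onD[OF this, of a 0] show ?thesis using a NM.A(2) by simp
  qed
  define c where "c = complex_of_real (\<tau> powr (- 1 / 2))"
  note lam = NM.is_basisD[OF tr(3) basis]
  note lamP = MP.is_basisD(2)[OF tr_P(3) hyp2, folded c_def]
  have "jones_pair M tr \<Lambda> N E_N {1..n} lam f P"
  proof unfold_locales
    \<comment> \<open>The basis of P/M expands \<open>x\<close> as the sum of
      \<open>E_M (x * adj (c f lam\<^sub>i))\<close> times \<open>c f lam\<^sub>i\<close>. Moving
      \<open>c\<close> to the left factor leaves a coefficient in M, then \<open>f\<close>, then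
      \<open>lam i\<close>.\<close>
    show "\<exists>u v. (\<forall>i\<in>{1..n}. u i \<in> M \<and> v i \<in> M) \<and> x = (\<Sum>i=1..n. u i * f * v i)" if x: "x \<in> P" for x
    proof (intro exI conjI ballI)
      fix i assume i: "i \<in> {1..n}"
      show "c *\<^sub>C E_M (x * adj (c *\<^sub>C (f * lam i))) \<in> M"
        using i lam(1)[OF i] vna(5) f(1) x by (intro MP.A MP.E_in MP.B) auto
      show "lam i \<in> M" by (rule lam(1)[OF i])
    next
      show "x = (\<Sum>i=1..n. c *\<^sub>C E_M (x * adj (c *\<^sub>C (f * lam i))) * f * lam i)"
        by (rule trans[OF lamP[OF x]]) (simp add: mult.assoc)
    qed
  qed (use lam(1,4) vna f fp hyp1 inj in auto)
  then show ?thesis by (rule jones_pair.basic_construction_isomorphism)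
qed

end
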